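(* Let $\kappa$ be an infinite cardinal and let $G=(V,E)$ be a bipartite graph with classes $A,B$ where $|A|=\kappa$. Suppose that $A$ is $(\mathcal A,\kappa)$-centered in $G$ for some $\mathcal A$. Then for any edge colouring $c:E\to r$ with $r\in\mathbb N$, the set $A$ is covered by the vertex sets of pairwise disjoint monochromatic paths of pairwise different colours.
   Context: For $F\subseteq V$ let $N_G[F]=\bigcap_{v\in F}N_G(v)$. For $A\subseteq V$, $A$ is $(\mathcal A,\kappa)$-centered in $G$ iff $\mathcal A=\{(A^i_\alpha)_{\alpha<\lambda_i}: i\in I\}$ for some finite set $I$ such that (1) $A^i_\alpha\subseteq A^i_\beta$ whenever $\alpha<\beta<\lambda_i$, $i\in I$; (2) $A\subseteq\bigcup_{\alpha<\lambda_i}A^i_\alpha$ for each $i\in I$; (3) $|N_G[\bigcap_{i\in I}A^i_{\alpha_i}]|\ge\kappa$ for every $(\alpha_i)_{i\in I}\in\prod_{i\in I}\lambda_i$ (for $I=\emptyset$ the intersection is understood as $A$). Paths are in the sense of Rado: a graph $P$ is a path iff there is a well ordering $\prec$ of $V(P)$ such that for every $v\in V(P)$ the set $\{w\in N_P(v):w\prec v\}$ is $\prec$-cofinal below $v$. A monochromatic path of colour $i$ is a subgraph of $(V,c^{-1}(i))$ that is a path; a single vertex is a path. *)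

theory Defs
  imports Main "HOL-Library.FuncSet" "HOL-Library.Disjoint_Sets"
begin

unbundle cardinal_syntax

text \<open>Simple graphs of arbitrary cardinality; an edge is a two-element set of vertices.\<close>

type_synonym 'a graph = "'a set \<times> 'a set set"

abbreviation verts :: "'a graph \<Rightarrow> 'a set" where
  "verts G \<equiv> fst G"

abbreviation edges :: "'a graph \<Rightarrow> 'a set set" where
  "edges G \<equiv> snd G"

definition is_graph :: "'a graph \<Rightarrow> bool" where
  "is_graph G \<longleftrightarrow> (\<forall>e \<in> edges G. e \<subseteq> verts G \<and> card e = 2)"

definition bipartite :: "'a graph \<Rightarrow> 'a set \<Rightarrow> 'a set \<Rightarrow> bool" where
  "bipartite G A B \<longleftrightarrow>
     is_graph G \<and> A \<inter> B = {} \<and> verts G = A \<union> B \<and>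
     (\<forall>e \<in> edges G. \<exists>a \<in> A. \<exists>b \<in> B. e = {a, b})"

definition nbh :: "'a graph \<Rightarrow> 'a \<Rightarrow> 'a set" where
  "nbh G v = {w \<in> verts G. {v, w} \<in> edges G}"

text \<open>\<open>N\<^sub>G[F]\<close>. The intersection is taken inside the vertex set, so \<open>N\<^sub>G[\<emptyset>]\<close> is the vertex set.\<close>

definition common_nbh :: "'a graph \<Rightarrow> 'a set \<Rightarrow> 'a set" where
  "common_nbh G F = verts G \<inter> (\<Inter>v \<in> F. nbh G v)"

text \<open>
  The family \<open>\<A> = {(A\<^sup>i\<^sub>\<alpha>)\<^sub>\<alpha>\<^sub><\<^sub>\<lambda>\<^sub>i : i \<in> I}\<close> is given by the index set \<open>I\<close>, the ordinals
  \<open>\<lambda>\<^sub>i\<close> as well-orders \<open>\<Lambda> i\<close> (whose field plays the role of \<open>{\<alpha>. \<alpha> < \<lambda>\<^sub>i}\<close>), and the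
  sets \<open>A\<^sup>i\<^sub>\<alpha> = \<S> i \<alpha>\<close>.
\<close>

definition centered ::
  "'a graph \<Rightarrow> 'a set \<Rightarrow> 'i set \<Rightarrow> ('i \<Rightarrow> 'o rel) \<Rightarrow> ('i \<Rightarrow> 'o \<Rightarrow> 'a set) \<Rightarrow> 'k rel \<Rightarrow> bool" where
  "centered G A I \<Lambda> \<S> \<kappa> \<longleftrightarrow>
     finite I \<and> (\<forall>i \<in> I. Well_order (\<Lambda> i)) \<and>
     (\<forall>i \<in> I. \<forall>\<beta> \<in> Field (\<Lambda> i). \<forall>\<alpha> \<in> underS (\<Lambda> i) \<beta>. \<S> i \<alpha> \<subseteq> \<S> i \<beta>) \<and>
     (\<forall>i \<in> I. A \<subseteq> (\<Union>\<alpha> \<in> Field (\<Lambda> i). \<S> i \<alpha>)) \<and>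
     (\<forall>\<alpha> \<in> (\<Pi>\<^sub>E i \<in> I. Field (\<Lambda> i)).
        \<kappa> \<le>o |common_nbh G (if I = {} then A else \<Inter>i \<in> I. \<S> i (\<alpha> i))| )"

text \<open>
  Paths in the sense of Rado. The last clause says that the neighbours of \<open>v\<close> preceding \<open>v\<close>
  are cofinal below \<open>v\<close>: \<open>w\<close> may coincide with \<open>u\<close>, as \<open>R\<close> is reflexive.
\<close>

definition rado_path :: "'a graph \<Rightarrow> bool" where
  "rado_path P \<longleftrightarrow>
     is_graph P \<and>
     (\<exists>R. well_order_on (verts P) R \<and>
        (\<forall>v \<in> verts P. \<forall>u \<in> underS R v. \<exists>w \<in> nbh P v \<inter> underS R v. (u, w) \<in> R))"

definition subgraph :: "'a graph \<Rightarrow> 'a graph \<Rightarrow> bool" where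
  "subgraph H G \<longleftrightarrow> is_graph H \<and> verts H \<subseteq> verts G \<and> edges H \<subseteq> edges G"

definition colour_graph :: "'a graph \<Rightarrow> ('a set \<Rightarrow> nat) \<Rightarrow> nat \<Rightarrow> 'a graph" where
  "colour_graph G c i = (verts G, {e \<in> edges G. c e = i})"

definition mono_path :: "'a graph \<Rightarrow> ('a set \<Rightarrow> nat) \<Rightarrow> nat \<Rightarrow> 'a graph \<Rightarrow> bool" where
  "mono_path G c i P \<longleftrightarrow> subgraph P (colour_graph G c i) \<and> rado_path P"

end

theory Submission
  imports Defs "HOL-Library.Equipollence"
begin

text \<open>
  The centering family is turned into a base of subsets of \<open>B\<close>, each of size at least \<open>|A|\<close>, indexed
  by a product of finitely many chains, such that every point of \<open>A\<close> is joined to all of some member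
  of the base. Choose a set \<open>X \<subseteq> A\<close> of full size, a finer base and a set \<open>K\<close> of colours such that every
  \<open>x \<in> X\<close> is joined to some member of the base in colours from \<open>K\<close> only, with \<open>K\<close> minimal. For
  \<open>k \<in> K\<close> let \<open>A'\<close> consist of the points of \<open>A\<close> with \<open>|A|\<close> many \<open>k\<close>-neighbours in each member of the base.
  Up to sets of size less than \<open>|A|\<close>, the remaining points are joined to members of the base in
  colours other than \<open>k\<close>, so induction on the number of colours applies to them, on a part of \<open>B\<close>
  split off beforehand.

  For a suitable \<open>k \<in> K\<close> the set \<open>A'\<close> is covered by a single path of colour \<open>k\<close>, a concatenation of
  \<open>cf |A|\<close> many blocks. By minimality of \<open>K\<close>, any point of \<open>A'\<close> has \<open>|A|\<close> many common \<open>k\<close>-neighbours with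
  almost every point of \<open>X\<close>, which yields the successor steps; moreover every subset of \<open>X\<close> of full size
  has a subset of size less than \<open>|A|\<close> that is hit by the \<open>k\<close>-neighbourhoods of almost all points of
  some member of the base, so if each block contains such a set, the limits of blocks can be passed.
  Limits inside a block come from induction on \<open>|A|\<close>, and the colour \<open>k\<close> is one for which such smaller
  pieces exist everywhere in \<open>X\<close>.
\<close>

subsection \<open>Cardinal arithmetic\<close>

text \<open>The class of bases indexed by finitely many chains is closed under adding a chain of
  length \<open>|A|\<close>, and this is what makes minimality usable: if a
  \<open>k\<close>-neighbourhood were too thin for \<open>|A|\<close> many points, or if no small
  part of \<open>X\<close> were seen by almost a whole member of the base, one more chain would give
  a finer base that captures \<open>|A|\<close> many points without \<open>k\<close>. The obstacle
  is limits, where one link must see earlier blocks cofinally. The hitting sets of earlier blocks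
  belong to different members of the base, and fewer than \<open>cf |A|\<close> of these have a
  common lower bound only after the base has been regularized chain by chain, at the price of
  passing to a subset of the blocks. The same regularization, applied to a subset of
  \<open>X\<close> of size \<open>|M|^+\<close>, puts \<open>|M|\<close> many points over a single
  member of the base; pieces of every infinite size below \<open>|A|\<close> arise in this
  way.\<close>

lemma lepoll_iff_card_of: "A \<lesssim> B \<longleftrightarrow> card_of A \<le>o card_of B"
  by (simp add: card_of_ordLeq[symmetric] lepoll_def)

lemma not_lepoll_iff: "\<not> A \<lesssim> B \<longleftrightarrow> B \<prec> A"
proof
  assume "\<not> A \<lesssim> B"
  moreover have "A \<lesssim> B \<or> B \<lesssim> A"
    unfolding lepoll_iff_card_of by (rule ordLeq_total) (rule card_of_Well_order)+
  ultimately show "B \<prec> A" unfolding lesspoll_def using eqpoll_imp_lepoll eqpoll_sym by blast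
next
  assume "B \<prec> A"
  then show "\<not> A \<lesssim> B" unfolding lesspoll_def using lepoll_antisym by blast
qed

lemma lesspoll_iff_card_of: "A \<prec> B \<longleftrightarrow> card_of A <o card_of B"
proof -
  have "card_of A <o card_of B \<longleftrightarrow> \<not> card_of B \<le>o card_of A"
    using not_ordLess_iff_ordLeq[OF card_of_Well_order card_of_Well_order] by blast
  then show ?thesis unfolding lepoll_iff_card_of[symmetric] not_lepoll_iff by simp
qed

lemma subset_lesspoll: "A \<subseteq> B \<Longrightarrow> B \<prec> C \<Longrightarrow> A \<prec> C"
  using lesspoll_trans1 subset_imp_lepoll by blast

lemma lesspoll_subset: "A \<prec> B \<Longrightarrow> B \<subseteq> C \<Longrightarrow> A \<prec> C"
  using lesspoll_trans2 subset_imp_lepoll by blast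

lemma lepoll_subset: "A \<lesssim> B \<Longrightarrow> B \<subseteq> C \<Longrightarrow> A \<lesssim> C"
  using lepoll_trans subset_imp_lepoll by blast

lemma Un_lesspoll:
  assumes "infinite C" "A \<prec> C" "B \<prec> C" shows "A \<union> B \<prec> C"
  using card_of_Un_ordLess_infinite assms by (simp add: lesspoll_iff_card_of)

lemma UN_lepoll:
  assumes "infinite M" "I \<lesssim> M" "\<And>i. i \<in> I \<Longrightarrow> F i \<lesssim> M"
  shows "(\<Union>i\<in>I. F i) \<lesssim> M"
  using card_of_UNION_ordLeq_infinite[of M I F] assms by (simp add: lepoll_iff_card_of)

lemma Un_lepoll:
  assumes "infinite M" "A \<lesssim> M" "B \<lesssim> M" shows "A \<union> B \<lesssim> M"
proof -
  have "(\<Union>i\<in>{True,False}. if i then A else B) \<lesssim> M"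
    using assms by (intro UN_lepoll) (auto intro: finite_lepoll_infinite)
  then show ?thesis by (simp add: Un_commute)
qed

text \<open>The uniform bound \<open>M\<close> matters: when \<open>|C|\<close> is singular, fewer
  than \<open>|C|\<close> smaller sets can have a union of full size.\<close>

lemma UN_lesspoll:
  assumes "infinite C" "I \<prec> C" "M \<prec> C" "\<And>i. i \<in> I \<Longrightarrow> F i \<lesssim> M"
  shows "(\<Union>i\<in>I. F i) \<prec> C"
proof (cases "finite I \<and> finite M")
  case True
  then have "finite (\<Union>i\<in>I. F i)"
    using assms(4) by (metis card_of_ordLeq_finite finite_UN lepoll_iff_card_of)
  then show ?thesis using assms(1) finite_lesspoll_infinite by blast
next
  case False
  have IM: "I <+> M \<prec> C"
    using assms card_of_Plus_ordLess_infinite by (auto simp: lesspoll_iff_card_of)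
  have "I \<lesssim> I <+> M" "M \<lesssim> I <+> M"
    by (auto simp: lepoll_iff_card_of card_of_Plus1 card_of_Plus2)
  moreover have "infinite (I <+> M)" using False by simp
  ultimately have "(\<Union>i\<in>I. F i) \<lesssim> I <+> M"
    using assms(4) by (meson UN_lepoll lepoll_trans)
  then show ?thesis using IM lesspoll_trans1 by blast
qed

lemma finite_UN_lesspoll:
  assumes "infinite C" "finite I" "\<And>i. i \<in> I \<Longrightarrow> F i \<prec> C"
  shows "(\<Union>i\<in>I. F i) \<prec> C"
  using assms(2,3)
proof induction
  case empty
  then show ?case using finite_lesspoll_infinite[OF assms(1), of "{}"] by simp
next
  case (insert x I)
  then show ?case using Un_lesspoll[OF assms(1), of "F x" "\<Union> (F ` I)"] by simp
qed

lemma lepoll_Diff: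
  assumes "infinite C" "C \<lesssim> E" "D \<prec> C" shows "C \<lesssim> E - D"
proof (rule ccontr)
  assume "\<not> C \<lesssim> E - D"
  then have "(E - D) \<union> D \<prec> C" using Un_lesspoll assms not_lepoll_iff by blast
  moreover have "E \<lesssim> (E - D) \<union> D" by (rule subset_imp_lepoll) blast
  ultimately have "E \<prec> C" using lesspoll_trans1 by blast
  then show False using assms(2) not_lepoll_iff by blast
qed

lemma eqpoll_Diff:
  assumes "infinite C" "E \<approx> C" "D \<prec> C" shows "E - D \<approx> C"
proof (rule lepoll_antisym)
  have "E - D \<lesssim> E" by (simp add: subset_imp_lepoll)
  then show "E - D \<lesssim> C" using assms(2) lepoll_trans2 by blast
  have "C \<lesssim> E" using assms(2) eqpoll_sym eqpoll_imp_lepoll by blast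
  then show "C \<lesssim> E - D" using assms lepoll_Diff by blast
qed

lemma split_infinite:
  assumes "infinite X"
  obtains X1 X2 where "X1 \<union> X2 = X" "X1 \<inter> X2 = {}" "X1 \<approx> X" "X2 \<approx> X"
proof -
  have "(UNIV::bool set) \<lesssim> X" by (simp add: assms finite_lepoll_infinite)
  then have "X \<times> (UNIV::bool set) \<approx> X"
    using card_of_Times_infinite[OF assms, of "UNIV::bool set"]
    by (simp add: eqpoll_iff_card_of_ordIso lepoll_iff_card_of)
  then obtain f where f: "bij_betw f (X \<times> (UNIV::bool set)) X" unfolding eqpoll_def by blast
  let ?h = "\<lambda>i x. f (x, i)"
  have inj: "inj_on (?h i) X" for i using f by (auto simp: bij_betw_def inj_on_def)
  show thesis
  proof
    have X: "f ` (X \<times> UNIV) = X" using f by (simp add: bij_betw_def)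
    have "X \<times> (UNIV :: bool set) = (\<lambda>x. (x, True)) ` X \<union> (\<lambda>x. (x, False)) ` X" by (auto simp: UNIV_bool)
    then have "f ` (X \<times> UNIV) = ?h True ` X \<union> ?h False ` X" by (simp add: image_Un image_image)
    then show "?h True ` X \<union> ?h False ` X = X" using X by simp
    show "?h True ` X \<inter> ?h False ` X = {}" using f by (auto simp: bij_betw_def inj_on_def)
    show "?h True ` X \<approx> X" "?h False ` X \<approx> X" using inj inj_on_image_eqpoll_self by blast+
  qed
qed

text \<open>\<open>card_of A\<close> has the least possible order type, so its proper initial
  segments can stand for the cardinals below \<open>|A|\<close>.\<close>

lemma underS_card_of: "u \<in> A \<Longrightarrow> underS (card_of A) u \<prec> A"
  using card_of_underS[OF card_of_Card_order, of u A] by (simp add: lesspoll_iff_card_of Field_card_of)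

lemma wf_card_of: "wf ( (card_of A) - Id)"
  using card_of_Well_order by (metis well_order_on_def)

lemma in_card_of: "(x, y) \<in> (card_of A) \<Longrightarrow> x \<in> A \<and> y \<in> A"
  by (metis Field_card_of FieldI1 FieldI2)

lemma card_of_linear: "refl_on A (card_of A)" "trans (card_of A)" "antisym (card_of A)" "total_on A (card_of A)"
  using card_of_Well_order[of A]
  by (auto simp: well_order_on_def linear_order_on_def partial_order_on_def preorder_on_def Field_card_of)

lemma card_of_cases:
  assumes "x \<in> A" "y \<in> A" shows "(x, y) \<in> (card_of A) \<or> (y, x) \<in> (card_of A)"
  using card_of_linear(1,4)[of A] assms by (metis refl_onD total_on_def)

lemma lesspoll_imp_underS:
  assumes "B \<prec> A" obtains u where "u \<in> A" "B \<lesssim> underS (card_of A) u"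
proof -
  have "card_of B <o card_of A" using assms lesspoll_iff_card_of by blast
  then have "\<exists>u\<in>Field (card_of A). card_of B =o Restr (card_of A) (underS (card_of A) u)"
    by (rule iffD1[OF ordLess_iff_ordIso_Restr[OF card_of_Well_order card_of_Well_order]])
  then obtain u where u: "u \<in> A" "card_of B =o Restr (card_of A) (underS (card_of A) u)"
    unfolding Field_card_of by (rule bexE)
  have "card_of (Field (card_of B)) =o card_of (Field (Restr (card_of A) (underS (card_of A) u)))"
    by (rule card_of_cong[OF u(2)])
  then have "B \<lesssim> Field (Restr (card_of A) (underS (card_of A) u))"
    unfolding Field_card_of eqpoll_iff_card_of_ordIso[symmetric] by (rule eqpoll_imp_lepoll)
  also have "Field (Restr (card_of A) (underS (card_of A) u)) \<lesssim> underS (card_of A) u"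
    by (rule subset_imp_lepoll) (auto simp: Field_def)
  finally show thesis using that u(1) by blast
qed

text \<open>Transfinite greedy choice: at each step fewer than \<open>|C|\<close> values are forbidden.\<close>

lemma injective_choice:
  assumes "infinite C" "T \<lesssim> C" "Q \<prec> C" "\<And>t. t \<in> T \<Longrightarrow> C \<lesssim> S t"
  obtains f where "inj_on f T" "\<And>t. t \<in> T \<Longrightarrow> f t \<in> S t - Q"
proof -
  let ?R = "(card_of T) - Id"
  define P where "P = (\<lambda>f t y. t \<in> T \<longrightarrow> y \<in> S t - Q \<and> (\<forall>s. (s, t) \<in> ?R \<longrightarrow> y \<noteq> f s))"
  have "\<exists>f. \<forall>t. P f t (f t)"
  proof (rule dependent_wf_choice[OF wf_card_of[of T]])
    show "P f x r = P g x r" if "\<And>z. (z, x) \<in> ?R \<Longrightarrow> f z = g z" for f g x r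
      using that unfolding P_def by metis
    show "\<exists>r. P f x r" for f x
    proof (cases "x \<in> T")
      case True
      have "underS (card_of T) x \<prec> C" using underS_card_of[OF True] assms(2) lesspoll_trans2 by blast
      then have "f ` underS (card_of T) x \<prec> C" using image_lepoll lesspoll_trans1 by blast
      then have "Q \<union> f ` underS (card_of T) x \<prec> C" using assms Un_lesspoll by blast
      then have "C \<lesssim> S x - (Q \<union> f ` underS (card_of T) x)" using lepoll_Diff assms True by blast
      then have "S x - (Q \<union> f ` underS (card_of T) x) \<noteq> {}" using assms(1) by force
      then show ?thesis unfolding P_def underS_def by blast
    qed (simp add: P_def)
  qed
  then obtain f where f: "\<And>t. P f t (f t)" by blast
  have "inj_on f T"
  proof (rule inj_onI, rule ccontr)
    fix x y assume "x \<in> T" "y \<in> T" "f x = f y" "x \<noteq> y"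
    then show False using f[of x] f[of y] card_of_cases[of x T y] by (auto simp: P_def)
  qed
  then show thesis using that f unfolding P_def by blast
qed

lemma infinite_product_lepoll:
  assumes "infinite C" "A \<lesssim> C" "B \<lesssim> C" shows "A \<times> B \<lesssim> C"
proof -
  have "A \<times> B \<lesssim> C \<times> C" using assms times_lepoll_mono by blast
  also have "C \<times> C \<approx> C"
    using card_of_Times_same_infinite assms(1) by (simp add: eqpoll_iff_card_of_ordIso)
  finally show ?thesis .
qed

text \<open>Distinct values are chosen for all triples \<open>(P, a, i)\<close>, which reserves two
  disjoint copies of \<open>C\<close> in every \<open>P\<close>, disjoint also for different
  \<open>P\<close>. \<open>H\<close> collects the copies with \<open>i = True\<close>.\<close>

lemma splitting_set:
  assumes "infinite C" "\<P> \<lesssim> C" "\<And>P. P \<in> \<P> \<Longrightarrow> C \<lesssim> P"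
  obtains H where "\<And>P. P \<in> \<P> \<Longrightarrow> C \<lesssim> P \<inter> H" "\<And>P. P \<in> \<P> \<Longrightarrow> C \<lesssim> P - H"
proof -
  let ?T = "\<P> \<times> (C \<times> (UNIV :: bool set))"
  have "?T \<lesssim> C"
    using assms by (intro infinite_product_lepoll) (auto intro: finite_lepoll_infinite)
  moreover have "{} \<prec> C" using assms(1) by (simp add: finite_lesspoll_infinite)
  ultimately obtain f where f: "inj_on f ?T" "\<And>t. t \<in> ?T \<Longrightarrow> f t \<in> fst t - {}"
    using injective_choice[OF assms(1), of ?T "{}" fst] assms(3) by (metis mem_Times_iff)
  define H where "H = f ` (\<P> \<times> (C \<times> {True}))"
  have 1: "C \<lesssim> P \<inter> H" if "P \<in> \<P>" for P
    unfolding lepoll_def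
    by (rule exI[of _ "\<lambda>a. f (P, a, True)"])
      (use f that in \<open>auto simp: H_def inj_on_def\<close>)
  have 2: "C \<lesssim> P - H" if "P \<in> \<P>" for P
    unfolding lepoll_def
  proof (intro exI[of _ "\<lambda>a. f (P, a, False)"] conjI)
    show "inj_on (\<lambda>a. f (P, a, False)) C" using f(1) that by (auto simp: inj_on_def)
    have "f (P, a, False) \<notin> H" if "a \<in> C" for a
      using inj_on_image_mem_iff[OF f(1), of "(P, a, False)"] \<open>P \<in> \<P>\<close> that by (auto simp: H_def)
    then show "(\<lambda>a. f (P, a, False)) ` C \<subseteq> P - H" using f(2) that by auto
  qed
  show thesis using that 1 2 by blast
qed

subsection \<open>Filtrations and cofinal subsets\<close>

text \<open>Plain initial segments would not do: if \<open>|A|\<close> is singular, the sizes of the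
  \<open>e y\<close> below a point need not have a common bound smaller than \<open>|A|\<close>.
  Hence \<open>V u\<close> admits \<open>y\<close> only once \<open>e y\<close> is no larger than
  the segment below \<open>u\<close>.\<close>

lemma exhaustion:
  assumes A: "infinite A" "Y \<subseteq> A" and e: "\<And>y. y \<in> Y \<Longrightarrow> e y \<prec> A"
  obtains V where
    "\<And>u v. (u, v) \<in> card_of A \<Longrightarrow> V u \<subseteq> V v" "Y = (\<Union>u\<in>A. V u)"
    "\<And>u. u \<in> A \<Longrightarrow> V u \<prec> A" "\<And>u. u \<in> A \<Longrightarrow> (\<Union>y\<in>V u. e y) \<prec> A"
proof
  let ?r = "card_of A"
  define V where "V = (\<lambda>u. {y\<in>Y. (y, u) \<in> ?r \<and> e y \<lesssim> underS ?r u})"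
  have mono: "underS ?r u \<subseteq> underS ?r v" if "(u, v) \<in> ?r" for u v
    using that card_of_linear(2,3)[of A] unfolding underS_def trans_def antisym_def by blast
  show "V u \<subseteq> V v" if "(u, v) \<in> ?r" for u v
    using that mono[OF that] card_of_linear(2)[of A] lepoll_trans[OF _ subset_imp_lepoll]
    unfolding V_def trans_def by blast
  have "y \<in> (\<Union>u\<in>A. V u)" if y: "y \<in> Y" for y
  proof -
    obtain u where u: "u \<in> A" "e y \<lesssim> underS ?r u" using lesspoll_imp_underS e y by blast
    have yA: "y \<in> A" using y A by blast
    from card_of_cases[OF u(1) yA] show ?thesis
    proof
      assume uy: "(u, y) \<in> ?r"
      then have "e y \<lesssim> underS ?r y" using u(2) mono lepoll_trans subset_imp_lepoll by meson
      moreover have "(y, y) \<in> ?r" using card_of_linear(1) yA refl_onD by metis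
      ultimately have "y \<in> V y" unfolding V_def using y by blast
      then show ?thesis using yA by blast
    next
      assume "(y, u) \<in> ?r"
      then have "y \<in> V u" unfolding V_def using y u(2) by blast
      then show ?thesis using u(1) by blast
    qed
  qed
  then show "Y = (\<Union>u\<in>A. V u)" unfolding V_def by blast
  have under: "underS ?r u \<prec> A" if "u \<in> A" for u using underS_card_of that .
  show V: "V u \<prec> A" if "u \<in> A" for u
  proof -
    have "V u \<subseteq> underS ?r u \<union> {u}" unfolding V_def underS_def by blast
    moreover have "underS ?r u \<union> {u} \<prec> A"
      by (rule Un_lesspoll[OF A(1) under[OF that] finite_lesspoll_infinite[OF A(1)]]) simp
    ultimately show ?thesis using lesspoll_trans1 subset_imp_lepoll by blast
  qed
  show "(\<Union>y\<in>V u. e y) \<prec> A" if "u \<in> A" for u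
    by (rule UN_lesspoll[OF A(1) V[OF that] under[OF that]]) (simp add: V_def)
qed

text \<open>Thus \<open>|C|\<close> is the cofinality of the order \<open>card_of A\<close>, and
  \<open>C\<close> is listed in the order type of that cardinal.\<close>

definition regular_cofinal :: "'a set \<Rightarrow> 'a set \<Rightarrow> bool" where
  "regular_cofinal A C \<longleftrightarrow> C \<subseteq> A \<and> (\<forall>u\<in>A. \<exists>c\<in>C. (u, c) \<in> card_of A) \<and>
     (\<forall>c\<in>C. {d\<in>C. (d, c) \<in> card_of A \<and> d \<noteq> c} \<prec> C) \<and>
     (\<forall>S\<subseteq>A. S \<prec> C \<longrightarrow> (\<exists>u\<in>A. \<forall>s\<in>S. (s, u) \<in> card_of A))"

text \<open>From a cofinal set \<open>D\<close> of least size keep those \<open>d\<close> that lie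
  above everything preceding them in a listing of type \<open>|D|\<close>. On \<open>C\<close> the
  order of \<open>A\<close> agrees with the listing, so initial segments are small. \<open>C\<close>
  is still cofinal, since the first listed element above a given \<open>u\<close> is kept.\<close>

lemma regular_cofinal_exists: "\<exists>C. regular_cofinal A C"
proof -
  let ?r = "card_of A"
  define cof where "cof = (\<lambda>D. D \<subseteq> A \<and> (\<forall>u\<in>A. \<exists>c\<in>D. (u, c) \<in> ?r))"
  have "cof A" unfolding cof_def using card_of_linear(1) refl_onD by fastforce
  then have "\<exists>r\<in>card_of ` Collect cof. \<forall>r'\<in>card_of ` Collect cof. r \<le>o r'"
    by (intro exists_minim_Card_order) (auto simp: card_of_Card_order)
  then obtain D where D: "cof D" "\<And>D'. cof D' \<Longrightarrow> D \<lesssim> D'"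
    unfolding lepoll_iff_card_of by blast
  define C where "C = {d\<in>D. \<forall>e\<in>D. (e, d) \<in> card_of D \<longrightarrow> (e, d) \<in> ?r}"
  have CD: "C \<subseteq> D" unfolding C_def by blast
  have tr: "trans ?r" and an: "antisym ?r" by (rule card_of_linear)+
  have "cof C" unfolding cof_def
  proof (intro conjI ballI)
    show "C \<subseteq> A" using CD D(1) unfolding cof_def by blast
    fix u assume u: "u \<in> A"
    then obtain d0 where "d0 \<in> {d\<in>D. (u, d) \<in> ?r}" using D(1) unfolding cof_def by blast
    then obtain d where d: "d \<in> {d\<in>D. (u, d) \<in> ?r}"
      "\<And>e. (e, d) \<in> card_of D - Id \<Longrightarrow> e \<notin> {d\<in>D. (u, d) \<in> ?r}"
      by (rule wfE_min[OF wf_card_of[of D]]) blast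
    have "(e, d) \<in> ?r" if e: "e \<in> D" "(e, d) \<in> card_of D" for e
    proof (cases "e = d")
      case True
      then show ?thesis using d(1) card_of_linear(1)[of A] in_card_of refl_onD by fastforce
    next
      case False
      then have "(u, e) \<notin> ?r" using d(2) e by blast
      moreover have "e \<in> A" using e(1) D(1) unfolding cof_def by blast
      ultimately have "(e, u) \<in> ?r" using card_of_cases u by metis
      then show ?thesis using d(1) tr unfolding trans_def by blast
    qed
    then show "\<exists>c\<in>C. (u, c) \<in> ?r" using d(1) unfolding C_def by blast
  qed
  then have "D \<lesssim> C" by (rule D(2))
  have "{d\<in>C. (d, c) \<in> ?r \<and> d \<noteq> c} \<prec> C" if c: "c \<in> C" for c
  proof -
    have "{d\<in>C. (d, c) \<in> ?r \<and> d \<noteq> c} \<subseteq> underS (card_of D) c"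
    proof
      fix d assume d: "d \<in> {d\<in>C. (d, c) \<in> ?r \<and> d \<noteq> c}"
      then have "(c, d) \<notin> ?r" using an unfolding antisym_def by blast
      then have "(c, d) \<notin> card_of D" using d c CD unfolding C_def by blast
      then have "(d, c) \<in> card_of D" using card_of_cases[of d D c] d c CD by blast
      then show "d \<in> underS (card_of D) c" using d unfolding underS_def by blast
    qed
    then have "{d\<in>C. (d, c) \<in> ?r \<and> d \<noteq> c} \<prec> D"
      by (rule subset_lesspoll) (rule underS_card_of, use c CD in blast)
    then show ?thesis using \<open>D \<lesssim> C\<close> by (rule lesspoll_trans2)
  qed
  moreover have "\<exists>u\<in>A. \<forall>s\<in>S. (s, u) \<in> ?r" if S: "S \<subseteq> A" "S \<prec> C" for S
  proof -
    have "S \<prec> D" using S(2) CD by (rule lesspoll_subset)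
    then have "\<not> cof S" using D(2) not_lepoll_iff by blast
    then obtain u where u: "u \<in> A" "\<And>s. s \<in> S \<Longrightarrow> (u, s) \<notin> ?r" using S unfolding cof_def by blast
    then have "(s, u) \<in> ?r" if "s \<in> S" for s using card_of_cases[of s A u] that S(1) by blast
    then show ?thesis using u(1) by blast
  qed
  ultimately show ?thesis
    using \<open>cof C\<close> unfolding cof_def regular_cofinal_def by blast
qed

text \<open>The sizes are measured by segments below points \<open>u j\<close>. Fewer than
  \<open>|C|\<close> such points are bounded in \<open>A\<close>, and a bound supplies the uniform
  size that \<open>UN_lesspoll\<close> asks for.\<close>

lemma regular_cofinal_UN_lesspoll:
  assumes "regular_cofinal A C" "infinite A" "S \<prec> C" "\<And>j. j \<in> S \<Longrightarrow> F j \<prec> A"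
  shows "(\<Union>j\<in>S. F j) \<prec> A"
proof -
  have "\<forall>j\<in>S. \<exists>u\<in>A. F j \<lesssim> underS (card_of A) u"
    using lesspoll_imp_underS assms(4) by meson
  then obtain u where u: "\<And>j. j \<in> S \<Longrightarrow> u j \<in> A" "\<And>j. j \<in> S \<Longrightarrow> F j \<lesssim> underS (card_of A) (u j)"
    by metis
  have "u ` S \<prec> C" using assms(3) image_lepoll lesspoll_trans1 by blast
  moreover have "u ` S \<subseteq> A" using u by blast
  ultimately have "\<exists>v\<in>A. \<forall>s\<in>u ` S. (s, v) \<in> card_of A"
    using assms(1) unfolding regular_cofinal_def by blast
  then obtain v where v: "v \<in> A" "\<And>j. j \<in> S \<Longrightarrow> (u j, v) \<in> card_of A" by blast
  have "underS (card_of A) (u j) \<subseteq> underS (card_of A) v" if "j \<in> S" for j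
    using v(2)[OF that] card_of_linear(2,3)[of A] unfolding underS_def trans_def antisym_def by blast
  then have "F j \<lesssim> underS (card_of A) v" if "j \<in> S" for j
    using lepoll_subset[OF u(2)] that by blast
  moreover have "S \<prec> A"
    using lesspoll_subset[OF assms(3)] assms(1) unfolding regular_cofinal_def by blast
  ultimately show ?thesis using UN_lesspoll[OF assms(2) _ underS_card_of[OF v(1)]] by blast
qed

text \<open>For infinite \<open>X\<close> this says that \<open>|J|\<close> is less than the cofinality of \<open>|X|\<close>.\<close>

definition too_few :: "'x set \<Rightarrow> 'j set \<Rightarrow> bool" where
  "too_few X J \<longleftrightarrow> (\<forall>Y. (\<forall>j\<in>J. Y j \<prec> X) \<longrightarrow> \<not> X \<subseteq> (\<Union>j\<in>J. Y j))"

lemma too_few_image: "too_few X J \<Longrightarrow> too_few X (g ` J)"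
  unfolding too_few_def
proof (intro allI impI notI)
  fix Y assume a: "\<forall>Y. (\<forall>j\<in>J. Y j \<prec> X) \<longrightarrow> \<not> X \<subseteq> (\<Union>j\<in>J. Y j)"
    "\<forall>j\<in>g ` J. Y j \<prec> X" "X \<subseteq> (\<Union>j\<in>g ` J. Y j)"
  then show False using spec[OF a(1), of "\<lambda>j. Y (g j)"] by auto
qed

lemma too_few_eqpoll:
  assumes "X \<approx> Z" "too_few X J" shows "too_few Z J"
  unfolding too_few_def
proof (intro allI impI notI)
  fix Y assume Y: "\<forall>j\<in>J. Y j \<prec> Z" "Z \<subseteq> (\<Union>j\<in>J. Y j)"
  obtain h where h: "bij_betw h X Z" using assms(1) unfolding eqpoll_def by blast
  define Y' where "Y' = (\<lambda>j. {x\<in>X. h x \<in> Y j})"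
  have "Y' j \<prec> X" if "j \<in> J" for j
  proof -
    have "Y' j \<lesssim> Y j" unfolding lepoll_def Y'_def
      by (rule exI[of _ h]) (use h in \<open>auto simp: bij_betw_def inj_on_def\<close>)
    then show ?thesis using Y(1) that assms(1) eqpoll_sym lesspoll_trans1 lesspoll_eq_trans by blast
  qed
  moreover have "X \<subseteq> (\<Union>j\<in>J. Y' j)"
    using Y(2) h unfolding Y'_def bij_betw_def by blast
  ultimately show False using assms(2) unfolding too_few_def by blast
qed

text \<open>Regularity of the cofinality: a cover of \<open>C\<close> by fewer than
  \<open>|C|\<close> smaller sets would bound \<open>C\<close> piece by piece and then as a whole,
  although \<open>C\<close> is cofinal in an order without last element.\<close>

lemma regular_cofinal_too_few:
  assumes "regular_cofinal A C" "infinite A" "S \<prec> C"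
  shows "too_few C S"
  unfolding too_few_def
proof (intro allI impI notI)
  fix Y assume Y: "\<forall>j\<in>S. Y j \<prec> C" "C \<subseteq> (\<Union>j\<in>S. Y j)"
  have CA: "C \<subseteq> A" using assms(1) unfolding regular_cofinal_def by blast
  have bd: "\<exists>u\<in>A. \<forall>s\<in>T. (s, u) \<in> card_of A" if "T \<subseteq> A" "T \<prec> C" for T
    using assms(1) that unfolding regular_cofinal_def by blast
  have "\<forall>j\<in>S. \<exists>u\<in>A. \<forall>s\<in>Y j \<inter> C. (s, u) \<in> card_of A"
    using Y(1) CA bd subset_lesspoll[OF Int_lower1] by (meson inf_le2 order_trans)
  then obtain u where u: "\<And>j. j \<in> S \<Longrightarrow> u j \<in> A"
    "\<And>j s. j \<in> S \<Longrightarrow> s \<in> Y j \<inter> C \<Longrightarrow> (s, u j) \<in> card_of A" by metis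
  have "u ` S \<prec> C" using assms(3) image_lepoll lesspoll_trans1 by blast
  moreover have "u ` S \<subseteq> A" using u by blast
  ultimately have "\<exists>v\<in>A. \<forall>s\<in>u ` S. (s, v) \<in> card_of A" by (rule bd[rotated])
  then obtain v where v: "v \<in> A" "\<And>j. j \<in> S \<Longrightarrow> (u j, v) \<in> card_of A" by blast
  have le: "(c, v) \<in> card_of A" if "c \<in> C" for c
    using Y(2) that u(2) v(2) card_of_linear(2)[of A] unfolding trans_def by blast
  obtain w where w: "w \<in> A" "v \<noteq> w" "(v, w) \<in> card_of A"
    using infinite_Card_order_limit[OF card_of_Card_order, of A v] v(1) assms(2)
    unfolding Field_card_of by blast
  obtain c where c: "c \<in> C" "(w, c) \<in> card_of A"
    using assms(1) w(1) unfolding regular_cofinal_def by blast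
  have "(w, v) \<in> card_of A" using c le card_of_linear(2)[of A] unfolding trans_def by blast
  then show False using w card_of_linear(3)[of A] unfolding antisym_def by blast
qed

text \<open>Here \<open>|X|\<close> is the successor cardinal of \<open>|M|\<close>, hence
  regular.\<close>

lemma eqpoll_too_few:
  fixes X :: "'x set"
  assumes "infinite M" "J \<lesssim> M" "M \<prec> X" "\<And>L :: 'x set. L \<prec> X \<Longrightarrow> L \<lesssim> M"
  shows "too_few X J"
  unfolding too_few_def
proof (intro allI impI notI)
  fix Y assume Y: "\<forall>j\<in>J. Y j \<prec> X" "X \<subseteq> (\<Union>j\<in>J. Y j)"
  have "(\<Union>j\<in>J. Y j) \<lesssim> M"
  proof (rule UN_lepoll[OF assms(1,2)])
    show "Y j \<lesssim> M" if "j \<in> J" for j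
    proof (rule assms(4))
      show "Y j \<prec> X" using Y(1) that by blast
    qed
  qed
  then show False using subset_imp_lepoll[OF Y(2)] assms(3) lepoll_trans not_lepoll_iff by blast
qed

subsection \<open>Bases indexed by finitely many chains\<close>

lemma listset_iff: "xs \<in> listset Cs \<longleftrightarrow> list_all2 (\<in>) xs Cs"
proof (induction Cs arbitrary: xs)
  case (Cons C Cs)
  then show ?case by (cases xs) (auto simp: set_Cons_def)
qed simp

text \<open>
  The number of chains must be finite: the theorem fails for arbitrary directed families.
\<close>

definition fin_base :: "'m set \<Rightarrow> 'a set set \<Rightarrow> bool" where
  "fin_base M \<B> \<longleftrightarrow> (\<exists>(Cs :: 'a set set list) f.
     (\<forall>C\<in>set Cs. C \<noteq> {} \<and> chain_subset C \<and> C \<lesssim> M) \<and>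
     (\<forall>xs\<in>listset Cs. \<forall>ys\<in>listset Cs. list_all2 (\<subseteq>) xs ys \<longrightarrow> f ys \<subseteq> f xs) \<and>
     \<B> = f ` listset Cs)"

lemma fin_baseE:
  fixes \<B> :: "'a set set"
  assumes "fin_base M \<B>"
  obtains Cs :: "'a set set list" and f where "\<forall>C\<in>set Cs. C \<noteq> {} \<and> chain_subset C \<and> C \<lesssim> M"
    "\<forall>xs\<in>listset Cs. \<forall>ys\<in>listset Cs. list_all2 (\<subseteq>) xs ys \<longrightarrow> f ys \<subseteq> f xs" "\<B> = f ` listset Cs"
proof -
  from assms show thesis unfolding fin_base_def
    by (elim exE conjE) (rule that)
qed

lemma fin_base_nonempty:
  fixes \<B> :: "'a set set"
  assumes "fin_base M \<B>" shows "\<B> \<noteq> {}"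
proof -
  have *: "listset Cs \<noteq> {}" if "\<forall>C\<in>set Cs. C \<noteq> {}" for Cs :: "'a set set list"
    using that by (induction Cs) (auto simp: set_Cons_def)
  obtain Cs :: "'a set set list" and f where f: "\<forall>C\<in>set Cs. C \<noteq> {} \<and> chain_subset C \<and> C \<lesssim> M"
    "\<forall>xs\<in>listset Cs. \<forall>ys\<in>listset Cs. list_all2 (\<subseteq>) xs ys \<longrightarrow> f ys \<subseteq> f xs" "\<B> = f ` listset Cs"
    by (rule fin_baseE[OF assms])
  have "listset Cs \<noteq> {}" by (rule *) (use f(1) in simp)
  then show ?thesis using f(3) by simp
qed

lemma listset_directed:
  assumes "\<forall>C\<in>set Cs. chain_subset C" "xs \<in> listset Cs" "ys \<in> listset Cs"
  shows "\<exists>zs\<in>listset Cs. list_all2 (\<subseteq>) xs zs \<and> list_all2 (\<subseteq>) ys zs"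
  using assms
proof (induction Cs arbitrary: xs ys)
  case (Cons C Cs)
  from Cons.prems obtain x xs' y ys' where e: "xs = x # xs'" "ys = y # ys'"
    "x \<in> C" "y \<in> C" "xs' \<in> listset Cs" "ys' \<in> listset Cs"
    by (auto simp: set_Cons_def)
  then obtain zs where zs: "zs \<in> listset Cs" "list_all2 (\<subseteq>) xs' zs" "list_all2 (\<subseteq>) ys' zs"
    using Cons.IH[of xs' ys'] Cons.prems(1) by auto
  have "x \<subseteq> y \<or> y \<subseteq> x" using Cons.prems(1) e(3,4) by (auto simp: chain_subset_def)
  then have "x \<union> y \<in> C" using e(3,4) by (elim disjE) (simp_all add: Un_absorb1 Un_absorb2)
  then show ?case using zs e by (intro bexI[of _ "(x \<union> y) # zs"]) (auto simp: set_Cons_def)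
qed simp

lemma fin_base_directed:
  fixes \<B> :: "'a set set"
  assumes "fin_base M \<B>" "E \<in> \<B>" "F \<in> \<B>"
  obtains G where "G \<in> \<B>" "G \<subseteq> E \<inter> F"
proof -
  obtain Cs :: "'a set set list" and f where f: "\<forall>C\<in>set Cs. C \<noteq> {} \<and> chain_subset C \<and> C \<lesssim> M"
    "\<forall>xs\<in>listset Cs. \<forall>ys\<in>listset Cs. list_all2 (\<subseteq>) xs ys \<longrightarrow> f ys \<subseteq> f xs" "\<B> = f ` listset Cs"
    by (rule fin_baseE[OF assms(1)])
  obtain xs where xs: "xs \<in> listset Cs" "E = f xs" using assms(2) unfolding f(3) by (rule imageE)
  obtain ys where ys: "ys \<in> listset Cs" "F = f ys" using assms(3) unfolding f(3) by (rule imageE)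
  have "\<forall>C\<in>set Cs. chain_subset C" using f(1) by simp
  then obtain zs where zs: "zs \<in> listset Cs" "list_all2 (\<subseteq>) xs zs" "list_all2 (\<subseteq>) ys zs"
    using listset_directed xs(1) ys(1) by blast
  have "f zs \<subseteq> f xs" "f zs \<subseteq> f ys" using f(2) zs xs(1) ys(1) by blast+
  then have "f zs \<in> \<B>" "f zs \<subseteq> E \<inter> F" using f(3) zs(1) xs(2) ys(2) by simp_all
  then show thesis using that by blast
qed

lemma fin_base_lepoll:
  fixes \<B> :: "'a set set"
  assumes "infinite M" "fin_base M \<B>" shows "\<B> \<lesssim> M"
proof -
  have "listset Cs \<lesssim> M" if "\<forall>C\<in>set Cs. C \<lesssim> M" for Cs :: "'a set set list"
    using that
  proof (induction Cs)
    case Nil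
    then show ?case by (simp add: finite_lepoll_infinite[OF assms(1)])
  next
    case (Cons C Cs)
    then have "C \<times> listset Cs \<lesssim> M" by (intro infinite_product_lepoll[OF assms(1)]) auto
    moreover have "listset (C # Cs) \<subseteq> (\<lambda>(x, xs). x # xs) ` (C \<times> listset Cs)"
      by (auto simp: set_Cons_def)
    then have "listset (C # Cs) \<lesssim> C \<times> listset Cs" by (rule subset_image_lepoll)
    ultimately show ?case using lepoll_trans by blast
  qed
  moreover obtain Cs :: "'a set set list" and f where
    "\<forall>C\<in>set Cs. C \<noteq> {} \<and> chain_subset C \<and> C \<lesssim> M" "\<B> = f ` listset Cs"
    by (rule fin_baseE[OF assms(2)])
  ultimately have "f ` listset Cs \<lesssim> M" using image_lepoll[of f "listset Cs"] lepoll_trans by blast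
  then show ?thesis using \<open>\<B> = f ` listset Cs\<close> by simp
qed

lemma fin_base_singleton: "fin_base M {E}"
  unfolding fin_base_def by (intro exI[of _ "[]"] exI[of _ "\<lambda>_. E"]) simp

lemma fin_base_Int:
  fixes \<B> :: "'a set set"
  assumes "fin_base M \<B>" shows "fin_base M ((\<lambda>E. E \<inter> P) ` \<B>)"
proof -
  obtain Cs :: "'a set set list" and f where f: "\<forall>C\<in>set Cs. C \<noteq> {} \<and> chain_subset C \<and> C \<lesssim> M"
    "\<forall>xs\<in>listset Cs. \<forall>ys\<in>listset Cs. list_all2 (\<subseteq>) xs ys \<longrightarrow> f ys \<subseteq> f xs" "\<B> = f ` listset Cs"
    by (rule fin_baseE[OF assms(1)])
  have "f ys \<inter> P \<subseteq> f xs \<inter> P"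
    if "xs \<in> listset Cs" "ys \<in> listset Cs" "list_all2 (\<subseteq>) xs ys" for xs ys
    using f(2) that by blast
  then show ?thesis unfolding fin_base_def using f(1,3)
    by (intro exI[of _ Cs] exI[of _ "\<lambda>xs. f xs \<inter> P"] conjI) (auto simp: image_image)
qed

text \<open>In the applications \<open>\<V>\<close> consists of the stages of a filtration and
  \<open>g\<close> maps a stage to what is left of \<open>B\<close> after removing its exceptions,
  so that all exceptions together cost one further chain.\<close>

lemma fin_base_chain:
  fixes \<B> \<V> :: "'a set set"
  assumes "fin_base M \<B>" "\<V> \<noteq> {}" "chain_subset \<V>" "\<V> \<lesssim> M"
    and g: "\<And>S T. S \<in> \<V> \<Longrightarrow> T \<in> \<V> \<Longrightarrow> S \<subseteq> T \<Longrightarrow> g T \<subseteq> g S"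
  shows "fin_base M ((\<lambda>(E, S). E \<inter> g S) ` (\<B> \<times> \<V>))"
proof -
  obtain Cs :: "'a set set list" and f where f: "\<forall>C\<in>set Cs. C \<noteq> {} \<and> chain_subset C \<and> C \<lesssim> M"
    "\<forall>xs\<in>listset Cs. \<forall>ys\<in>listset Cs. list_all2 (\<subseteq>) xs ys \<longrightarrow> f ys \<subseteq> f xs" "\<B> = f ` listset Cs"
    by (rule fin_baseE[OF assms(1)])
  show ?thesis unfolding fin_base_def
  proof (intro exI[of _ "\<V> # Cs"] exI[of _ "\<lambda>xs. f (tl xs) \<inter> g (hd xs)"] conjI)
    show "\<forall>C\<in>set (\<V> # Cs). C \<noteq> {} \<and> chain_subset C \<and> C \<lesssim> M" using f assms by auto
    show "\<forall>xs\<in>listset (\<V> # Cs). \<forall>ys\<in>listset (\<V> # Cs). list_all2 (\<subseteq>) xs ys \<longrightarrow>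
      f (tl ys) \<inter> g (hd ys) \<subseteq> f (tl xs) \<inter> g (hd xs)"
    proof (intro ballI impI)
      fix xs ys assume a: "xs \<in> listset (\<V> # Cs)" "ys \<in> listset (\<V> # Cs)" "list_all2 (\<subseteq>) xs ys"
      then obtain x xs' y ys' where e: "xs = x # xs'" "ys = y # ys'"
        "x \<in> \<V>" "y \<in> \<V>" "xs' \<in> listset Cs" "ys' \<in> listset Cs" by (auto simp: set_Cons_def)
      then have "f ys' \<subseteq> f xs'" "g y \<subseteq> g x" using a(3) f(2) g by auto
      then show "f (tl ys) \<inter> g (hd ys) \<subseteq> f (tl xs) \<inter> g (hd xs)" using e by auto
    qed
    show "(\<lambda>(E, S). E \<inter> g S) ` (\<B> \<times> \<V>) = (\<lambda>xs. f (tl xs) \<inter> g (hd xs)) ` listset (\<V> # Cs)"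
    proof (intro equalityI subsetI)
      fix Z assume "Z \<in> (\<lambda>(E, S). E \<inter> g S) ` (\<B> \<times> \<V>)"
      then obtain xs S where "xs \<in> listset Cs" "S \<in> \<V>" "Z = f xs \<inter> g S" using f(3) by auto
      then show "Z \<in> (\<lambda>xs. f (tl xs) \<inter> g (hd xs)) ` listset (\<V> # Cs)"
        by (intro image_eqI[of _ _ "S # xs"]) (auto simp: set_Cons_def)
    next
      fix Z assume "Z \<in> (\<lambda>xs. f (tl xs) \<inter> g (hd xs)) ` listset (\<V> # Cs)"
      then obtain xs S where "xs \<in> listset Cs" "S \<in> \<V>" "Z = f xs \<inter> g S" by (auto simp: set_Cons_def)
      then show "Z \<in> (\<lambda>(E, S). E \<inter> g S) ` (\<B> \<times> \<V>)" using f(3) by auto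
    qed
  qed
qed

text \<open>Picking one member for each \<open>y\<close> would destroy the product form. Instead
  every chain is cut down to the entries occurring in the picked lists, and the full product of the
  shortened chains is taken.\<close>

lemma fin_base_shrink:
  fixes \<B> :: "'a set set"
  assumes "fin_base M \<B>" "Y \<noteq> {}" "\<And>y. y \<in> Y \<Longrightarrow> \<exists>E\<in>\<B>. Q y E"
  obtains \<B>' where "\<B>' \<subseteq> \<B>" "fin_base Y \<B>'" "\<And>y. y \<in> Y \<Longrightarrow> \<exists>E\<in>\<B>'. Q y E"
proof -
  obtain Cs :: "'a set set list" and f where f: "\<forall>C\<in>set Cs. C \<noteq> {} \<and> chain_subset C \<and> C \<lesssim> M"
    "\<forall>xs\<in>listset Cs. \<forall>ys\<in>listset Cs. list_all2 (\<subseteq>) xs ys \<longrightarrow> f ys \<subseteq> f xs" "\<B> = f ` listset Cs"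
    by (rule fin_baseE[OF assms(1)])
  have "\<forall>y\<in>Y. \<exists>xs. xs \<in> listset Cs \<and> Q y (f xs)" using assms(3) f(3) by blast
  then obtain p where p: "\<And>y. y \<in> Y \<Longrightarrow> p y \<in> listset Cs" "\<And>y. y \<in> Y \<Longrightarrow> Q y (f (p y))" by metis
  define Ds where "Ds = map (\<lambda>i. (\<lambda>y. p y ! i) ` Y) [0..<length Cs]"
  have len: "length (p y) = length Cs" if "y \<in> Y" for y
    using p(1)[OF that] by (auto simp: listset_iff dest: list_all2_lengthD)
  have sub: "Ds ! i \<subseteq> Cs ! i" if "i < length Cs" for i
    using p(1) that by (auto simp: Ds_def listset_iff list_all2_conv_all_nth)
  have Dsub: "listset Ds \<subseteq> listset Cs"
  proof
    fix xs assume "xs \<in> listset Ds"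
    then have "length xs = length Cs" "\<forall>i<length Cs. xs ! i \<in> Ds ! i"
      by (auto simp: listset_iff list_all2_conv_all_nth Ds_def)
    then show "xs \<in> listset Cs" using sub by (auto simp: listset_iff list_all2_conv_all_nth)
  qed
  have pD: "p y \<in> listset Ds" if "y \<in> Y" for y
    using len[OF that] that by (auto simp: listset_iff list_all2_conv_all_nth Ds_def)
  have "\<forall>C\<in>set Ds. C \<noteq> {} \<and> chain_subset C \<and> C \<lesssim> Y"
  proof
    fix D assume "D \<in> set Ds"
    then obtain i where i: "i < length Cs" "D = Ds ! i" "D = (\<lambda>y. p y ! i) ` Y"
      by (auto simp: Ds_def)
    moreover have "chain_subset (Cs ! i)" using f(1) i(1) by auto
    ultimately have "chain_subset D" using sub[OF i(1)] unfolding chain_subset_def by blast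
    moreover have "D \<noteq> {}" using i(3) assms(2) by simp
    moreover have "D \<lesssim> Y" unfolding i(3) by (rule image_lepoll)
    ultimately show "D \<noteq> {} \<and> chain_subset D \<and> D \<lesssim> Y" by blast
  qed
  then have "fin_base Y (f ` listset Ds)"
    unfolding fin_base_def using f(2) Dsub by (intro exI[of _ Ds] exI[of _ f]) blast
  then show thesis using that[of "f ` listset Ds"] Dsub f(3) pD p(2) by blast
qed

lemma list_all2_subset_refl: "list_all2 (\<subseteq>) xs xs"
  by (simp add: list_all2_same)

text \<open>
  The chains are handled one at a time. Either a single element of the chain serves \<open>|X|\<close> many
  points of \<open>X\<close>, or the chain has the same cofinality as \<open>|X|\<close>.
\<close>

lemma listset_regularize:
  fixes X :: "'x set" and Cs :: "'a set set list"
  assumes "infinite X" "\<forall>C\<in>set Cs. chain_subset C"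
    and "\<And>x. x \<in> X \<Longrightarrow> \<exists>xs\<in>listset Cs. Q x xs"
    and "\<And>x xs ys. xs \<in> listset Cs \<Longrightarrow> ys \<in> listset Cs \<Longrightarrow> list_all2 (\<subseteq>) xs ys \<Longrightarrow> Q x xs \<Longrightarrow> Q x ys"
  shows "\<exists>X' D. X' \<subseteq> X \<and> X' \<approx> X \<and> D \<subseteq> listset Cs \<and> (\<forall>x\<in>X'. \<exists>d\<in>D. Q x d) \<and>
    (\<forall>J\<subseteq>D. too_few X J \<longrightarrow> (\<exists>d\<in>D. \<forall>j\<in>J. list_all2 (\<subseteq>) j d))"
  using assms
proof (induction Cs arbitrary: X Q)
  case Nil
  have "\<forall>x\<in>X. \<exists>d\<in>{[]}. Q x d" using Nil.prems(3) by simp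
  moreover have "\<exists>d\<in>{[]}. \<forall>j\<in>J. list_all2 (\<subseteq>) j d" if "J \<subseteq> {[]}" for J :: "'a set list set"
    using that by auto
  ultimately show ?case
    by (intro exI[of _ X] exI[of _ "{[]}"] conjI allI impI subset_refl eqpoll_refl) simp_all
next
  case (Cons C Cs)
  have chains: "\<forall>C\<in>set Cs. chain_subset C" using Cons.prems(2) by simp
  have up: "Q x (T # ys)"
    if "S \<in> C" "T \<in> C" "S \<subseteq> T" "xs \<in> listset Cs" "ys \<in> listset Cs" "list_all2 (\<subseteq>) xs ys" "Q x (S # xs)"
    for x S T xs ys
    using Cons.prems(4)[of "S # xs" "T # ys" x] that by (auto simp: set_Cons_def)
  have ex: "\<exists>S\<in>C. \<exists>xs\<in>listset Cs. Q x (S # xs)" if "x \<in> X" for x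
    using Cons.prems(3)[OF that] by (auto simp: set_Cons_def)
  define XS where "XS = (\<lambda>S. {x\<in>X. \<exists>xs\<in>listset Cs. Q x (S # xs)})"
  show ?case
  proof (cases "\<exists>S\<in>C. X \<lesssim> XS S")
    case True
    then obtain S where S: "S \<in> C" "X \<lesssim> XS S" by blast
    have XS: "XS S \<approx> X"
      using S(2) lepoll_antisym[of "XS S" X] subset_imp_lepoll[of "XS S" X] by (auto simp: XS_def)
    then have inf: "infinite (XS S)" using Cons.prems(1) eqpoll_finite_iff by blast
    have "\<exists>X' D. X' \<subseteq> XS S \<and> X' \<approx> XS S \<and> D \<subseteq> listset Cs \<and> (\<forall>x\<in>X'. \<exists>d\<in>D. Q x (S # d)) \<and>
      (\<forall>J\<subseteq>D. too_few (XS S) J \<longrightarrow> (\<exists>d\<in>D. \<forall>j\<in>J. list_all2 (\<subseteq>) j d))"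
      by (rule Cons.IH[OF inf chains, of "\<lambda>x xs. Q x (S # xs)"])
        (use S(1) up[of S S] in \<open>auto simp: XS_def\<close>)
    then obtain X' D where D: "X' \<subseteq> XS S" "X' \<approx> XS S" "D \<subseteq> listset Cs"
      "\<forall>x\<in>X'. \<exists>d\<in>D. Q x (S # d)"
      "\<forall>J\<subseteq>D. too_few (XS S) J \<longrightarrow> (\<exists>d\<in>D. \<forall>j\<in>J. list_all2 (\<subseteq>) j d)" by blast
    have dir: "\<exists>d\<in>(#) S ` D. \<forall>j\<in>J. list_all2 (\<subseteq>) j d" if J: "J \<subseteq> (#) S ` D" "too_few X J" for J
    proof -
      have "tl ` J \<subseteq> D" using J(1) by auto
      moreover have "too_few (XS S) (tl ` J)"
        using too_few_image[OF too_few_eqpoll[OF eqpoll_sym[OF XS] J(2)]] .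
      ultimately obtain d where "d \<in> D" "\<forall>j\<in>tl ` J. list_all2 (\<subseteq>) j d" using D(5) by blast
      have "list_all2 (\<subseteq>) j (S # d)" if j: "j \<in> J" for j
      proof -
        obtain e where "j = S # e" using J(1) j by auto
        then show ?thesis using \<open>\<forall>j\<in>tl ` J. list_all2 (\<subseteq>) j d\<close> j by force
      qed
      then show ?thesis using \<open>d \<in> D\<close> by (intro bexI[of _ "S # d"]) auto
    qed
    have "X' \<subseteq> X" using D(1) by (auto simp: XS_def)
    moreover have "X' \<approx> X" using D(2) XS by (rule eqpoll_trans)
    moreover have "(#) S ` D \<subseteq> listset (C # Cs)" using D(3) S(1) by (auto simp: set_Cons_def)
    moreover have "\<forall>x\<in>X'. \<exists>d\<in>(#) S ` D. Q x d" using D(4) by blast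
    ultimately show ?thesis using dir by (intro exI[of _ X'] exI[of _ "(#) S ` D"] conjI) simp_all
  next
    case False
    then have small: "XS S \<prec> X" if "S \<in> C" for S using that not_lepoll_iff by blast
    \<comment> \<open>If \<open>J\<close> were unbounded in the chain \<open>C\<close>, the element
      serving a given \<open>x\<close> would lie below some \<open>T\<close> in \<open>J\<close>,
      which then serves \<open>x\<close> as well; so the small sets \<open>XS T\<close> with
      \<open>T\<close> in \<open>J\<close> would cover \<open>X\<close>.\<close>
    have bound: "\<exists>S\<in>C. \<forall>T\<in>J. T \<subseteq> S" if J: "J \<subseteq> C" "too_few X J" for J
    proof (rule ccontr)
      assume no: "\<not> (\<exists>S\<in>C. \<forall>T\<in>J. T \<subseteq> S)"
      have "X \<subseteq> (\<Union>T\<in>J. XS T)"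
      proof
        fix x assume x: "x \<in> X"
        then obtain S xs where S: "S \<in> C" "xs \<in> listset Cs" "Q x (S # xs)" using ex by blast
        obtain T where T: "T \<in> J" "\<not> T \<subseteq> S" using no S(1) by blast
        then have "S \<subseteq> T" using Cons.prems(2) S(1) J(1) by (auto simp: chain_subset_def)
        then have "Q x (T # xs)" using up[OF S(1) _ _ S(2) S(2) list_all2_subset_refl S(3)] T(1) J(1) by blast
        then show "x \<in> (\<Union>T\<in>J. XS T)" using x S(2) T(1) by (auto simp: XS_def)
      qed
      moreover have "\<forall>T\<in>J. XS T \<prec> X" using small J(1) by blast
      ultimately show False using J(2) unfolding too_few_def by blast
    qed
    \<comment> \<open>With the first coordinate quantified away, induction regularizes the tails.
      Heads and tails of a small \<open>J\<close> are then bounded separately.\<close>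
    have "\<exists>X' D. X' \<subseteq> X \<and> X' \<approx> X \<and> D \<subseteq> listset Cs \<and> (\<forall>x\<in>X'. \<exists>d\<in>D. \<exists>S\<in>C. Q x (S # d)) \<and>
      (\<forall>J\<subseteq>D. too_few X J \<longrightarrow> (\<exists>d\<in>D. \<forall>j\<in>J. list_all2 (\<subseteq>) j d))"
    proof (rule Cons.IH[OF Cons.prems(1) chains])
      show "\<exists>xs\<in>listset Cs. \<exists>S\<in>C. Q x (S # xs)" if "x \<in> X" for x using ex that by blast
      show "\<exists>S\<in>C. Q x (S # ys)" if "xs \<in> listset Cs" "ys \<in> listset Cs"
        "list_all2 (\<subseteq>) xs ys" "\<exists>S\<in>C. Q x (S # xs)" for x xs ys
        using up that by blast
    qed
    then obtain X' D where D: "X' \<subseteq> X" "X' \<approx> X" "D \<subseteq> listset Cs"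
      "\<forall>x\<in>X'. \<exists>d\<in>D. \<exists>S\<in>C. Q x (S # d)"
      "\<forall>J\<subseteq>D. too_few X J \<longrightarrow> (\<exists>d\<in>D. \<forall>j\<in>J. list_all2 (\<subseteq>) j d)" by blast
    let ?D = "(\<lambda>(S, d). S # d) ` (C \<times> D)"
    have dir: "\<exists>d\<in>?D. \<forall>j\<in>J. list_all2 (\<subseteq>) j d" if J: "J \<subseteq> ?D" "too_few X J" for J
    proof -
      have "hd ` J \<subseteq> C" "tl ` J \<subseteq> D" using J(1) by auto
      moreover obtain S where S: "S \<in> C" "\<forall>T\<in>hd ` J. T \<subseteq> S"
        using bound[OF _ too_few_image[OF J(2)], of hd] calculation(1) by blast
      moreover obtain d where d: "d \<in> D" "\<forall>j\<in>tl ` J. list_all2 (\<subseteq>) j d"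
        using D(5) too_few_image[OF J(2), of tl] calculation(2) by blast
      have "list_all2 (\<subseteq>) j (S # d)" if j: "j \<in> J" for j
      proof -
        obtain T e where "j = T # e" using J(1) j by auto
        then show ?thesis using S(2) d(2) j by force
      qed
      then show ?thesis using S(1) d(1) by (intro bexI[of _ "S # d"]) auto
    qed
    have "?D \<subseteq> listset (C # Cs)" using D(3) by (auto simp: set_Cons_def)
    moreover have "\<exists>d\<in>?D. Q x d" if x: "x \<in> X'" for x
    proof -
      obtain d S where "d \<in> D" "S \<in> C" "Q x (S # d)" using D(4) x by blast
      then show ?thesis by (intro bexI[of _ "S # d"]) auto
    qed
    ultimately show ?thesis using D(1,2) dir by (intro exI[of _ X'] exI[of _ ?D] conjI) simp_all
  qed
qed

text \<open>For \<open>\<B>'\<close> no product form is claimed. What limit steps use is that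
  families of fewer members than the cofinality of \<open>|X|\<close> have a lower bound in
  it.\<close>

lemma fin_base_regularize:
  fixes X :: "'x set" and \<B> :: "'a set set"
  assumes "fin_base M \<B>" "infinite X" "\<And>x. x \<in> X \<Longrightarrow> \<exists>E\<in>\<B>. Q x E"
    and mono: "\<And>x E F. Q x E \<Longrightarrow> F \<subseteq> E \<Longrightarrow> Q x F"
  obtains X' \<B>' where "X' \<subseteq> X" "X' \<approx> X" "\<B>' \<subseteq> \<B>" "\<And>x. x \<in> X' \<Longrightarrow> \<exists>E\<in>\<B>'. Q x E"
    "\<And>J. J \<subseteq> \<B>' \<Longrightarrow> too_few X J \<Longrightarrow> \<exists>E\<in>\<B>'. \<forall>F\<in>J. E \<subseteq> F"
proof -
  obtain Cs :: "'a set set list" and f where f: "\<forall>C\<in>set Cs. C \<noteq> {} \<and> chain_subset C \<and> C \<lesssim> M"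
    "\<forall>xs\<in>listset Cs. \<forall>ys\<in>listset Cs. list_all2 (\<subseteq>) xs ys \<longrightarrow> f ys \<subseteq> f xs" "\<B> = f ` listset Cs"
    by (rule fin_baseE[OF assms(1)])
  have "\<exists>X' D. X' \<subseteq> X \<and> X' \<approx> X \<and> D \<subseteq> listset Cs \<and> (\<forall>x\<in>X'. \<exists>d\<in>D. Q x (f d)) \<and>
    (\<forall>J\<subseteq>D. too_few X J \<longrightarrow> (\<exists>d\<in>D. \<forall>j\<in>J. list_all2 (\<subseteq>) j d))"
  proof (rule listset_regularize[OF assms(2)])
    show "\<forall>C\<in>set Cs. chain_subset C" using f(1) by blast
    show "\<exists>xs\<in>listset Cs. Q x (f xs)" if "x \<in> X" for x
      using assms(3)[OF that] unfolding f(3) by simp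
    show "Q x (f ys)" if "xs \<in> listset Cs" "ys \<in> listset Cs" "list_all2 (\<subseteq>) xs ys" "Q x (f xs)"
      for x xs ys
      by (rule mono[OF that(4)]) (use that f(2) in simp)
  qed
  then obtain X' D where D: "X' \<subseteq> X" "X' \<approx> X" "D \<subseteq> listset Cs" "\<forall>x\<in>X'. \<exists>d\<in>D. Q x (f d)"
    "\<forall>J\<subseteq>D. too_few X J \<longrightarrow> (\<exists>d\<in>D. \<forall>j\<in>J. list_all2 (\<subseteq>) j d)" by blast
  show thesis
  proof (rule that[of X' "f ` D"])
    show "f ` D \<subseteq> \<B>" unfolding f(3) using D(3) by (rule image_mono)
    show "\<exists>E\<in>f ` D. \<forall>F\<in>J. E \<subseteq> F" if J: "J \<subseteq> f ` D" "too_few X J" for J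
    proof -
      \<comment> \<open>The full preimage of \<open>J\<close> may be too large to be bounded, so one
        index is taken for each member.\<close>
      have sub: "inv_into D f ` J \<subseteq> D" using J(1) inv_into_into[of _ f D] by blast
      have "\<exists>d\<in>D. \<forall>j\<in>inv_into D f ` J. list_all2 (\<subseteq>) j d"
        by (rule D(5)[THEN spec, THEN mp, THEN mp, OF sub too_few_image[OF J(2)]])
      then obtain d where d: "d \<in> D" "\<And>j. j \<in> J \<Longrightarrow> list_all2 (\<subseteq>) (inv_into D f j) d"
        by (elim bexE) simp
      have "f d \<subseteq> F" if "F \<in> J" for F
      proof -
        have F: "inv_into D f F \<in> D" "f (inv_into D f F) = F"
          using sub that subsetD[OF J(1) that] f_inv_into_f[of F f D] by auto
        have L: "inv_into D f F \<in> listset Cs" "d \<in> listset Cs" using F(1) d(1) D(3) by blast+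
        have "f d \<subseteq> f (inv_into D f F)"
          by (rule f(2)[THEN bspec, THEN bspec, THEN mp, OF L d(2)[OF that]])
        then show ?thesis using F(2) by simp
      qed
      then show ?thesis using d(1) by blast
    qed
  qed (use D in blast)+
qed

subsection \<open>Sums of well-orders\<close>

definition wo_sum :: "'i rel \<Rightarrow> ('i \<Rightarrow> 'a set) \<Rightarrow> ('i \<Rightarrow> 'a rel) \<Rightarrow> 'a rel" where
  "wo_sum S W R = {(x, y). \<exists>i j. x \<in> W i \<and> y \<in> W j \<and> (i, j) \<in> S \<and> (i \<noteq> j \<or> (x, y) \<in> R i)}"

lemma well_order_on_wo_sum:
  fixes W :: "'i \<Rightarrow> 'v set"
  assumes S: "well_order_on I S" and R: "\<And>i. i \<in> I \<Longrightarrow> well_order_on (W i) (R i)"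
    and disj: "\<And>i j. i \<in> I \<Longrightarrow> j \<in> I \<Longrightarrow> i \<noteq> j \<Longrightarrow> W i \<inter> W j = {}"
  shows "well_order_on (\<Union>i\<in>I. W i) (wo_sum S W R)"
proof -
  let ?T = "wo_sum S W R"
  have SI: "S \<subseteq> I \<times> I" "refl_on I S" "trans S" "antisym S" "total_on I S" "wf (S - Id)"
    using S by (auto simp: well_order_on_def linear_order_on_def partial_order_on_def preorder_on_def)
  have RI: "R i \<subseteq> W i \<times> W i" "refl_on (W i) (R i)" "trans (R i)" "antisym (R i)" "total_on (W i) (R i)" "wf (R i - Id)"
    if "i \<in> I" for i
    using R[OF that] by (auto simp: well_order_on_def linear_order_on_def partial_order_on_def preorder_on_def)
  have uniq: "i = j" if "i \<in> I" "j \<in> I" "x \<in> W i" "x \<in> W j" for i j x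
    using disj that by blast
  have T: "(x, y) \<in> ?T \<longleftrightarrow> (i, j) \<in> S \<and> (i \<noteq> j \<or> (x, y) \<in> R i)"
    if "i \<in> I" "j \<in> I" "x \<in> W i" "y \<in> W j" for i j x y
  proof
    assume "(x, y) \<in> ?T"
    then obtain i' j' where *: "x \<in> W i'" "y \<in> W j'" "(i', j') \<in> S" "i' \<noteq> j' \<or> (x, y) \<in> R i'"
      unfolding wo_sum_def by blast
    moreover have "i' \<in> I" "j' \<in> I" using *(3) SI(1) by auto
    ultimately have "i' = i" "j' = j" using uniq that by blast+
    then show "(i, j) \<in> S \<and> (i \<noteq> j \<or> (x, y) \<in> R i)" using * by blast
  qed (use that in \<open>auto simp: wo_sum_def\<close>)
  have sub: "?T \<subseteq> (\<Union>i\<in>I. W i) \<times> (\<Union>i\<in>I. W i)"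
    using SI(1) unfolding wo_sum_def by blast
  have idx: "\<exists>i\<in>I. \<exists>j\<in>I. x \<in> W i \<and> y \<in> W j" if "(x, y) \<in> ?T" for x y
    using subsetD[OF sub that] by simp
  have "refl_on (\<Union>i\<in>I. W i) ?T"
  proof (rule refl_onI)
    fix x assume "x \<in> (\<Union>i\<in>I. W i)"
    then obtain i where "i \<in> I" "x \<in> W i" by blast
    then show "(x, x) \<in> ?T" using T[of i i x x] SI(2) RI(2)[of i] by (auto dest: refl_onD)
  qed
  moreover have "trans ?T"
  proof (rule transI)
    fix x y z assume a: "(x, y) \<in> ?T" "(y, z) \<in> ?T"
    obtain i j where i1: "i \<in> I" "j \<in> I" "x \<in> W i" "y \<in> W j" using idx[OF a(1)] by blast
    obtain k where i2: "k \<in> I" "z \<in> W k" using idx[OF a(2)] by blast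
    note i = i1(1,2) i2(1) i1(3,4) i2(2)
    have b: "(i, j) \<in> S" "i \<noteq> j \<or> (x, y) \<in> R i" "(j, k) \<in> S" "j \<noteq> k \<or> (y, z) \<in> R j"
      using a T[OF i(1,2,4,5)] T[OF i(2,3,5,6)] by simp_all
    then have "(i, k) \<in> S" using SI(3) unfolding trans_def by blast
    moreover have "(x, z) \<in> R i" if "i = k"
    proof -
      have "i = j" using b that SI(4) unfolding antisym_def by blast
      then show ?thesis using b that RI(3)[OF i(1)] unfolding trans_def by blast
    qed
    ultimately show "(x, z) \<in> ?T" using T[OF i(1,3,4,6)] by blast
  qed
  moreover have "antisym ?T"
  proof (rule antisymI)
    fix x y assume a: "(x, y) \<in> ?T" "(y, x) \<in> ?T"
    obtain i j where i: "i \<in> I" "j \<in> I" "x \<in> W i" "y \<in> W j" using idx[OF a(1)] by blast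
    have b: "(i, j) \<in> S" "i \<noteq> j \<or> (x, y) \<in> R i" "(j, i) \<in> S" "j \<noteq> i \<or> (y, x) \<in> R j"
      using a T[OF i] T[OF i(2,1,4,3)] by simp_all
    then have "i = j" using SI(4) unfolding antisym_def by blast
    then show "x = y" using b RI(4)[OF i(1)] unfolding antisym_def by blast
  qed
  moreover have "total_on (\<Union>i\<in>I. W i) ?T"
    unfolding total_on_def
  proof (intro ballI impI)
    fix x y assume "x \<in> (\<Union>i\<in>I. W i)" "y \<in> (\<Union>i\<in>I. W i)" "x \<noteq> y"
    then obtain i j where i: "i \<in> I" "j \<in> I" "x \<in> W i" "y \<in> W j" by blast
    show "(x, y) \<in> ?T \<or> (y, x) \<in> ?T"
    proof (cases "i = j")
      case True
      then show ?thesis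
        using T[of i i x y] T[of i i y x] i RI(5)[OF i(1)] \<open>x \<noteq> y\<close> refl_onD[OF SI(2) i(1)]
        unfolding total_on_def by auto
    next
      case False
      then have "(i, j) \<in> S \<or> (j, i) \<in> S" using SI(5) i(1,2) unfolding total_on_def by blast
      then show ?thesis using T[OF i] T[OF i(2,1,4,3)] False by auto
    qed
  qed
  moreover have "wf (?T - Id)"
  proof (rule wfI_min)
    fix x :: 'v and Q assume xQ: "x \<in> Q"
    show "\<exists>z\<in>Q. \<forall>y. (y, z) \<in> ?T - Id \<longrightarrow> y \<notin> Q"
    proof (cases "Q \<inter> (\<Union>i\<in>I. W i) = {}")
      case True
      then have "y \<notin> Q" if "(y, x) \<in> ?T" for y using idx[OF that] by blast
      then show ?thesis using xQ by blast
    next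
      case False
      then obtain i0 where "i0 \<in> {i\<in>I. Q \<inter> W i \<noteq> {}}" by blast
      then obtain i where i: "i \<in> {i\<in>I. Q \<inter> W i \<noteq> {}}"
        "\<And>j. (j, i) \<in> S - Id \<Longrightarrow> j \<notin> {i\<in>I. Q \<inter> W i \<noteq> {}}"
        by (rule wfE_min[OF SI(6)]) blast
      then obtain z0 where z0: "z0 \<in> Q \<inter> W i" by blast
      have "wf (R i - Id)" using RI(6) i(1) by blast
      then obtain z where z: "z \<in> Q \<inter> W i" "\<And>y. (y, z) \<in> R i - Id \<Longrightarrow> y \<notin> Q \<inter> W i"
        using z0 by (rule wfE_min) (rule that)
      have "y \<notin> Q" if y: "(y, z) \<in> ?T - Id" for y
      proof
        assume yQ: "y \<in> Q"
        obtain j where j: "j \<in> I" "y \<in> W j" using idx[of y z] y by blast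
        have jS: "(j, i) \<in> S" "j \<noteq> i \<or> (y, z) \<in> R j" using T[of j i y z] j i(1) z(1) y by auto
        have "j = i" using i(2)[of j] jS(1) j yQ by blast
        then show False using z(2)[of y] jS(2) y yQ j by blast
      qed
      then show ?thesis using z(1) by blast
    qed
  qed
  ultimately show ?thesis
    using sub by (auto simp: well_order_on_def linear_order_on_def partial_order_on_def preorder_on_def)
qed

lemma underS_wo_sum:
  assumes "well_order_on I S" "\<And>i j. i \<in> I \<Longrightarrow> j \<in> I \<Longrightarrow> i \<noteq> j \<Longrightarrow> W i \<inter> W j = {}"
    and "\<And>i. i \<in> I \<Longrightarrow> well_order_on (W i) (R i)" "i \<in> I" "x \<in> W i"
  shows "underS (wo_sum S W R) x = (\<Union>j\<in>underS S i. W j) \<union> underS (R i) x"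
proof -
  have SI: "S \<subseteq> I \<times> I" "refl_on I S" "antisym S"
    using assms(1) by (auto simp: well_order_on_def linear_order_on_def partial_order_on_def preorder_on_def)
  have RW: "R i \<subseteq> W i \<times> W i"
    using assms(3)[OF assms(4)]
    by (auto simp: well_order_on_def linear_order_on_def partial_order_on_def preorder_on_def)
  have uniq: "j = i" if "j \<in> I" "x \<in> W j" for j using assms that by blast
  show ?thesis
  proof (intro equalityI subsetI)
    fix y assume "y \<in> underS (wo_sum S W R) x"
    then obtain j i' where y: "y \<noteq> x" "y \<in> W j" "x \<in> W i'" "(j, i') \<in> S" "j \<noteq> i' \<or> (y, x) \<in> R j"
      unfolding underS_def wo_sum_def by blast
    then have "i' = i" using uniq SI(1) by blast
    then show "y \<in> (\<Union>j\<in>underS S i. W j) \<union> underS (R i) x" using y unfolding underS_def by blast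
  next
    fix y assume "y \<in> (\<Union>j\<in>underS S i. W j) \<union> underS (R i) x"
    then consider j where "j \<in> underS S i" "y \<in> W j" | "y \<in> underS (R i) x" by blast
    then show "y \<in> underS (wo_sum S W R) x"
    proof cases
      case 1
      then have "(j, i) \<in> S" "j \<noteq> i" "j \<in> I" using SI(1) unfolding underS_def by blast+
      moreover have "y \<noteq> x" using uniq[of j] calculation 1(2) by blast
      ultimately show ?thesis using 1(2) assms(5) unfolding wo_sum_def underS_def by blast
    next
      case 2
      then have "y \<in> W i" "y \<noteq> x" "(y, x) \<in> R i" using RW unfolding underS_def by blast+
      moreover have "(i, i) \<in> S" using SI(2) assms(4) refl_onD by fastforce
      ultimately show ?thesis using assms(5) unfolding wo_sum_def underS_def by blast
    qed
  qed
qed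

lemma wo_sum_intro1: "(i, j) \<in> S \<Longrightarrow> i \<noteq> j \<Longrightarrow> x \<in> W i \<Longrightarrow> y \<in> W j \<Longrightarrow> (x, y) \<in> wo_sum S W R"
  unfolding wo_sum_def by blast

lemma wo_sum_intro2: "(i, i) \<in> S \<Longrightarrow> x \<in> W i \<Longrightarrow> y \<in> W i \<Longrightarrow> (x, y) \<in> R i \<Longrightarrow> (x, y) \<in> wo_sum S W R"
  unfolding wo_sum_def by blast

lemma well_order_onD:
  assumes "well_order_on A R"
  shows "R \<subseteq> A \<times> A" "refl_on A R" "trans R" "antisym R" "total_on A R" "wf (R - Id)"
  using assms unfolding well_order_on_def linear_order_on_def partial_order_on_def preorder_on_def
  by blast+

section \<open>Coloured neighbourhoods, refinements of bases and minimal sets of colours\<close>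

locale coloured_nbhds =
  fixes N :: "nat \<Rightarrow> 'a \<Rightarrow> 'a set"
begin

definition NK :: "nat set \<Rightarrow> 'a \<Rightarrow> 'a set" where
  "NK K a = (\<Union>k\<in>K. N k a)"

definition captured :: "nat set \<Rightarrow> 'a set \<Rightarrow> 'a set set \<Rightarrow> bool" where
  "captured K X \<B> \<longleftrightarrow> (\<forall>x\<in>X. \<exists>E\<in>\<B>. E \<subseteq> NK K x)"

text \<open>
  Listing \<open>b x\<close> immediately before \<open>x\<close> turns such an order into a path of colour \<open>k\<close> on \<open>X \<union> b ` X\<close>.
\<close>

definition path_order :: "nat \<Rightarrow> 'a set \<Rightarrow> ('a \<Rightarrow> 'a) \<Rightarrow> 'a rel \<Rightarrow> bool" where
  "path_order k X b R \<longleftrightarrow> well_order_on X R \<and> inj_on b X \<and>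
     (\<forall>x\<in>X. b x \<in> N k x \<and> (\<forall>u\<in>underS R x. \<exists>w\<in>underS R x. (u, w) \<in> R \<and> b x \<in> N k w))"

end

definition big :: "'b set \<Rightarrow> 'a set set \<Rightarrow> bool" where
  "big A \<B> \<longleftrightarrow> (\<forall>E\<in>\<B>. A \<lesssim> E)"

text \<open>For infinite \<open>A\<close> and a directed base these are the positive sets of the
  filter generated by the base and the complements of sets smaller than \<open>A\<close>.\<close>

definition positive :: "'b set \<Rightarrow> 'a set set \<Rightarrow> 'a set \<Rightarrow> bool" where
  "positive A \<B> P \<longleftrightarrow> (\<forall>E\<in>\<B>. A \<lesssim> E \<inter> P)"

text \<open>The second clause ensures that links found in a refinement come from the part of
  \<open>B\<close> that the original base occupies.\<close>

definition refines :: "'a set set \<Rightarrow> 'a set set \<Rightarrow> bool" where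
  "refines \<B>' \<B> \<longleftrightarrow> (\<forall>E\<in>\<B>. \<exists>E'\<in>\<B>'. E' \<subseteq> E) \<and> \<Union>\<B>' \<subseteq> \<Union>\<B>"

lemma refines_trans: "refines \<C> \<B> \<Longrightarrow> refines \<D> \<C> \<Longrightarrow> refines \<D> \<B>"
  unfolding refines_def by (meson order_trans)

lemma refines_refl: "refines \<B> \<B>"
  unfolding refines_def by blast

lemma refines_Int: "refines ((\<lambda>E. E \<inter> P) ` \<B>) \<B>"
  unfolding refines_def by blast

lemma big_Int_iff: "big A ((\<lambda>E. E \<inter> P) ` \<B>) \<longleftrightarrow> positive A \<B> P"
  unfolding big_def positive_def by simp

lemma fin_base_filtration:
  fixes \<B> :: "'a set set" and V :: "'b \<Rightarrow> 'a set"
  assumes "fin_base A \<B>" "big A \<B>" "A \<noteq> {}"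
    and V: "\<And>u v. (u, v) \<in> card_of A \<Longrightarrow> V u \<subseteq> V v"
    and g: "\<And>S T. S \<subseteq> T \<Longrightarrow> g T \<subseteq> g S" and G: "\<And>u. u \<in> A \<Longrightarrow> positive A \<B> (g (V u))"
  defines "\<C> \<equiv> (\<lambda>(E, S). E \<inter> g S) ` (\<B> \<times> V ` A)"
  shows "fin_base A \<C>" "big A \<C>" "refines \<C> \<B>"
proof -
  have "chain_subset (V ` A)" unfolding chain_subset_def
  proof (intro ballI)
    fix S T assume "S \<in> V ` A" "T \<in> V ` A"
    then obtain u v where "u \<in> A" "v \<in> A" "S = V u" "T = V v" by blast
    then show "S \<subseteq> T \<or> T \<subseteq> S" using card_of_cases[of u A v] V by blast
  qed
  show "fin_base A \<C>" unfolding \<C>_def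
  proof (rule fin_base_chain[OF assms(1)])
    show "V ` A \<noteq> {}" using assms(3) by simp
    show "V ` A \<lesssim> A" by (rule image_lepoll)
    show "g T \<subseteq> g S" if "S \<subseteq> T" for S T using g that .
  qed fact
  show "big A \<C>" using G unfolding big_def \<C>_def positive_def by auto
  show "refines \<C> \<B>" unfolding refines_def
  proof
    show "\<Union>\<C> \<subseteq> \<Union>\<B>" unfolding \<C>_def by auto
    obtain u where u: "u \<in> A" using assms(3) by blast
    show "\<forall>E\<in>\<B>. \<exists>E'\<in>\<C>. E' \<subseteq> E"
    proof
      fix E assume E: "E \<in> \<B>"
      show "\<exists>E'\<in>\<C>. E' \<subseteq> E"
        by (rule bexI[of _ "E \<inter> g (V u)"]) (use E u in \<open>auto simp: \<C>_def\<close>)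
    qed
  qed
qed

context coloured_nbhds
begin

text \<open>Exceptional sets of size less than \<open>|A|\<close> are absorbed by adding one chain to the base.\<close>

lemma captured_absorb:
  assumes "infinite A" "fin_base A \<B>" "big A \<B>" "Y \<subseteq> A"
    and ex: "\<And>y. y \<in> Y \<Longrightarrow> \<exists>E\<in>\<B>. E - NK K y \<prec> A"
  obtains \<C> where "fin_base A \<C>" "big A \<C>" "refines \<C> \<B>" "captured K Y \<C>"
proof -
  obtain E where E: "\<And>y. y \<in> Y \<Longrightarrow> E y \<in> \<B>" "\<And>y. y \<in> Y \<Longrightarrow> E y - NK K y \<prec> A"
    using ex by metis
  obtain V where V: "\<And>u v. (u, v) \<in> card_of A \<Longrightarrow> V u \<subseteq> V v" "Y = (\<Union>u\<in>A. V u)"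
    "\<And>u. u \<in> A \<Longrightarrow> V u \<prec> A" "\<And>u. u \<in> A \<Longrightarrow> (\<Union>y\<in>V u. E y - NK K y) \<prec> A"
    by (rule exhaustion[OF assms(1,4) E(2)]) (assumption, rule that)
  define g where "g = (\<lambda>S. - (\<Union>y\<in>S. E y - NK K y))"
  have "positive A \<B> (g (V u))" if "u \<in> A" for u
    unfolding positive_def
  proof
    fix F assume "F \<in> \<B>"
    then have "A \<lesssim> F - (\<Union>y\<in>V u. E y - NK K y)"
      using assms(3) unfolding big_def by (intro lepoll_Diff[OF assms(1) _ V(4)[OF that]]) simp
    then show "A \<lesssim> F \<inter> g (V u)" unfolding g_def Diff_eq .
  qed
  moreover have "g T \<subseteq> g S" if "S \<subseteq> T" for S T using that unfolding g_def by blast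
  moreover have "A \<noteq> {}" using assms(1) by auto
  ultimately have C: "fin_base A ((\<lambda>(E, S). E \<inter> g S) ` (\<B> \<times> V ` A))"
    "big A ((\<lambda>(E, S). E \<inter> g S) ` (\<B> \<times> V ` A))" "refines ((\<lambda>(E, S). E \<inter> g S) ` (\<B> \<times> V ` A)) \<B>"
    using fin_base_filtration[where V = V and g = g, OF assms(2,3) _ V(1)] by simp_all
  moreover have "captured K Y ((\<lambda>(E, S). E \<inter> g S) ` (\<B> \<times> V ` A))"
    unfolding captured_def
  proof
    fix y assume y: "y \<in> Y"
    then obtain u where u: "u \<in> A" "y \<in> V u" using V(2) by blast
    have "E y \<inter> g (V u) \<subseteq> NK K y" using u(2) unfolding g_def by blast
    then show "\<exists>F\<in>(\<lambda>(E, S). E \<inter> g S) ` (\<B> \<times> V ` A). F \<subseteq> NK K y"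
      using E(1)[OF y] u(1) by (intro bexI[of _ "E y \<inter> g (V u)"]) auto
  qed
  ultimately show thesis using that by blast
qed

text \<open>Irreducibility is required hereditarily, for all full-size subsets and all refinements,
  because each argument that drops a colour first passes to such a subset and a finer base.\<close>

definition minimal :: "'a set \<Rightarrow> 'a set \<Rightarrow> nat set \<Rightarrow> 'a set set \<Rightarrow> bool" where
  "minimal A X K \<B> \<longleftrightarrow> X \<subseteq> A \<and> X \<approx> A \<and> fin_base A \<B> \<and> big A \<B> \<and> captured K X \<B> \<and>
     (\<forall>X' K' \<C>. X' \<subseteq> X \<longrightarrow> X' \<approx> A \<longrightarrow> K' \<subset> K \<longrightarrow> fin_base A \<C> \<longrightarrow> big A \<C> \<longrightarrow> refines \<C> \<B> \<longrightarrow>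
       \<not> captured K' X' \<C>)"

lemma minimalD:
  assumes "minimal A X K \<B>"
  shows "X \<subseteq> A" "X \<approx> A" "fin_base A \<B>" "big A \<B>" "captured K X \<B>"
  using assms unfolding minimal_def by blast+

lemma minimal_irreducible:
  assumes "minimal A X K \<B>" "X' \<subseteq> X" "X' \<approx> A" "K' \<subset> K" "fin_base A \<C>" "big A \<C>" "refines \<C> \<B>"
  shows "\<not> captured K' X' \<C>"
proof -
  have "\<forall>X' K' \<C>. X' \<subseteq> X \<longrightarrow> X' \<approx> A \<longrightarrow> K' \<subset> K \<longrightarrow> fin_base A \<C> \<longrightarrow> big A \<C> \<longrightarrow> refines \<C> \<B> \<longrightarrow>
    \<not> captured K' X' \<C>"
    using assms(1) unfolding minimal_def by (elim conjE) assumption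
  then show ?thesis using assms(2-) by simp
qed

lemma minimal_exists:
  assumes "finite K" "X \<subseteq> A" "X \<approx> A" "fin_base A \<B>" "big A \<B>" "captured K X \<B>"
  shows "\<exists>X' K' \<C>. X' \<subseteq> X \<and> K' \<subseteq> K \<and> refines \<C> \<B> \<and> minimal A X' K' \<C>"
  using assms
proof (induction K arbitrary: X \<B> rule: finite_psubset_induct)
  case (psubset K)
  show ?case
  proof (cases "minimal A X K \<B>")
    case True
    then show ?thesis using refines_refl by blast
  next
    case False
    then obtain X' K' \<C> where *: "X' \<subseteq> X" "X' \<approx> A" "K' \<subset> K" "fin_base A \<C>" "big A \<C>" "refines \<C> \<B>"
      "captured K' X' \<C>"
      using psubset.prems unfolding minimal_def by blast
    have "X' \<subseteq> A" using *(1) psubset.prems(1) by blast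
    then obtain X'' K'' \<D> where "X'' \<subseteq> X'" "K'' \<subseteq> K'" "refines \<D> \<C>" "minimal A X'' K'' \<D>"
      using psubset.IH[OF *(3) _ *(2,4,5,7)] by blast
    moreover have "refines \<D> \<B>" using *(6) calculation(3) by (rule refines_trans)
    moreover have "X'' \<subseteq> X" "K'' \<subseteq> K" using * calculation by blast+
    ultimately show ?thesis by blast
  qed
qed

lemma minimal_Int:
  assumes "minimal A X K \<B>" "positive A \<B> H"
  shows "minimal A X K ((\<lambda>E. E \<inter> H) ` \<B>)"
  unfolding minimal_def
proof (intro conjI allI impI notI)
  note m = minimalD[OF assms(1)]
  show "fin_base A ((\<lambda>E. E \<inter> H) ` \<B>)" using m(3) by (rule fin_base_Int)
  show "big A ((\<lambda>E. E \<inter> H) ` \<B>)" using assms(2) by (simp add: big_Int_iff)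
  show "captured K X ((\<lambda>E. E \<inter> H) ` \<B>)" unfolding captured_def
  proof
    fix x assume "x \<in> X"
    then obtain E where "E \<in> \<B>" "E \<subseteq> NK K x" using m(5) unfolding captured_def by blast
    then show "\<exists>F\<in>(\<lambda>E. E \<inter> H) ` \<B>. F \<subseteq> NK K x" by (intro bexI[of _ "E \<inter> H"]) auto
  qed
  show False if "X' \<subseteq> X" "X' \<approx> A" "K' \<subset> K" "fin_base A \<D>" "big A \<D>"
    "refines \<D> ((\<lambda>E. E \<inter> H) ` \<B>)" "captured K' X' \<D>" for X' K' \<D>
    using minimal_irreducible[OF assms(1) that(1-5) refines_trans[OF refines_Int that(6)]] that(7) by blast
qed (use minimalD[OF assms(1)] in simp_all)

lemma minimal_subset:
  assumes "minimal A X K \<B>" "X' \<subseteq> X" "X' \<approx> A"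
  shows "minimal A X' K \<B>"
  unfolding minimal_def
proof (intro conjI allI impI notI)
  note m = minimalD[OF assms(1)]
  show "X' \<subseteq> A" using m(1) assms(2) by blast
  show "captured K X' \<B>" using m(5) assms(2) unfolding captured_def by blast
  show False if "Z \<subseteq> X'" "Z \<approx> A" "K' \<subset> K" "fin_base A \<D>" "big A \<D>" "refines \<D> \<B>"
    "captured K' Z \<D>" for Z K' \<D>
    using minimal_irreducible[OF assms(1) order_trans[OF that(1) assms(2)] that(2-6)] that(7) by blast
qed (use minimalD[OF assms(1)] assms(3) in simp_all)

text \<open>Otherwise, for \<open>|A|\<close> many \<open>x\<close>, the \<open>k\<close>-neighbours
  of \<open>x\<close> in the trace of some member on \<open>P\<close> are fewer than
  \<open>|A|\<close>. Cutting the base down to \<open>P\<close> and absorbing these exceptions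
  captures all these \<open>x\<close> without \<open>k\<close>. With \<open>P = N k a\<close> the
  lemma provides common \<open>k\<close>-neighbours of \<open>a\<close> and almost all of
  \<open>X\<close>.\<close>

lemma minimal_almost:
  assumes "minimal A X K \<B>" "infinite A" "k \<in> K" "positive A \<B> P"
  shows "{x\<in>X. \<not> positive A \<B> (N k x \<inter> P)} \<prec> A"
proof (rule ccontr)
  let ?X = "{x\<in>X. \<not> positive A \<B> (N k x \<inter> P)}" and ?C = "(\<lambda>E. E \<inter> P) ` \<B>"
  assume "\<not> ?X \<prec> A"
  then have "A \<lesssim> ?X" using not_lepoll_iff by blast
  moreover have XA: "?X \<subseteq> A" using assms(1) unfolding minimal_def by blast
  ultimately have eq: "?X \<approx> A" using lepoll_antisym subset_imp_lepoll[OF XA] by blast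
  have cap: "captured K X \<B>" and fb: "fin_base A \<B>" using assms(1) unfolding minimal_def by simp_all
  have C: "fin_base A ?C" "big A ?C" using fin_base_Int[OF fb] assms(4) by (auto simp: big_Int_iff)
  have "\<exists>F\<in>?C. F - NK (K - {k}) x \<prec> A" if x: "x \<in> ?X" for x
  proof -
    obtain E where E: "E \<in> \<B>" "\<not> A \<lesssim> E \<inter> (N k x \<inter> P)" using x unfolding positive_def by blast
    obtain E' where E': "E' \<in> \<B>" "E' \<subseteq> NK K x" using x cap unfolding captured_def by blast
    obtain F where F: "F \<in> \<B>" "F \<subseteq> E \<inter> E'" using fin_base_directed[OF fb E(1) E'(1)] by blast
    have "F \<inter> P - NK (K - {k}) x \<subseteq> E \<inter> (N k x \<inter> P)"
      using F(2) E'(2) unfolding NK_def by blast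
    then have "F \<inter> P - NK (K - {k}) x \<prec> A"
      using subset_lesspoll E(2) not_lepoll_iff by blast
    then show ?thesis using F(1) by blast
  qed
  then obtain \<D> where D: "fin_base A \<D>" "big A \<D>" "refines \<D> ?C" "captured (K - {k}) ?X \<D>"
    using captured_absorb[OF assms(2) C XA, of "K - {k}"] by blast
  have "refines \<D> \<B>" using refines_Int D(3) by (rule refines_trans)
  moreover have "K - {k} \<subset> K" using assms(3) by blast
  ultimately show False using minimal_irreducible[OF assms(1) _ eq _ D(1,2)] D(4) by blast
qed

text \<open>Otherwise, for every stage \<open>V u\<close>, the points that no \<open>x\<close> of
  the stage sees in colour \<open>k\<close> form a positive set. These sets decrease along the
  stages and extend the base by one chain; a point of \<open>X\<close> that lies in stage
  \<open>u\<close> does not see the corresponding sets in colour \<open>k\<close>, so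
  \<open>k\<close> could be dropped.\<close>

lemma minimal_nonfree:
  assumes "minimal A X K \<B>" "infinite A" "k \<in> K"
    and V: "\<And>u v. (u, v) \<in> card_of A \<Longrightarrow> V u \<subseteq> V v" "X \<subseteq> (\<Union>u\<in>A. V u)"
  shows "\<exists>u\<in>A. \<exists>E\<in>\<B>. {b\<in>E. \<forall>x\<in>V u \<inter> X. b \<notin> N k x} \<prec> A"
proof (rule ccontr)
  assume no: "\<not> ?thesis"
  define g where "g = (\<lambda>S. {b. \<forall>x\<in>S \<inter> X. b \<notin> N k x})"
  have pos: "positive A \<B> (g (V u))" if "u \<in> A" for u
    unfolding positive_def
  proof
    fix E assume "E \<in> \<B>"
    then have "\<not> {b\<in>E. \<forall>x\<in>V u \<inter> X. b \<notin> N k x} \<prec> A" using no that by blast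
    moreover have "{b\<in>E. \<forall>x\<in>V u \<inter> X. b \<notin> N k x} = E \<inter> g (V u)" unfolding g_def by blast
    ultimately show "A \<lesssim> E \<inter> g (V u)" using not_lepoll_iff by fastforce
  qed
  have anti: "g T \<subseteq> g S" if "S \<subseteq> T" for S T using that unfolding g_def by blast
  have ne: "A \<noteq> {}" using assms(2) by auto
  have min: "fin_base A \<B>" "big A \<B>" "captured K X \<B>" "X \<approx> A" using assms(1) unfolding minimal_def by simp_all
  let ?C = "(\<lambda>(E, S). E \<inter> g S) ` (\<B> \<times> V ` A)"
  have C: "fin_base A ?C" "big A ?C" "refines ?C \<B>"
    using fin_base_filtration[where V = V and g = g, OF min(1,2) ne V(1) anti pos] by simp_all
  have "captured (K - {k}) X ?C"
    unfolding captured_def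
  proof
    fix x assume x: "x \<in> X"
    then obtain u where u: "u \<in> A" "x \<in> V u" using V(2) by blast
    obtain E where E: "E \<in> \<B>" "E \<subseteq> NK K x" using min(3) x unfolding captured_def by blast
    have "E \<inter> g (V u) \<subseteq> NK (K - {k}) x" using E(2) u(2) x unfolding g_def NK_def by blast
    then show "\<exists>F\<in>?C. F \<subseteq> NK (K - {k}) x"
      using E(1) u(1) by (intro bexI[of _ "E \<inter> g (V u)"]) auto
  qed
  moreover have "K - {k} \<subset> K" using assms(3) by blast
  ultimately show False using minimal_irreducible[OF assms(1) subset_refl min(4) _ C] by blast
qed

end

subsection \<open>Pieces of paths\<close>

lemma lesspoll_Diff:
  assumes "infinite Y" "Y \<prec> E" "D \<lesssim> Y" shows "Y \<prec> E - D"
proof (rule ccontr)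
  assume "\<not> Y \<prec> E - D"
  then have "E - D \<lesssim> Y" using not_lepoll_iff by blast
  then have "(E - D) \<union> D \<lesssim> Y" using assms(1,3) by (intro Un_lepoll)
  moreover have "E \<lesssim> (E - D) \<union> D" by (rule subset_imp_lepoll) blast
  ultimately have "E \<lesssim> Y" using lepoll_trans by blast
  then show False using assms(2) not_lepoll_iff by blast
qed

lemma lepoll_infinite_nonempty:
  assumes "infinite A" "A \<lesssim> S" shows "\<exists>y. y \<in> S"
proof (rule ccontr)
  assume "\<nexists>y. y \<in> S"
  then have "A \<lesssim> {}" using assms(2) by auto
  then show False using assms(1) by simp
qed

lemma lepoll_eqpoll_subset:
  assumes "A \<lesssim> B" obtains C where "C \<subseteq> B" "C \<approx> A"
  using assms inj_on_image_eqpoll_self unfolding lepoll_def by blast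

lemma well_order_on_snoc:
  assumes "well_order_on G R" "x \<notin> G"
  shows "well_order_on (insert x G) (R \<union> insert x G \<times> {x})"
    "\<And>y. y \<in> G \<Longrightarrow> underS (R \<union> insert x G \<times> {x}) y = underS R y"
    "underS (R \<union> insert x G \<times> {x}) x = G"
proof -
  note R = well_order_onD[OF assms(1)]
  let ?T = "R \<union> insert x G \<times> {x}"
  show 1: "underS ?T y = underS R y" if "y \<in> G" for y
    using that assms(2) unfolding underS_def by auto
  show 2: "underS ?T x = G" using assms(2) R(1) unfolding underS_def by auto
  have "refl_on (insert x G) ?T" using R(2) unfolding refl_on_def by auto
  moreover have "trans ?T" using R(1,3) assms(2) unfolding trans_def by blast
  moreover have "antisym ?T" using R(1,4) assms(2) unfolding antisym_def by blast
  moreover have "total_on (insert x G) ?T" using R(5) unfolding total_on_def by blast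
  moreover have "wf (?T - Id)"
  proof (rule wfI_min)
    fix q Q assume q: "q \<in> (Q :: 'a set)"
    show "\<exists>z\<in>Q. \<forall>y. (y, z) \<in> ?T - Id \<longrightarrow> y \<notin> Q"
    proof (cases "Q \<inter> G = {}")
      case True
      then show ?thesis using q R(1) by (intro bexI[of _ q]) auto
    next
      case False
      then obtain z0 where z0: "z0 \<in> Q \<inter> G" by blast
      obtain z where z: "z \<in> Q \<inter> G" "\<And>y. (y, z) \<in> R - Id \<Longrightarrow> y \<notin> Q \<inter> G"
        using R(6) z0 by (rule wfE_min) (rule that)
      have "y \<notin> Q" if "(y, z) \<in> ?T - Id" for y
        using that z R(1) assms(2) by auto
      then show ?thesis using z(1) by blast
    qed
  qed
  moreover have "?T \<subseteq> insert x G \<times> insert x G" using R(1) by auto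
  ultimately show "well_order_on (insert x G) ?T"
    unfolding well_order_on_def linear_order_on_def partial_order_on_def preorder_on_def by blast
qed

lemma positive_lepoll:
  assumes "positive A \<B> P" "\<B> \<noteq> {}" shows "A \<lesssim> P \<inter> \<Union>\<B>"
proof -
  obtain E where E: "E \<in> \<B>" using assms(2) by blast
  then have "A \<lesssim> E \<inter> P" using assms(1) unfolding positive_def by blast
  then show ?thesis by (rule lepoll_subset) (use E in blast)
qed

lemma positive_mono: "positive A \<B> P \<Longrightarrow> P \<subseteq> P' \<Longrightarrow> positive A \<B> P'"
  unfolding positive_def using lepoll_subset by (meson Int_mono subset_refl)

context coloured_nbhds
begin

text \<open>The last hypothesis serves two situations: if \<open>G\<close> has a last point, an edge
  from \<open>y\<close> to that point is enough; otherwise \<open>x\<close> sits at a limit and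
  \<open>y\<close> must see \<open>G\<close> cofinally.\<close>

lemma path_order_snoc:
  assumes "path_order k G b R" "x \<notin> G" "y \<in> N k x" "y \<notin> b ` G"
    and "\<And>u. u \<in> G \<Longrightarrow> \<exists>w\<in>G. (u, w) \<in> R \<and> y \<in> N k w"
  shows "path_order k (insert x G) (b(x := y)) (R \<union> insert x G \<times> {x})"
    "z \<in> insert x G \<Longrightarrow> (z, x) \<in> R \<union> insert x G \<times> {x}"
proof -
  have wo: "well_order_on G R" using assms(1) unfolding path_order_def by blast
  note s = well_order_on_snoc[OF wo assms(2)]
  have "inj_on (b(x := y)) (insert x G)"
    using assms(1,2,4) unfolding path_order_def inj_on_def by auto
  moreover have "(b(x := y)) v \<in> N k v \<and> (\<forall>u\<in>underS (R \<union> insert x G \<times> {x}) v.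
      \<exists>w\<in>underS (R \<union> insert x G \<times> {x}) v. (u, w) \<in> R \<union> insert x G \<times> {x} \<and> (b(x := y)) v \<in> N k w)"
    if v: "v \<in> insert x G" for v
  proof (cases "v = x")
    case True
    then show ?thesis using s(3) assms(3,5) by auto
  next
    case False
    then have vG: "v \<in> G" using v by blast
    then have "b v \<in> N k v" "\<forall>u\<in>underS R v. \<exists>w\<in>underS R v. (u, w) \<in> R \<and> b v \<in> N k w"
      using assms(1) unfolding path_order_def by blast+
    then show ?thesis using s(2)[OF vG] False by auto
  qed
  ultimately show "path_order k (insert x G) (b(x := y)) (R \<union> insert x G \<times> {x})"
    using s(1) unfolding path_order_def by blast
qed blast

text \<open>\<open>U\<close> stands for the points and \<open>Q\<close> for the links already spent,
  and the size \<open>M\<close> makes room for the points to be inserted later. The last point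
  allows the next block to be attached by a link to it alone.\<close>

definition piece :: "'a set \<Rightarrow> 'a set \<Rightarrow> nat \<Rightarrow> 'a set set \<Rightarrow> 'a set \<Rightarrow> 'a set \<Rightarrow> 'a set \<Rightarrow> bool" where
  "piece A X k \<B> U Q M \<longleftrightarrow> (\<exists>G b R. G \<subseteq> X - U \<and> M \<lesssim> G \<and> G \<prec> A \<and> path_order k G b R \<and>
     b ` G \<subseteq> \<Union>\<B> - Q \<and> (\<exists>l\<in>G. \<forall>x\<in>G. (x, l) \<in> R))"

definition rich :: "'a set \<Rightarrow> 'a set \<Rightarrow> nat \<Rightarrow> 'a set set \<Rightarrow> bool" where
  "rich A X k \<B> \<longleftrightarrow> (\<forall>U Q M. U \<prec> A \<longrightarrow> Q \<prec> A \<longrightarrow> M \<prec> A \<longrightarrow> piece A X k \<B> U Q M)"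

text \<open>Only finite pieces are needed, so there are no limits and a path grows by one point at a
  time. Every point is taken outside \<open>bad UNIV\<close>; then its
  \<open>k\<close>-neighbourhood is positive, and almost every point of \<open>X\<close> can be the
  next one.\<close>

lemma rich_countable:
  assumes min: "minimal A X K \<B>" and A: "infinite A" "\<And>M :: 'a set. M \<prec> A \<Longrightarrow> finite M"
    and k: "k \<in> K"
  shows "rich A X k \<B>"
  unfolding rich_def
proof (intro allI impI)
  fix U Q M :: "'a set" assume U: "U \<prec> A" and Q: "Q \<prec> A" and M: "M \<prec> A"
  note m = minimalD[OF min]
  have ne: "\<B> \<noteq> {}" using m(3) by (rule fin_base_nonempty)
  define bad where "bad = (\<lambda>P. {x\<in>X. \<not> positive A \<B> (N k x \<inter> P)})"
  have fin_lt: "F \<prec> A" if "finite F" for F :: "'a set" using that A(1) by (rule finite_lesspoll_infinite[rotated])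
  have "positive A \<B> UNIV" using m(4) unfolding big_def positive_def by simp
  then have bU: "bad UNIV \<prec> A" unfolding bad_def by (rule minimal_almost[OF min A(1) k])
  have pick: "\<exists>x. x \<in> X - (U \<union> bad UNIV \<union> F)" if F: "F \<prec> A" for F
  proof -
    have "U \<union> bad UNIV \<union> F \<prec> A" using U bU F by (intro Un_lesspoll[OF A(1)])
    then have "X - (U \<union> bad UNIV \<union> F) \<approx> A" using eqpoll_Diff[OF A(1) m(2)] by blast
    then have "A \<lesssim> X - (U \<union> bad UNIV \<union> F)" using eqpoll_sym eqpoll_imp_lepoll by blast
    then show ?thesis by (rule lepoll_infinite_nonempty[OF A(1)])
  qed
  have choose: "\<exists>y. y \<in> P \<inter> \<Union>\<B> - (Q \<union> F)" if "positive A \<B> P" "finite F" for P F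
  proof -
    have "Q \<union> F \<prec> A" by (rule Un_lesspoll[OF A(1) Q fin_lt[OF that(2)]])
    then have "A \<lesssim> P \<inter> \<Union>\<B> - (Q \<union> F)"
      by (rule lepoll_Diff[OF A(1) positive_lepoll[OF that(1) ne]])
    then show ?thesis by (rule lepoll_infinite_nonempty[OF A(1)])
  qed
  have ex: "\<exists>G b R l. finite G \<and> card G = Suc n \<and> G \<subseteq> X - (U \<union> bad UNIV) \<and> path_order k G b R \<and>
    b ` G \<subseteq> \<Union>\<B> - Q \<and> l \<in> G \<and> (\<forall>x\<in>G. (x, l) \<in> R)" for n
  proof (induction n)
    case 0
    obtain x where x: "x \<in> X - (U \<union> bad UNIV \<union> {})" using pick fin_lt[of "{}"] by blast
    then have "positive A \<B> (N k x)" unfolding bad_def by auto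
    then obtain y where y: "y \<in> N k x \<inter> \<Union>\<B> - (Q \<union> {})" using choose by blast
    have "path_order k {} (\<lambda>_. y) {}"
      unfolding path_order_def well_order_on_def linear_order_on_def partial_order_on_def preorder_on_def
      by (auto simp: refl_on_def)
    from path_order_snoc(1)[OF this, of x y] y
    have "path_order k {x} (\<lambda>_. y) {(x, x)}" by (simp add: fun_upd_idem)
    then show ?case using x y
      by (intro exI[of _ "{x}"] exI[of _ "\<lambda>_. y"] exI[of _ "{(x, x)}"] exI[of _ x]) simp
  next
    case (Suc n)
    then obtain G b R l where G: "finite G" "card G = Suc n" "G \<subseteq> X - (U \<union> bad UNIV)" "path_order k G b R"
      "b ` G \<subseteq> \<Union>\<B> - Q" "l \<in> G" "\<forall>x\<in>G. (x, l) \<in> R" by (elim exE conjE) (rule that)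
    have "l \<in> X" "l \<notin> bad UNIV" using G(3,6) by blast+
    then have "positive A \<B> (N k l)" unfolding bad_def by simp
    then have "bad (N k l) \<prec> A" unfolding bad_def by (rule minimal_almost[OF min A(1) k])
    then have "G \<union> bad (N k l) \<prec> A" by (rule Un_lesspoll[OF A(1) fin_lt[OF G(1)]])
    then obtain x where x: "x \<in> X - (U \<union> bad UNIV \<union> (G \<union> bad (N k l)))"
      by (elim pick[THEN exE]) (rule that)
    then have "positive A \<B> (N k x \<inter> N k l)" unfolding bad_def by auto
    moreover have "finite (b ` G)" using G(1) by simp
    ultimately obtain y where y: "y \<in> N k x \<inter> N k l \<inter> \<Union>\<B> - (Q \<union> b ` G)"
      using choose by (metis (no_types))
    let ?b = "b(x := y)" and ?R = "R \<union> insert x G \<times> {x}"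
    have xG: "x \<notin> G" using x by blast
    have "path_order k (insert x G) ?b ?R"
      using path_order_snoc(1)[OF G(4) xG, of y] y G(6,7) by blast
    moreover have "?b ` insert x G \<subseteq> \<Union>\<B> - Q" using G(5) y by auto
    moreover have "insert x G \<subseteq> X - (U \<union> bad UNIV)" using G(3) x by blast
    moreover have "card (insert x G) = Suc (Suc n)" using G(1,2) xG by simp
    ultimately show ?case using G(1)
      by (intro exI[of _ "insert x G"] exI[of _ ?b] exI[of _ ?R] exI[of _ x] conjI) (assumption | simp)+
  qed
  obtain G b R l where G: "finite G" "card G = Suc (card M)" "G \<subseteq> X - (U \<union> bad UNIV)"
    "path_order k G b R" "b ` G \<subseteq> \<Union>\<B> - Q" "l \<in> G" "\<forall>x\<in>G. (x, l) \<in> R" using ex[of "card M"] by (elim exE conjE) (rule that)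
  moreover have "M \<lesssim> G" using lepoll_iff_card_le[OF A(2)[OF M] G(1)] G(2) by simp
  ultimately show "piece A X k \<B> U Q M" unfolding piece_def
    by (intro exI[of _ G] exI[of _ b] exI[of _ R] conjI bexI[of _ l] fin_lt) (assumption | blast)+
qed

text \<open>The statement for the induction on size. For infinite \<open>Z\<close>, small initial
  segments make all final segments of the path as large as \<open>Z\<close>; this is used to put a
  further point on top.\<close>

definition pathable :: "'a set \<Rightarrow> bool" where
  "pathable Z \<longleftrightarrow> (\<forall>K \<B>. finite K \<longrightarrow> fin_base Z \<B> \<longrightarrow> big Z \<B> \<longrightarrow> captured K Z \<B> \<longrightarrow>
     (\<exists>k\<in>K. \<exists>Z' b R. Z' \<subseteq> Z \<and> Z' \<approx> Z \<and> path_order k Z' b R \<and> b ` Z' \<subseteq> \<Union>\<B> \<and>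
       (\<forall>x\<in>Z'. underS R x \<prec> Z')))"

lemma pathableD:
  assumes "pathable Z" "finite K" "fin_base Z \<B>" "big Z \<B>" "captured K Z \<B>"
  shows "\<exists>k\<in>K. \<exists>Z' b R. Z' \<subseteq> Z \<and> Z' \<approx> Z \<and> path_order k Z' b R \<and> b ` Z' \<subseteq> \<Union>\<B> \<and>
    (\<forall>x\<in>Z'. underS R x \<prec> Z')"
  using assms(1)[unfolded pathable_def, THEN spec, THEN spec, THEN mp, THEN mp, THEN mp, THEN mp, OF assms(2-5)] .

lemma path_order_with_top:
  assumes "finite K" "infinite Y" "Y \<prec> E" "\<And>y. y \<in> Y \<Longrightarrow> E \<subseteq> NK K y"
    and path: "\<And>Z. Z \<approx> Y \<Longrightarrow> pathable Z"
  shows "\<exists>k\<in>K. \<exists>G b R. G \<subseteq> Y \<and> G \<approx> Y \<and> path_order k G b R \<and> b ` G \<subseteq> E \<and>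
    (\<exists>l\<in>G. \<forall>x\<in>G. (x, l) \<in> R)"
  using assms
proof (induction K arbitrary: Y E rule: finite_psubset_induct)
  case (psubset K)
  show ?case
  proof (cases "\<exists>Y' E' K'. Y' \<subseteq> Y \<and> Y' \<approx> Y \<and> E' \<subseteq> E \<and> Y \<prec> E' \<and> K' \<subset> K \<and> (\<forall>y\<in>Y'. E' \<subseteq> NK K' y)")
    case True
    then obtain Y' E' K' where *: "Y' \<subseteq> Y" "Y' \<approx> Y" "E' \<subseteq> E" "Y \<prec> E'" "K' \<subset> K"
      "\<And>y. y \<in> Y' \<Longrightarrow> E' \<subseteq> NK K' y" by blast
    have "infinite Y'" using *(2) psubset.prems(1) eqpoll_finite_iff by blast
    moreover have "Y' \<prec> E'" using *(2,4) by (rule eq_lesspoll_trans)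
    moreover have "pathable Z" if "Z \<approx> Y'" for Z using psubset.prems(4) eqpoll_trans[OF that *(2)] by blast
    ultimately obtain k G b R where G: "k \<in> K'" "G \<subseteq> Y'" "G \<approx> Y'" "path_order k G b R" "b ` G \<subseteq> E'"
      "\<exists>l\<in>G. \<forall>x\<in>G. (x, l) \<in> R"
      using psubset.IH[OF *(5)] *(6) by metis
    moreover have "G \<approx> Y" using G(3) *(2) by (rule eqpoll_trans)
    ultimately show ?thesis using *(1,3,5) by (intro bexI[of _ k] exI[of _ G] exI[of _ b] exI[of _ R] conjI) (assumption | blast)+
  next
    case False
    then have irr: "\<not> Y \<prec> E'" if "Y' \<subseteq> Y" "Y' \<approx> Y" "E' \<subseteq> E" "K' \<subset> K" "\<And>y. y \<in> Y' \<Longrightarrow> E' \<subseteq> NK K' y"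
      for Y' E' K' using that by blast
    obtain Ya Yb where Y: "Ya \<union> Yb = Y" "Ya \<inter> Yb = {}" "Ya \<approx> Y" "Yb \<approx> Y"
      using split_infinite psubset.prems(1) by blast
    have "fin_base Ya {E}" by (rule fin_base_singleton)
    moreover have "big Ya {E}"
      using eq_lesspoll_trans[OF Y(3) psubset.prems(2)] lesspoll_imp_lepoll unfolding big_def by blast
    moreover have "captured K Ya {E}" using psubset.prems(3) Y(1) unfolding captured_def by blast
    ultimately have "\<exists>k\<in>K. \<exists>Z b R. Z \<subseteq> Ya \<and> Z \<approx> Ya \<and> path_order k Z b R \<and> b ` Z \<subseteq> \<Union>{E} \<and>
      (\<forall>x\<in>Z. underS R x \<prec> Z)"
      by (intro pathableD[OF psubset.prems(4)[OF Y(3)] psubset.hyps])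
    then obtain k Z b R where Z: "k \<in> K" "Z \<subseteq> Ya" "Z \<approx> Ya" "path_order k Z b R" "b ` Z \<subseteq> \<Union>{E}"
      "\<forall>x\<in>Z. underS R x \<prec> Z" by (elim bexE exE conjE) (rule that)
    have ZY: "Z \<approx> Y" using Z(3) Y(3) by (rule eqpoll_trans)
    have Zinf: "infinite Z" using ZY psubset.prems(1) eqpoll_finite_iff by blast
    have wo: "well_order_on Z R" using Z(4) unfolding path_order_def by blast
    note R = well_order_onD[OF wo]
    have Kk: "K - {k} \<subset> K" using Z(1) by blast
    define M where "M = (\<lambda>z. {e\<in>E. \<forall>w\<in>Z. (z, w) \<in> R \<longrightarrow> e \<notin> N k w})"
    have M: "M z \<lesssim> Y" if z: "z \<in> Z" for z
    proof -
      have eq: "{w\<in>Z. (z, w) \<in> R} = Z - underS R z"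
      proof (intro equalityI subsetI)
        fix w assume "w \<in> {w\<in>Z. (z, w) \<in> R}"
        then show "w \<in> Z - underS R z" using R(4) unfolding underS_def antisym_def by blast
      next
        fix w assume w: "w \<in> Z - underS R z"
        then show "w \<in> {w\<in>Z. (z, w) \<in> R}"
          using R(5) z refl_onD[OF R(2) z] unfolding underS_def total_on_def
          by (cases "w = z") auto
      qed
      have "{w\<in>Z. (z, w) \<in> R} \<approx> Z"
        unfolding eq by (rule eqpoll_Diff[OF Zinf eqpoll_refl bspec[OF Z(6) z]])
      then have "{w\<in>Z. (z, w) \<in> R} \<approx> Y" using ZY by (rule eqpoll_trans)
      moreover have "{w\<in>Z. (z, w) \<in> R} \<subseteq> Y" using Z(2) Y(1) by blast
      moreover have "M z \<subseteq> NK (K - {k}) w" if "w \<in> {w\<in>Z. (z, w) \<in> R}" for w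
      proof -
        have "w \<in> Y" using that Z(2) Y(1) by blast
        then have "E \<subseteq> NK K w" by (rule psubset.prems(3))
        then show ?thesis using that unfolding M_def NK_def by blast
      qed
      moreover have "M z \<subseteq> E" unfolding M_def by blast
      ultimately have "\<not> Y \<prec> M z" by (intro irr[OF _ _ _ Kk])
      then show ?thesis using not_lepoll_iff by blast
    qed
    define T where "T = {e\<in>E. \<forall>z\<in>Z. \<exists>w\<in>Z. (z, w) \<in> R \<and> e \<in> N k w}"
    have "(\<Union>z\<in>Z. M z) \<lesssim> Y"
      using M eqpoll_imp_lepoll[OF ZY] by (intro UN_lepoll[OF psubset.prems(1)])
    moreover have "E - T \<subseteq> (\<Union>z\<in>Z. M z)" unfolding M_def T_def by blast
    ultimately have ET: "E - T \<lesssim> Y" using lepoll_trans subset_imp_lepoll by blast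
    \<comment> \<open>Otherwise removing the \<open>k\<close>-neighbours of all points of
      \<open>Yb\<close> deletes only \<open>|Y|\<close> points of \<open>E\<close>, and
      \<open>Yb\<close> sees the rest without \<open>k\<close>.\<close>
    have "\<exists>x\<in>Yb. Y \<prec> N k x \<inter> E"
    proof (rule ccontr)
      assume "\<not> ?thesis"
      then have "N k x \<inter> E \<lesssim> Y" if "x \<in> Yb" for x using that not_lepoll_iff by blast
      then have "(\<Union>x\<in>Yb. N k x \<inter> E) \<lesssim> Y"
        using eqpoll_imp_lepoll[OF Y(4)] by (intro UN_lepoll[OF psubset.prems(1)])
      then have "Y \<prec> E - (\<Union>x\<in>Yb. N k x \<inter> E)" by (rule lesspoll_Diff[OF psubset.prems(1,2)])
      moreover have "E - (\<Union>x\<in>Yb. N k x \<inter> E) \<subseteq> NK (K - {k}) y" if "y \<in> Yb" for y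
      proof -
        have "y \<in> Y" using that Y(1) by blast
        then have "E \<subseteq> NK K y" by (rule psubset.prems(3))
        then show ?thesis using that unfolding NK_def by blast
      qed
      moreover have "Yb \<subseteq> Y" using Y(1) by blast
      ultimately show False using irr[OF _ Y(4) Diff_subset Kk, of "\<Union>x\<in>Yb. N k x \<inter> E"] by blast
    qed
    then obtain x where x: "x \<in> Yb" "Y \<prec> N k x \<inter> E" by blast
    have "b ` Z \<lesssim> Y" using image_lepoll ZY by (rule lepoll_trans2)
    then have "(E - T) \<union> b ` Z \<lesssim> Y" using ET by (intro Un_lepoll[OF psubset.prems(1)])
    then have "\<not> N k x \<inter> E \<subseteq> (E - T) \<union> b ` Z" using x(2) not_lepoll_iff lepoll_trans[OF subset_imp_lepoll] by blast
    then obtain y where y: "y \<in> N k x" "y \<in> T" "y \<in> E" "y \<notin> b ` Z" by blast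
    have xZ: "x \<notin> Z" using x(1) Z(2) Y(2) by blast
    let ?b = "b(x := y)" and ?R = "R \<union> insert x Z \<times> {x}"
    have "\<exists>w\<in>Z. (u, w) \<in> R \<and> y \<in> N k w" if "u \<in> Z" for u using y(2) that unfolding T_def by blast
    then have "path_order k (insert x Z) ?b ?R" by (rule path_order_snoc(1)[OF Z(4) xZ y(1,4)])
    moreover have "insert x Z \<approx> Y" using infinite_insert_eqpoll[OF Zinf] ZY by (rule eqpoll_trans)
    moreover have "?b ` insert x Z \<subseteq> E" using Z(5) y(3) by auto
    moreover have "insert x Z \<subseteq> Y" using x(1) Z(2) Y(1) by blast
    moreover have "\<exists>l\<in>insert x Z. \<forall>z\<in>insert x Z. (z, l) \<in> ?R" by blast
    ultimately show ?thesis
      by (intro bexI[OF _ Z(1)] exI[of _ "insert x Z"] exI[of _ ?b] exI[of _ ?R] conjI)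
  qed
qed

text \<open>A particular colour may fail to be rich, but not all of them: the obstructions
  \<open>U\<close>, \<open>Q\<close> and sizes of the finitely many colours are united,
  \<open>M0\<close> making the size infinite, and a piece that defeats the union defeats the
  obstruction of its own colour.\<close>

lemma rich_uncountable:
  fixes M0 :: "'a set"
  assumes min: "minimal A X K \<B>" and A: "infinite A" "infinite M0" "M0 \<prec> A" and K: "finite K"
    and X1: "X1 \<subseteq> X" "X1 \<approx> A" and path: "\<And>Z. infinite Z \<Longrightarrow> Z \<prec> A \<Longrightarrow> pathable Z"
  shows "\<exists>k\<in>K. rich A X1 k \<B>"
proof (rule ccontr)
  assume no: "\<not> ?thesis"
  note m = minimalD[OF min]
  have "\<forall>k\<in>K. \<exists>U Q M. U \<prec> A \<and> Q \<prec> A \<and> M \<prec> A \<and> \<not> piece A X1 k \<B> U Q M"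
  proof
    fix k assume "k \<in> K"
    then have "\<not> rich A X1 k \<B>" using no by blast
    then show "\<exists>U Q M. U \<prec> A \<and> Q \<prec> A \<and> M \<prec> A \<and> \<not> piece A X1 k \<B> U Q M"
      unfolding rich_def by blast
  qed
  then obtain u q s where uqs: "\<And>k. k \<in> K \<Longrightarrow> u k \<prec> A" "\<And>k. k \<in> K \<Longrightarrow> q k \<prec> A" "\<And>k. k \<in> K \<Longrightarrow> s k \<prec> A"
    "\<And>k. k \<in> K \<Longrightarrow> \<not> piece A X1 k \<B> (u k) (q k) (s k)" by metis
  define U Q M where "U = (\<Union>k\<in>K. u k)" and "Q = (\<Union>k\<in>K. q k)" and "M = M0 \<union> (\<Union>k\<in>K. s k)"
  have U: "U \<prec> A" unfolding U_def using uqs(1) by (rule finite_UN_lesspoll[OF A(1) K])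
  have Q: "Q \<prec> A" unfolding Q_def using uqs(2) by (rule finite_UN_lesspoll[OF A(1) K])
  have "(\<Union>k\<in>K. s k) \<prec> A" using uqs(3) by (rule finite_UN_lesspoll[OF A(1) K])
  then have "M \<prec> A" unfolding M_def by (rule Un_lesspoll[OF A(1,3)])
  moreover have "infinite M" unfolding M_def using A(2) by simp
  ultimately have M: "M \<prec> A" "infinite M" by blast+
  have XU: "X1 - U \<approx> A" using eqpoll_Diff[OF A(1) X1(2) U] .
  \<comment> \<open>A set \<open>B\<close> of least size above \<open>|M|\<close> is taken inside
    \<open>X1 - U\<close>, so \<open>|B|\<close> is the successor of \<open>|M|\<close>. Since
    \<open>|M|\<close> is below the cofinality of \<open>|B|\<close>, \<open>|M|\<close> many
    members of the regularized base have a common lower bound.\<close>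
  define bs where "bs = (\<lambda>B. B \<subseteq> X1 - U \<and> M \<prec> B)"
  have "M \<prec> X1 - U" using M(1) eqpoll_sym[OF XU] by (rule lesspoll_eq_trans)
  then have "bs (X1 - U)" unfolding bs_def by blast
  then have "\<exists>r\<in>card_of ` Collect bs. \<forall>r'\<in>card_of ` Collect bs. r \<le>o r'"
    by (intro exists_minim_Card_order) (auto simp: card_of_Card_order)
  then obtain B where B: "bs B" "\<And>B'. bs B' \<Longrightarrow> B \<lesssim> B'" unfolding lepoll_iff_card_of by blast
  have small: "L \<lesssim> M" if L: "L \<prec> B" for L :: "'a set"
  proof (rule ccontr)
    assume "\<not> L \<lesssim> M"
    then have "M \<prec> L" using not_lepoll_iff by blast
    obtain L' where L': "L' \<subseteq> B" "L' \<approx> L"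
      by (rule lepoll_eqpoll_subset[OF lesspoll_imp_lepoll[OF L]]) (rule that)
    have "M \<prec> L'" using \<open>M \<prec> L\<close> eqpoll_sym[OF L'(2)] by (rule lesspoll_eq_trans)
    then have "bs L'" using L'(1) B(1) unfolding bs_def by blast
    then have "B \<lesssim> L'" by (rule B(2))
    then have "B \<lesssim> L" using L'(2) by (rule lepoll_trans2)
    then show False using L not_lepoll_iff by blast
  qed
  have MB: "M \<prec> B" and BX: "B \<subseteq> X1 - U" using B(1) unfolding bs_def by blast+
  have Binf: "infinite B"
    using lesspoll_imp_lepoll[OF MB] M(2) unfolding lepoll_def using inj_on_finite by blast
  have cap: "\<exists>E\<in>\<B>. E \<subseteq> NK K x" if "x \<in> B" for x
    using m(5) that BX X1(1) unfolding captured_def by blast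
  obtain X' \<B>' where X': "X' \<subseteq> B" "X' \<approx> B" "\<B>' \<subseteq> \<B>" "\<And>x. x \<in> X' \<Longrightarrow> \<exists>E\<in>\<B>'. E \<subseteq> NK K x"
    "\<And>J. J \<subseteq> \<B>' \<Longrightarrow> too_few B J \<Longrightarrow> \<exists>E\<in>\<B>'. \<forall>F\<in>J. E \<subseteq> F"
    by (rule fin_base_regularize[OF m(3) Binf, of "\<lambda>x E. E \<subseteq> NK K x"])
      (assumption | rule cap that order_trans)+
  have "M \<prec> X'" using MB eqpoll_sym[OF X'(2)] by (rule lesspoll_eq_trans)
  then obtain Y where Y: "Y \<subseteq> X'" "Y \<approx> M"
    by (rule lepoll_eqpoll_subset[OF lesspoll_imp_lepoll]) (rule that)
  obtain e where e: "\<And>y. y \<in> Y \<Longrightarrow> e y \<in> \<B>'" "\<And>y. y \<in> Y \<Longrightarrow> e y \<subseteq> NK K y"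
    using bchoice[of Y "\<lambda>y E. E \<in> \<B>' \<and> E \<subseteq> NK K y"] X'(4) Y(1) by blast
  have "e ` Y \<lesssim> M" using image_lepoll Y(2) by (rule lepoll_trans2)
  then have "too_few B (e ` Y)" by (rule eqpoll_too_few[OF M(2) _ MB small])
  moreover have "e ` Y \<subseteq> \<B>'" using e(1) by blast
  ultimately have "\<exists>E\<in>\<B>'. \<forall>F\<in>e ` Y. E \<subseteq> F" by (intro X'(5))
  then obtain E where E: "E \<in> \<B>'" "\<And>y. y \<in> Y \<Longrightarrow> E \<subseteq> e y" by blast
  have EB: "E \<in> \<B>" using E(1) X'(3) by blast
  have "A \<lesssim> E" using m(4) EB unfolding big_def by blast
  then have "A \<lesssim> E - Q" using Q by (rule lepoll_Diff[OF A(1)])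
  have YA: "Y \<prec> A" using Y(2) M(1) by (rule eq_lesspoll_trans)
  then have YE: "Y \<prec> E - Q" using \<open>A \<lesssim> E - Q\<close> by (rule lesspoll_trans2)
  have Yinf: "infinite Y" using Y(2) M(2) eqpoll_finite_iff by blast
  have sub: "E - Q \<subseteq> NK K y" if "y \<in> Y" for y using E(2)[OF that] e(2)[OF that] by blast
  have pY: "pathable Z" if "Z \<approx> Y" for Z
  proof (rule path)
    show "infinite Z" using that Yinf eqpoll_finite_iff by blast
    show "Z \<prec> A" using that YA by (rule eq_lesspoll_trans)
  qed
  have "\<exists>k\<in>K. \<exists>G b R. G \<subseteq> Y \<and> G \<approx> Y \<and> path_order k G b R \<and> b ` G \<subseteq> E - Q \<and>
    (\<exists>l\<in>G. \<forall>x\<in>G. (x, l) \<in> R)"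
    by (rule path_order_with_top[OF K Yinf YE]) (erule sub pY)+
  then obtain k G b R where G: "k \<in> K" "G \<subseteq> Y" "G \<approx> Y" "path_order k G b R" "b ` G \<subseteq> E - Q"
    "\<exists>l\<in>G. \<forall>x\<in>G. (x, l) \<in> R"
    by (elim bexE exE conjE) (rule that, (assumption | rule bexI)+)
  have "G \<subseteq> X1 - u k" using G(1,2) Y(1) X'(1) BX unfolding U_def by blast
  moreover have "s k \<lesssim> G"
  proof -
    have "s k \<lesssim> M" by (rule subset_imp_lepoll) (use G(1) in \<open>auto simp: M_def\<close>)
    also have "M \<approx> G" using eqpoll_trans[OF G(3) Y(2)] by (rule eqpoll_sym)
    finally show ?thesis .
  qed
  moreover have "G \<prec> A" using G(3) YA by (rule eq_lesspoll_trans)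
  moreover have "b ` G \<subseteq> \<Union>\<B> - q k" using G(1,5) EB unfolding Q_def by blast
  ultimately have "piece A X1 k \<B> (u k) (q k) (s k)"
    unfolding piece_def using G(4,6) by (intro exI[of _ G] exI[of _ b] exI[of _ R] conjI)
  then show False using uqs(4) G(1) by blast
qed

end

section \<open>Blocks: inserting prescribed points into a piece\<close>

definition pair_order :: "'a \<Rightarrow> 'a set \<Rightarrow> 'a rel" where
  "pair_order g F = {(x, y). x \<in> insert g F \<and> y \<in> insert g F \<and> (x = g \<or> x = y)}"

text \<open>\<open>F\<close> has at most one element. The pair is either a point of a piece followed
  by the point inserted after it, or a link followed by its vertex.\<close>

lemma well_order_on_pair_order:
  assumes "\<And>x y. x \<in> F \<Longrightarrow> y \<in> F \<Longrightarrow> x = y" "g \<notin> F"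
  shows "well_order_on (insert g F) (pair_order g F)"
proof -
  let ?R = "pair_order g F"
  have "wf (?R - Id)"
  proof (rule wfI_min)
    fix q :: 'a and Q assume q: "q \<in> Q"
    show "\<exists>z\<in>Q. \<forall>y. (y, z) \<in> ?R - Id \<longrightarrow> y \<notin> Q"
    proof (cases "g \<in> Q")
      case True
      then show ?thesis by (intro bexI[of _ g]) (auto simp: pair_order_def)
    next
      case False
      then show ?thesis using q by (intro bexI[of _ q]) (auto simp: pair_order_def)
    qed
  qed
  moreover have "total_on (insert g F) ?R" using assms(1) by (auto simp: total_on_def pair_order_def)
  moreover have "antisym ?R" using assms by (auto simp: antisym_def pair_order_def)
  moreover have "trans ?R" by (auto simp: trans_def pair_order_def)
  moreover have "refl_on (insert g F) ?R" by (auto simp: refl_on_def pair_order_def)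
  moreover have "?R \<subseteq> insert g F \<times> insert g F" by (auto simp: pair_order_def)
  ultimately show ?thesis
    unfolding well_order_on_def linear_order_on_def partial_order_on_def preorder_on_def by blast
qed

lemma underS_pair_order:
  "underS (pair_order g F) g = {}" "a \<in> F \<Longrightarrow> a \<noteq> g \<Longrightarrow> underS (pair_order g F) a = {g}"
  by (auto simp: underS_def pair_order_def)

context coloured_nbhds
begin

text \<open>
  The points of \<open>D\<close> are inserted into a rich piece \<open>G\<close>, each \<open>a\<close> immediately after a different point
  \<open>h a\<close>; the links around the inserted points are chosen anew.
\<close>

lemma block_exists:
  assumes A: "infinite A" and ne: "\<B> \<noteq> {}" and rich: "rich A X k \<B>" and D: "D \<prec> A"
    and bad: "(\<Union>a\<in>D. {x\<in>X. \<not> positive A \<B> (N k x \<inter> N k a)}) \<prec> A"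
    and U: "U \<prec> A" and Q: "Q \<prec> A" and T: "{x\<in>X. \<not> positive A \<B> (N k x \<inter> T)} \<prec> A"
  obtains W R b l where "D \<subseteq> W" "W - D \<subseteq> X - U" "W \<prec> A" "well_order_on W R" "inj_on b W"
    "b ` W \<subseteq> \<Union>\<B> - Q" "l \<in> W" "\<And>x. x \<in> W \<Longrightarrow> (x, l) \<in> R"
    "\<And>x. x \<in> W \<Longrightarrow> b x \<in> N k x" "\<And>x. x \<in> W \<Longrightarrow> underS R x = {} \<Longrightarrow> b x \<in> T"
    "\<And>x u. x \<in> W \<Longrightarrow> u \<in> underS R x \<Longrightarrow> \<exists>w\<in>underS R x. (u, w) \<in> R \<and> b x \<in> N k w"
proof -
  define badD where "badD = (\<Union>a\<in>D. {x\<in>X. \<not> positive A \<B> (N k x \<inter> N k a)})"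
  define badT where "badT = {x\<in>X. \<not> positive A \<B> (N k x \<inter> T)}"
  have U': "U \<union> D \<union> badD \<union> badT \<prec> A"
    using U D bad T unfolding badD_def badT_def by (intro Un_lesspoll[OF A])
  have M: "{undefined} \<union> D \<prec> A"
    by (rule Un_lesspoll[OF A finite_lesspoll_infinite[OF A] D]) simp
  have "piece A X k \<B> (U \<union> D \<union> badD \<union> badT) Q ({undefined} \<union> D)"
    using rich U' Q M unfolding rich_def by blast
  then obtain G b0 R0 l0 where G: "G \<subseteq> X - (U \<union> D \<union> badD \<union> badT)" "{undefined} \<union> D \<lesssim> G" "G \<prec> A"
    "path_order k G b0 R0" "b0 ` G \<subseteq> \<Union>\<B> - Q" "l0 \<in> G" "\<forall>x\<in>G. (x, l0) \<in> R0"
    unfolding piece_def by (elim exE bexE conjE) (rule that)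
  have GD: "G \<inter> D = {}" using G(1) by blast
  have "D \<lesssim> G" using subset_imp_lepoll[of D "{undefined} \<union> D"] G(2) lepoll_trans by blast
  then obtain h where h: "inj_on h D" "h ` D \<subseteq> G" unfolding lepoll_def by blast
  have wo0: "well_order_on G R0" using G(4) unfolding path_order_def by blast
  note R0 = well_order_onD[OF wo0]
  have b0: "inj_on b0 G" "\<And>g. g \<in> G \<Longrightarrow> b0 g \<in> N k g"
    "\<And>g u. g \<in> G \<Longrightarrow> u \<in> underS R0 g \<Longrightarrow> \<exists>w\<in>underS R0 g. (u, w) \<in> R0 \<and> b0 g \<in> N k w"
    using G(4) unfolding path_order_def by blast+
  define F where "F = (\<lambda>g. {a\<in>D. h a = g})"
  define W where "W = (\<lambda>g. insert g (F g))"
  define Rg where "Rg = (\<lambda>g. pair_order g (F g))"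
  have F1: "x = y" if "x \<in> F g" "y \<in> F g" for x y g
    using that h(1) unfolding F_def inj_on_def by auto
  have F2: "g \<notin> F g" if "g \<in> G" for g using that GD unfolding F_def by blast
  have woW: "well_order_on (W g) (Rg g)" if "g \<in> G" for g
    unfolding W_def Rg_def by (rule well_order_on_pair_order) (use F1 F2[OF that] in blast)+
  have disj: "W g \<inter> W g' = {}" if "g \<in> G" "g' \<in> G" "g \<noteq> g'" for g g'
    using that GD unfolding W_def F_def by auto
  let ?R = "wo_sum R0 W Rg" and ?W = "G \<union> D"
  have WU: "(\<Union>g\<in>G. W g) = ?W" using h(2) unfolding W_def F_def by auto
  have wo: "well_order_on ?W ?R"
    using well_order_on_wo_sum[where W = W and R = Rg, OF wo0 woW disj] unfolding WU by blast
  have under: "underS ?R x = (\<Union>j\<in>underS R0 g. W j) \<union> underS (Rg g) x" if "g \<in> G" "x \<in> W g" for g x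
    by (rule underS_wo_sum[where W = W and R = Rg, OF wo0 disj woW that])
  have uG: "underS ?R g = (\<Union>j\<in>underS R0 g. W j)" if "g \<in> G" for g
    using under[OF that, of g] underS_pair_order(1)[of g "F g"] unfolding W_def Rg_def by simp
  have hG: "h a \<in> G" if "a \<in> D" for a using h(2) that by blast
  have aF: "a \<in> F (h a)" if "a \<in> D" for a using that unfolding F_def by blast
  have aW: "a \<in> W (h a)" if "a \<in> D" for a using aF[OF that] unfolding W_def by blast
  have uD: "underS ?R a = (\<Union>j\<in>underS R0 (h a). W j) \<union> {h a}" if a: "a \<in> D" for a
  proof -
    have "a \<noteq> h a"
    proof
      assume "a = h a"
      then have "a \<in> G" using hG[OF a] by simp
      then show False using GD a by blast
    qed
    then have "underS (Rg (h a)) a = {h a}"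
      unfolding Rg_def by (rule underS_pair_order(2)[OF aF[OF a]])
    then show ?thesis using under[OF hG[OF a] aW[OF a]] by simp
  qed
  have refl0: "(g, g) \<in> R0" if "g \<in> G" for g by (rule refl_onD[OF R0(2) that])
  have underG: "underS R0 g \<subseteq> G" for g using R0(1) unfolding underS_def by blast
  \<comment> \<open>Here \<open>h a\<close> is the last point of \<open>G\<close> below
    \<open>g\<close>, so the inserted \<open>a\<close> comes between the two and \<open>g\<close>
    needs a link joined to \<open>a\<close>. Links at limits survive, since their neighbours in
    \<open>G\<close> stay cofinal in the enlarged order.\<close>
  define pred where "pred = (\<lambda>a g. a \<in> D \<and> h a \<in> underS R0 g \<and> (\<forall>g'\<in>underS R0 g. (g', h a) \<in> R0))"
  define old where "old = {g\<in>G. underS R0 g \<noteq> {} \<and> (\<forall>a. \<not> pred a g)}"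
  \<comment> \<open>Admissible new links: an inserted point is tied to the \<open>h x\<close> before
    it, the first point to earlier blocks through \<open>T\<close>, and a point following an
    inserted one to that point. All three sets are large because the piece avoids the bad sets of
    \<open>D\<close> and \<open>T\<close>.\<close>
  define S where "S = (\<lambda>x. (if x \<in> D then N k x \<inter> N k (h x)
    else if underS R0 x = {} then N k x \<inter> T else N k x \<inter> N k (SOME a. pred a x)) \<inter> \<Union>\<B>)"
  have posD: "positive A \<B> (N k g \<inter> N k a)" if "g \<in> G" "a \<in> D" for g a
    using G(1) that unfolding badD_def by blast
  have posT: "positive A \<B> (N k g \<inter> T)" if "g \<in> G" for g
    using G(1) that unfolding badT_def by blast
  have predS: "pred (SOME a. pred a g) g" if "g \<in> ?W - old" "g \<notin> D" "underS R0 g \<noteq> {}" for g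
  proof -
    have "\<exists>a. pred a g" using that unfolding old_def by simp
    then show ?thesis by (rule someI_ex)
  qed
  have S: "A \<lesssim> S x" if x: "x \<in> ?W - old" for x
  proof -
    consider "x \<in> D" | "x \<in> G" "x \<notin> D" "underS R0 x = {}" | "x \<in> G" "x \<notin> D" "underS R0 x \<noteq> {}"
      using x by blast
    then show ?thesis
    proof cases
      case 1
      have "positive A \<B> (N k x \<inter> N k (h x))" using posD[OF hG[OF 1] 1] by (simp add: Int_commute)
      then have "A \<lesssim> N k x \<inter> N k (h x) \<inter> \<Union>\<B>" using ne by (rule positive_lepoll)
      then show ?thesis using 1 unfolding S_def by simp
    next
      case 2
      have "A \<lesssim> N k x \<inter> T \<inter> \<Union>\<B>" using posT[OF 2(1)] ne by (rule positive_lepoll)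
      then show ?thesis using 2 unfolding S_def by simp
    next
      case 3
      have "(SOME a. pred a x) \<in> D" using predS[OF x 3(2,3)] unfolding pred_def by blast
      then have "A \<lesssim> N k x \<inter> N k (SOME a. pred a x) \<inter> \<Union>\<B>"
        using posD[OF 3(1)] ne by (intro positive_lepoll)
      then show ?thesis using 3 unfolding S_def by simp
    qed
  qed
  have WA: "?W \<prec> A" using G(3) D by (rule Un_lesspoll[OF A])
  have "?W - old \<lesssim> A" using subset_lesspoll[OF Diff_subset WA] by (rule lesspoll_imp_lepoll)
  moreover have "b0 ` old \<prec> A"
  proof -
    have "old \<prec> A" by (rule subset_lesspoll[OF _ G(3)]) (auto simp: old_def)
    then show ?thesis using image_lepoll lesspoll_trans1 by blast
  qed
  then have "Q \<union> b0 ` old \<prec> A" by (rule Un_lesspoll[OF A Q])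
  ultimately obtain f where f: "inj_on f (?W - old)" "\<And>x. x \<in> ?W - old \<Longrightarrow> f x \<in> S x - (Q \<union> b0 ` old)"
    using injective_choice[OF A, of "?W - old" "Q \<union> b0 ` old" S] S by metis
  define b where "b = (\<lambda>x. if x \<in> old then b0 x else f x)"
  have oldG: "old \<subseteq> G" unfolding old_def by blast
  have fS: "f x \<in> S x" "f x \<notin> Q" "f x \<notin> b0 ` old" if "x \<in> ?W - old" for x using f(2)[OF that] by blast+
  have inj: "inj_on b ?W"
  proof (rule inj_onI)
    fix x y assume xy: "x \<in> ?W" "y \<in> ?W" "b x = b y"
    consider "x \<in> old" "y \<in> old" | "x \<in> old" "y \<notin> old" | "x \<notin> old" "y \<in> old" | "x \<notin> old" "y \<notin> old" by blast
    then show "x = y"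
    proof cases
      case 1
      then show ?thesis using xy(3) b0(1) oldG unfolding b_def inj_on_def by auto
    next
      case 2
      then show ?thesis using xy fS(3)[of y] unfolding b_def by force
    next
      case 3
      then show ?thesis using xy fS(3)[of x] unfolding b_def by force
    next
      case 4
      then show ?thesis using xy f(1) unfolding b_def inj_on_def by auto
    qed
  qed
  have bN: "b x \<in> N k x" if x: "x \<in> ?W" for x
  proof (cases "x \<in> old")
    case True
    then show ?thesis using b0(2) oldG unfolding b_def by auto
  next
    case False
    then have "f x \<in> S x" using fS(1) x by blast
    then have "f x \<in> N k x" unfolding S_def by (auto split: if_splits)
    then show ?thesis using False unfolding b_def by simp
  qed
  have bran: "b ` ?W \<subseteq> \<Union>\<B> - Q"
  proof
    fix y assume "y \<in> b ` ?W"
    then obtain x where x: "x \<in> ?W" "y = b x" by blast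
    show "y \<in> \<Union>\<B> - Q"
    proof (cases "x \<in> old")
      case True
      then show ?thesis using x G(5) oldG unfolding b_def by auto
    next
      case False
      then have "f x \<in> S x" "f x \<notin> Q" using fS x by blast+
      then show ?thesis using x(2) False unfolding b_def S_def by simp
    qed
  qed
  have min: "b x \<in> T" if x: "x \<in> ?W" "underS ?R x = {}" for x
  proof -
    have xD: "x \<notin> D"
    proof
      assume "x \<in> D"
      then show False using uD x(2) by blast
    qed
    then have xG: "x \<in> G" using x(1) by blast
    have e: "underS R0 x = {}" using uG[OF xG] x(2) unfolding W_def by blast
    then have o: "x \<notin> old" unfolding old_def by blast
    then have "f x \<in> S x" using fS(1)[of x] x(1) by blast
    moreover have "S x = N k x \<inter> T \<inter> \<Union>\<B>" using e xD unfolding S_def by simp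
    ultimately show ?thesis using o unfolding b_def by simp
  qed
  have link: "\<exists>w\<in>underS ?R x. (u, w) \<in> ?R \<and> b x \<in> N k w" if x: "x \<in> ?W" "u \<in> underS ?R x" for x u
  proof (cases "x \<in> D")
    case True
    then have "x \<notin> old" using oldG GD by blast
    then have "f x \<in> S x" "b x = f x" using fS(1)[of x] x(1) unfolding b_def by simp_all
    then have bx: "b x \<in> N k (h x)" using True unfolding S_def by simp
    have "h x \<in> underS ?R x" using uD[OF True] by blast
    moreover have "(u, h x) \<in> ?R"
    proof -
      have hW: "h x \<in> W (h x)" unfolding W_def by blast
      consider j where "j \<in> underS R0 (h x)" "u \<in> W j" | "u = h x" using x(2) uD[OF True] by blast
      then show ?thesis
      proof cases
        case 1
        then show ?thesis using hW unfolding underS_def by (intro wo_sum_intro1[of j "h x"]) auto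
      next
        case 2
        then show ?thesis
          using hW refl0[OF hG[OF True]] unfolding Rg_def by (intro wo_sum_intro2[of "h x"]) (auto simp: pair_order_def)
      qed
    qed
    ultimately show ?thesis using bx by blast
  next
    case False
    then have xG: "x \<in> G" using x(1) by blast
    obtain j where j: "j \<in> underS R0 x" "u \<in> W j" using x(2) uG[OF xG] by blast
    have jG: "j \<in> G" using j(1) underG by blast
    have ne0: "underS R0 x \<noteq> {}" using j(1) by blast
    show ?thesis
    proof (cases "x \<in> old")
      case True
      then have nopred: "\<And>a. \<not> pred a x" and bx: "b x = b0 x" unfolding old_def b_def by simp_all
      \<comment> \<open>\<open>W j\<close> contains \<open>j\<close> and perhaps a point inserted
        after \<open>j\<close>, so in the case \<open>w = j\<close> the neighbour is above
        \<open>u\<close> only if \<open>u = j\<close>.\<close>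
      have step: "?thesis" if w: "w \<in> underS R0 x" "(j, w) \<in> R0" "b0 x \<in> N k w" "w \<noteq> j \<or> u = j" for w
      proof -
        have wW: "w \<in> W w" unfolding W_def by blast
        have "(u, w) \<in> ?R"
        proof (cases "w = j")
          case True
          then show ?thesis using w(4) wW refl0[OF jG] unfolding Rg_def
            by (intro wo_sum_intro2[of j]) (auto simp: pair_order_def W_def)
        next
          case False
          then show ?thesis using w(2) j(2) wW by (intro wo_sum_intro1[of j w]) auto
        qed
        moreover have "w \<in> underS ?R x" using uG[OF xG] w(1) wW by blast
        ultimately show ?thesis using w(3) bx by auto
      qed
      show ?thesis
      proof (cases "u = j")
        case True
        then show ?thesis using b0(3)[OF xG j(1)] step by blast
      next
        case False
        then have u: "u \<in> D" "h u = j" using j(2) unfolding W_def F_def by auto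
        \<comment> \<open>\<open>u\<close> was inserted after \<open>j\<close> without becoming the
          immediate predecessor of \<open>x\<close>, so the old path has a point \<open>g'\<close>
          strictly between \<open>j\<close> and \<open>x\<close>; a neighbour above
          \<open>g'\<close> is above \<open>u\<close>.\<close>
        obtain g' where g': "g' \<in> underS R0 x" "(g', j) \<notin> R0"
          using nopred[of u] u j(1) unfolding pred_def by blast
        have "(j, g') \<in> R0"
          using R0(5) g' jG subsetD[OF underG g'(1)] refl0[OF jG] unfolding total_on_def
          by (cases "j = g'") auto
        moreover obtain w where w: "w \<in> underS R0 x" "(g', w) \<in> R0" "b0 x \<in> N k w"
          using b0(3)[OF xG g'(1)] by blast
        ultimately have "(j, w) \<in> R0" using R0(3) unfolding trans_def by blast
        moreover have "w \<noteq> j" using w(2) g'(2) by blast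
        ultimately show ?thesis using step[OF w(1) _ w(3)] by blast
      qed
    next
      case notold: False
      define a where "a = (SOME a. pred a x)"
      have "pred a x" unfolding a_def using predS x(1) notold False ne0 by blast
      then have a: "a \<in> D" "h a \<in> underS R0 x" "\<And>g'. g' \<in> underS R0 x \<Longrightarrow> (g', h a) \<in> R0"
        unfolding pred_def by blast+
      have "f x \<in> S x" "b x = f x" using fS(1)[of x] x(1) notold unfolding b_def by simp_all
      then have "b x \<in> N k a" using False ne0 unfolding S_def a_def by simp
      moreover have "a \<in> underS ?R x" using uG[OF xG] a(2) aW[OF a(1)] by blast
      moreover have "(u, a) \<in> ?R"
      proof (cases "j = h a")
        case True
        have "u = h a \<or> u = a" using j(2) True F1[OF _ aF[OF a(1)]] unfolding W_def by blast
        then show ?thesis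
          using True j(2) aW[OF a(1)] aF[OF a(1)] refl0[OF jG] unfolding Rg_def
          by (intro wo_sum_intro2[of "h a"]) (auto simp: pair_order_def)
      next
        case False
        then show ?thesis using a(3)[OF j(1)] j(2) aW[OF a(1)] by (intro wo_sum_intro1[of j "h a"])
      qed
      ultimately show ?thesis by blast
    qed
  qed
  have last: "\<exists>l\<in>?W. \<forall>x\<in>?W. (x, l) \<in> ?R"
  proof -
    have l0: "\<exists>l\<in>W l0. \<forall>y\<in>W l0. (y, l) \<in> Rg l0"
    proof (cases "F l0 = {}")
      case True
      then show ?thesis unfolding W_def Rg_def by (auto simp: pair_order_def)
    next
      case False
      then obtain a where a: "a \<in> F l0" by blast
      have "(y, a) \<in> Rg l0" if "y \<in> W l0" for y
      proof -
        have "y = l0 \<or> y = a" using that F1[OF _ a] unfolding W_def by blast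
        then show ?thesis using a unfolding Rg_def by (auto simp: pair_order_def)
      qed
      then show ?thesis using a unfolding W_def by blast
    qed
    then obtain l where l: "l \<in> W l0" "\<forall>y\<in>W l0. (y, l) \<in> Rg l0" by blast
    have "(x, l) \<in> ?R" if x: "x \<in> ?W" for x
    proof -
      have "x \<in> (\<Union>g\<in>G. W g)" unfolding WU by (rule x)
      then obtain g where g: "g \<in> G" "x \<in> W g" by blast
      show ?thesis
      proof (cases "g = l0")
        case True
        then show ?thesis using l g refl0[OF g(1)] by (intro wo_sum_intro2[of l0]) auto
      next
        case False
        then show ?thesis using l(1) g G(7) by (intro wo_sum_intro1[of g l0]) auto
      qed
    qed
    moreover have "l \<in> ?W" unfolding WU[symmetric] using l(1) G(6) by blast
    ultimately show ?thesis by blast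
  qed
  then obtain l where l: "l \<in> ?W" "\<And>x. x \<in> ?W \<Longrightarrow> (x, l) \<in> ?R" by blast
  show thesis
  proof (rule that[of ?W ?R b l])
    show "D \<subseteq> ?W" by blast
    show "?W - D \<subseteq> X - U" using G(1) by blast
    show "b x \<in> N k x" if "x \<in> ?W" for x by (rule bN[OF that])
    show "b x \<in> T" if "x \<in> ?W" "underS ?R x = {}" for x by (rule min[OF that])
    show "\<exists>w\<in>underS ?R x. (u, w) \<in> ?R \<and> b x \<in> N k w" if "x \<in> ?W" "u \<in> underS ?R x" for x u
      by (rule link[OF that])
    show "(x, l) \<in> ?R" if "x \<in> ?W" for x by (rule l(2)[OF that])
  qed (fact WA wo inj bran l(1))+
qed

end

subsection \<open>Concatenating blocks\<close>

lemma card_of_refl: "a \<in> A \<Longrightarrow> (a, a) \<in> card_of A"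
  by (rule refl_onD[OF card_of_linear(1)])

lemma regular_cofinal_infinite:
  assumes "regular_cofinal A C" "infinite A" shows "infinite C"
proof
  assume "finite C"
  let ?F = "\<lambda>c. underS (card_of A) c \<union> {c}"
  have CA: "C \<subseteq> A" using assms(1) unfolding regular_cofinal_def by blast
  have "(\<Union>c\<in>C. ?F c) \<prec> A"
  proof (rule finite_UN_lesspoll[OF assms(2) \<open>finite C\<close>])
    fix c assume "c \<in> C"
    then have "c \<in> A" using CA by blast
    then have "underS (card_of A) c \<prec> A" by (rule underS_card_of)
    then show "?F c \<prec> A"
      by (rule Un_lesspoll[OF assms(2) _ finite_lesspoll_infinite[OF assms(2)]]) simp
  qed
  moreover have "A \<subseteq> (\<Union>c\<in>C. ?F c)"
  proof
    fix u assume "u \<in> A"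
    then obtain c where "c \<in> C" "(u, c) \<in> card_of A" using assms(1) unfolding regular_cofinal_def by blast
    then show "u \<in> (\<Union>c\<in>C. ?F c)" unfolding underS_def by auto
  qed
  ultimately show False using subset_lesspoll lesspoll_not_refl by blast
qed

text \<open>A subset with nothing above \<open>u\<close> lies in a proper initial segment of
  \<open>C\<close>, which is smaller than \<open>C\<close>.\<close>

lemma regular_cofinal_subset:
  assumes "regular_cofinal A C" "C' \<subseteq> C" "C' \<approx> C" "u \<in> A"
  shows "\<exists>c\<in>C'. (u, c) \<in> card_of A"
proof (rule ccontr)
  assume no: "\<not> ?thesis"
  obtain c0 where c0: "c0 \<in> C" "(u, c0) \<in> card_of A"
    using assms(1,4) unfolding regular_cofinal_def by blast
  have CA: "C \<subseteq> A" using assms(1) unfolding regular_cofinal_def by blast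
  have "C' \<subseteq> {d\<in>C. (d, c0) \<in> card_of A \<and> d \<noteq> c0}"
  proof
    fix d assume d: "d \<in> C'"
    then have "(u, d) \<notin> card_of A" using no by blast
    moreover have "d \<in> A" using d assms(2) CA by blast
    ultimately have "(d, u) \<in> card_of A" using card_of_cases[OF assms(4)] by blast
    then have "(d, c0) \<in> card_of A" using c0(2) card_of_linear(2) unfolding trans_def by metis
    moreover have "d \<noteq> c0" using \<open>(u, d) \<notin> card_of A\<close> c0(2) by auto
    ultimately show "d \<in> {d\<in>C. (d, c0) \<in> card_of A \<and> d \<noteq> c0}" using d assms(2) by blast
  qed
  moreover have "{d\<in>C. (d, c0) \<in> card_of A \<and> d \<noteq> c0} \<prec> C"
    using assms(1) c0(1) unfolding regular_cofinal_def by blast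
  ultimately have "C' \<prec> C" by (rule subset_lesspoll)
  then show False using assms(3) unfolding lesspoll_def by blast
qed

context coloured_nbhds
begin

text \<open>Recursion along \<open>C\<close>: the earlier stages together are smaller than
  \<open>A\<close>, so the rest of \<open>X\<close> is still minimal, and
  \<open>minimal_nonfree\<close> yields a stage such that almost every point of some member of the
  base has a \<open>k\<close>-neighbour among the new points. Regularizing these members replaces
  \<open>C\<close> by \<open>C'\<close>, which does no harm: with fewer earlier stages there are
  more new points.\<close>

lemma block_filtration:
  fixes A :: "'a set" and V :: "'a \<Rightarrow> 'a set"
  assumes A: "infinite A" and min: "minimal A X K \<B>" and k: "k \<in> K" and C: "regular_cofinal A C"
    and V: "\<And>u v. (u, v) \<in> card_of A \<Longrightarrow> V u \<subseteq> V v" "\<And>u. u \<in> A \<Longrightarrow> V u \<prec> A" "X \<subseteq> (\<Union>u\<in>A. V u)"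
  obtains C' t \<B>' where "C' \<subseteq> C" "C' \<approx> C" "\<B>' \<subseteq> \<B>"
    "\<And>c. c \<in> C' \<Longrightarrow> t c \<in> A" "\<And>c. c \<in> C' \<Longrightarrow> (c, t c) \<in> card_of A"
    "\<And>c. c \<in> C' \<Longrightarrow> \<exists>E\<in>\<B>'. {b\<in>E. \<forall>x\<in>V (t c) \<inter> X - (\<Union>e\<in>{e\<in>C'. (e, c) \<in> card_of A - Id}. V (t e)). b \<notin> N k x} \<prec> A"
    "\<And>J. J \<subseteq> \<B>' \<Longrightarrow> too_few C J \<Longrightarrow> \<exists>E\<in>\<B>'. \<forall>F\<in>J. E \<subseteq> F"
proof -
  let ?r = "card_of A - Id"
  define pre where "pre = (\<lambda>c. {e\<in>C. (e, c) \<in> ?r})"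
  define miss where "miss = (\<lambda>E Z. {b\<in>E. \<forall>x\<in>Z. b \<notin> N k x})"
  define P where "P = (\<lambda>f c u. c \<in> C \<longrightarrow> u \<in> A \<and> (c, u) \<in> card_of A \<and>
    (\<exists>E\<in>\<B>. miss E (V u \<inter> X - (\<Union>e\<in>pre c. V (f e))) \<prec> A))"
  have CA: "C \<subseteq> A" using C unfolding regular_cofinal_def by blast
  have pre: "pre c \<prec> C" if "c \<in> C" for c
  proof -
    have "pre c \<subseteq> {d\<in>C. (d, c) \<in> card_of A \<and> d \<noteq> c}" unfolding pre_def by blast
    then show ?thesis by (rule subset_lesspoll) (use C that in \<open>simp add: regular_cofinal_def\<close>)
  qed
  have "\<exists>f. \<forall>c. P f c (f c)"
  proof (rule dependent_wf_choice[OF wf_card_of[of A]])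
    fix f g :: "'a \<Rightarrow> 'a" and c u assume eq: "\<And>z. (z, c) \<in> ?r \<Longrightarrow> f z = g z"
    have "(\<Union>e\<in>pre c. V (f e)) = (\<Union>e\<in>pre c. V (g e))" unfolding pre_def using eq by auto
    then show "P f c u = P g c u" unfolding P_def by simp
  next
    fix c f assume IH: "\<And>y. (y, c) \<in> ?r \<Longrightarrow> P f y (f y)"
    show "\<exists>u. P f c u"
    proof (cases "c \<in> C")
      case True
      let ?Y = "\<Union>e\<in>pre c. V (f e)"
      have "V (f e) \<prec> A" if "e \<in> pre c" for e
        using IH[of e] that V(2) unfolding pre_def P_def by blast
      then have "?Y \<prec> A" by (rule regular_cofinal_UN_lesspoll[OF C A pre[OF True]])
      then have "X - ?Y \<approx> A" by (rule eqpoll_Diff[OF A minimalD(2)[OF min]])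
      then have "minimal A (X - ?Y) K \<B>" by (rule minimal_subset[OF min Diff_subset])
      moreover have "X - ?Y \<subseteq> (\<Union>u\<in>A. V u)" using V(3) by blast
      ultimately obtain u0 E where u0: "u0 \<in> A" "E \<in> \<B>" "{b\<in>E. \<forall>x\<in>V u0 \<inter> (X - ?Y). b \<notin> N k x} \<prec> A"
        using minimal_nonfree[where V = V, OF _ A k V(1)] by blast
      have cA: "c \<in> A" using True CA by blast
      have "(c, c) \<in> card_of A" "(u0, u0) \<in> card_of A"
        using card_of_refl[OF cA] card_of_refl[OF u0(1)] .
      then obtain u where u: "u \<in> A" "(c, u) \<in> card_of A" "(u0, u) \<in> card_of A"
        using card_of_cases[OF cA u0(1)] cA u0(1) by blast
      have "miss E (V u \<inter> X - ?Y) \<subseteq> {b\<in>E. \<forall>x\<in>V u0 \<inter> (X - ?Y). b \<notin> N k x}"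
        unfolding miss_def using V(1)[OF u(3)] by blast
      then have "miss E (V u \<inter> X - ?Y) \<prec> A" using u0(3) by (rule subset_lesspoll)
      then show ?thesis unfolding P_def using u u0(2) by blast
    qed (simp add: P_def)
  qed
  then obtain t where t: "\<And>c. P t c (t c)" by blast
  define Q where "Q = (\<lambda>c E. miss E (V (t c) \<inter> X - (\<Union>e\<in>pre c. V (t e))) \<prec> A)"
  have Q1: "\<exists>E\<in>\<B>. Q c E" if "c \<in> C" for c using t[of c] that unfolding P_def Q_def by blast
  have Q2: "Q c F" if "Q c E" "F \<subseteq> E" for c E F
  proof -
    have "miss F Z \<subseteq> miss E Z" for Z using that(2) unfolding miss_def by blast
    then show ?thesis using that(1) subset_lesspoll unfolding Q_def by blast
  qed
  obtain C' \<B>' where C': "C' \<subseteq> C" "C' \<approx> C" "\<B>' \<subseteq> \<B>" "\<And>c. c \<in> C' \<Longrightarrow> \<exists>E\<in>\<B>'. Q c E"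
    "\<And>J. J \<subseteq> \<B>' \<Longrightarrow> too_few C J \<Longrightarrow> \<exists>E\<in>\<B>'. \<forall>F\<in>J. E \<subseteq> F"
    by (rule fin_base_regularize[OF minimalD(3)[OF min] regular_cofinal_infinite[OF C A], of Q])
      (assumption | rule Q1 Q2 that)+
  show thesis
  proof (rule that[of C' \<B>' t])
    show "t c \<in> A" "(c, t c) \<in> card_of A" if "c \<in> C'" for c
      using t[of c] that C'(1) unfolding P_def by blast+
    fix c assume c: "c \<in> C'"
    then obtain E where E: "E \<in> \<B>'" "Q c E" using C'(4) by blast
    let ?Z = "V (t c) \<inter> X - (\<Union>e\<in>{e\<in>C'. (e, c) \<in> ?r}. V (t e))"
    have "V (t c) \<inter> X - (\<Union>e\<in>pre c. V (t e)) \<subseteq> ?Z" using C'(1) unfolding pre_def by blast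
    then have "{b\<in>E. \<forall>x\<in>?Z. b \<notin> N k x} \<subseteq> miss E (V (t c) \<inter> X - (\<Union>e\<in>pre c. V (t e)))"
      unfolding miss_def by blast
    then have "{b\<in>E. \<forall>x\<in>?Z. b \<notin> N k x} \<prec> A" using E(2) unfolding Q_def by (rule subset_lesspoll)
    then show "\<exists>E\<in>\<B>'. {b\<in>E. \<forall>x\<in>?Z. b \<notin> N k x} \<prec> A" using E(1) by blast
  qed (fact C')+
qed

lemma path_from_blocks:
  fixes A :: "'a set"
  assumes A: "infinite A" and min: "minimal A X K \<B>" and k: "k \<in> K"
    and X12: "X1 \<subseteq> X" "X2 \<subseteq> X" "X1 \<inter> X2 = {}" "X1 \<approx> A" "X2 \<approx> A" and rich: "rich A X1 k \<B>"
  defines "Ap \<equiv> {a\<in>A. positive A \<B> (N k a)}"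
  shows "\<exists>b R. path_order k Ap b R \<and> b ` Ap \<subseteq> \<Union>\<B> \<and> (\<forall>x\<in>Ap. underS R x \<prec> A)"
proof -
  let ?r = "card_of A - Id"
  note m = minimalD[OF min]
  have ne: "\<B> \<noteq> {}" using m(3) by (rule fin_base_nonempty)
  have min1: "minimal A X1 K \<B>" by (rule minimal_subset[OF min X12(1,4)])
  have posU: "positive A \<B> UNIV" using m(4) unfolding big_def positive_def by simp
  have XA: "{x\<in>X. \<not> positive A \<B> (N k x \<inter> UNIV)} \<prec> A" by (rule minimal_almost[OF min A k posU])
  have XAp: "X - Ap \<prec> A" by (rule subset_lesspoll[OF _ XA]) (use m(1) in \<open>auto simp: Ap_def\<close>)
  define X2p where "X2p = X2 \<inter> Ap"
  have "X2 - (X - Ap) \<approx> A" by (rule eqpoll_Diff[OF A X12(5) XAp])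
  moreover have "X2 - (X - Ap) = X2p" using X12(2) unfolding X2p_def by blast
  ultimately have X2p: "X2p \<approx> A" by simp
  have min2: "minimal A X2p K \<B>" by (rule minimal_subset[OF min _ X2p]) (use X12(2) X2p_def in blast)
  define bad where "bad = (\<lambda>a. {x\<in>X1. \<not> positive A \<B> (N k x \<inter> N k a)})"
  have bad: "bad a \<prec> A" if "a \<in> Ap" for a
    unfolding bad_def by (rule minimal_almost[OF min1 A k]) (use that in \<open>simp add: Ap_def\<close>)
  have ApA: "Ap \<subseteq> A" unfolding Ap_def by blast
  obtain V where V: "\<And>u v. (u, v) \<in> card_of A \<Longrightarrow> V u \<subseteq> V v" "Ap = (\<Union>u\<in>A. V u)"
    "\<And>u. u \<in> A \<Longrightarrow> V u \<prec> A" "\<And>u. u \<in> A \<Longrightarrow> (\<Union>y\<in>V u. bad y) \<prec> A"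
    by (rule exhaustion[OF A ApA bad]) (assumption, rule that)
  obtain C where C: "regular_cofinal A C" using regular_cofinal_exists by blast
  have X2V: "X2p \<subseteq> (\<Union>u\<in>A. V u)" unfolding V(2)[symmetric] X2p_def by blast
  obtain C' t \<B>' where C': "C' \<subseteq> C" "C' \<approx> C" "\<B>' \<subseteq> \<B>"
    "\<And>c. c \<in> C' \<Longrightarrow> t c \<in> A" "\<And>c. c \<in> C' \<Longrightarrow> (c, t c) \<in> card_of A"
    "\<And>c. c \<in> C' \<Longrightarrow> \<exists>E\<in>\<B>'. {b\<in>E. \<forall>x\<in>V (t c) \<inter> X2p - (\<Union>e\<in>{e\<in>C'. (e, c) \<in> ?r}. V (t e)). b \<notin> N k x} \<prec> A"
    "\<And>J. J \<subseteq> \<B>' \<Longrightarrow> too_few C J \<Longrightarrow> \<exists>E\<in>\<B>'. \<forall>F\<in>J. E \<subseteq> F"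
    by (rule block_filtration[where V = V, OF A min2 k C V(1,3) X2V]) (assumption, assumption, rule that)
  have CA: "C \<subseteq> A" using C unfolding regular_cofinal_def by blast
  define pre where "pre = (\<lambda>c. {e\<in>C'. (e, c) \<in> ?r})"
  have preC: "pre c \<prec> C" if "c \<in> C'" for c
  proof -
    have "pre c \<subseteq> {d\<in>C. (d, c) \<in> card_of A \<and> d \<noteq> c}" unfolding pre_def using C'(1) by blast
    then show ?thesis
      by (rule subset_lesspoll) (use C that C'(1) in \<open>auto simp: regular_cofinal_def\<close>)
  qed
  \<comment> \<open>Possible links for the first point of block \<open>c\<close>: those whose
    \<open>k\<close>-neighbours are cofinal in the sum of the earlier blocks. The recursion can
    continue because this set is positive.\<close>
  define T where "T = (\<lambda>Wf (Rf :: 'a \<Rightarrow> 'a rel) c. {y. \<forall>e\<in>pre c. \<forall>u\<in>Wf e. \<exists>e'\<in>pre c. \<exists>w\<in>Wf e'.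
    y \<in> N k w \<and> ((e, e') \<in> ?r \<or> e = e' \<and> (u, w) \<in> Rf e)})"
  define block where "block = (\<lambda>Wf Rf bf c (W :: 'a set) (R :: 'a rel) (b :: 'a \<Rightarrow> 'a).
    V (t c) \<subseteq> W \<union> (\<Union>e\<in>pre c. Wf e) \<and> W \<inter> (\<Union>e\<in>pre c. Wf e) = {} \<and> W \<subseteq> Ap \<and> W - V (t c) \<subseteq> X1 \<and>
    W \<prec> A \<and> well_order_on W R \<and> inj_on b W \<and> b ` W \<subseteq> \<Union>\<B> - (\<Union>e\<in>pre c. bf e ` Wf e) \<and>
    (\<exists>l\<in>W. \<forall>x\<in>W. (x, l) \<in> R) \<and> (\<forall>x\<in>W. b x \<in> N k x) \<and>
    (\<forall>x\<in>W. underS R x = {} \<longrightarrow> b x \<in> T Wf Rf c) \<and>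
    (\<forall>x\<in>W. \<forall>u\<in>underS R x. \<exists>w\<in>underS R x. (u, w) \<in> R \<and> b x \<in> N k w))"
  define P where "P = (\<lambda>f c (W, R, b). c \<in> C' \<longrightarrow>
    block (\<lambda>e. fst (f e)) (\<lambda>e. fst (snd (f e))) (\<lambda>e. snd (snd (f e))) c W R b)"
  have blockD: "V (t c) \<subseteq> W \<union> (\<Union>e\<in>pre c. Wf e)" "W \<inter> (\<Union>e\<in>pre c. Wf e) = {}" "W \<subseteq> Ap"
    "W - V (t c) \<subseteq> X1" "W \<prec> A" "well_order_on W R" "inj_on b W"
    "b ` W \<subseteq> \<Union>\<B> - (\<Union>e\<in>pre c. bf e ` Wf e)" "\<exists>l\<in>W. \<forall>x\<in>W. (x, l) \<in> R" "\<forall>x\<in>W. b x \<in> N k x"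
    "\<forall>x\<in>W. underS R x = {} \<longrightarrow> b x \<in> T Wf Rf c"
    "\<forall>x\<in>W. \<forall>u\<in>underS R x. \<exists>w\<in>underS R x. (u, w) \<in> R \<and> b x \<in> N k w"
    if "block Wf Rf bf c W R b" for Wf Rf bf c W R b
    using that[unfolded block_def] by - (rule conjunctionI | (elim conjE, assumption))+
  have posT: "positive A \<B> (T Wf Rf c)"
    if c: "c \<in> C'" and bl: "\<And>e. e \<in> pre c \<Longrightarrow> block Wf Rf bf e (Wf e) (Rf e) (bf e)" for Wf Rf bf c
  proof -
    have preC': "e \<in> C'" "(e, c) \<in> ?r" if "e \<in> pre c" for e using that unfolding pre_def by blast+
    have lin: "(e, e') \<in> ?r \<or> e = e' \<or> (e', e) \<in> ?r" if "e \<in> C'" "e' \<in> C'" for e e'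
      using card_of_cases[of e A e'] that C'(1) CA by blast
    \<comment> \<open>There is no earlier block, or a last one, whose last point alone is cofinal,
      or a limit of blocks, where one neighbour in each earlier block suffices.\<close>
    consider "pre c = {}" | e where "e \<in> pre c" "\<And>e'. e' \<in> pre c \<Longrightarrow> (e, e') \<notin> ?r"
      | "\<And>e. e \<in> pre c \<Longrightarrow> \<exists>e'\<in>pre c. (e, e') \<in> ?r" by blast
    then show ?thesis
    proof cases
      case 1
      then have "T Wf Rf c = UNIV" unfolding T_def by simp
      then show ?thesis using posU by simp
    next
      case 2
      obtain l where l: "l \<in> Wf e" "\<And>x. x \<in> Wf e \<Longrightarrow> (x, l) \<in> Rf e" using blockD(9)[OF bl[OF 2(1)]] by blast
      have "N k l \<subseteq> T Wf Rf c"
      proof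
        fix y assume y: "y \<in> N k l"
        have "(e', e) \<in> ?r \<or> e' = e \<and> (u, l) \<in> Rf e'" if "e' \<in> pre c" "u \<in> Wf e'" for e' u
          using lin[of e e'] 2 preC'(1) that l(2) by blast
        then show "y \<in> T Wf Rf c" unfolding T_def using y l(1) 2(1) by blast
      qed
      moreover have "positive A \<B> (N k l)" using l(1) blockD(3)[OF bl[OF 2(1)]] unfolding Ap_def by blast
      ultimately show ?thesis using positive_mono by blast
    next
      case 3
      define H where "H = {y. \<forall>e\<in>pre c. \<exists>w\<in>Wf e. y \<in> N k w}"
      have HT: "H \<subseteq> T Wf Rf c"
      proof
        fix y assume y: "y \<in> H"
        show "y \<in> T Wf Rf c" unfolding T_def
        proof (intro CollectI ballI)
          fix e u assume e: "e \<in> pre c" "u \<in> Wf e"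
          obtain e' where "e' \<in> pre c" "(e, e') \<in> ?r" using 3 e(1) by blast
          moreover then obtain w where "w \<in> Wf e'" "y \<in> N k w" using y unfolding H_def by blast
          ultimately show "\<exists>e'\<in>pre c. \<exists>w\<in>Wf e'. y \<in> N k w \<and> ((e, e') \<in> ?r \<or> e = e' \<and> (u, w) \<in> Rf e)"
            by blast
        qed
      qed
      \<comment> \<open>A point of \<open>X2\<close> that is new at stage \<open>e\<close> is not in
        an earlier block \<open>d\<close>, since outside \<open>V (t d)\<close> that block uses only
        \<open>X1\<close>. So the hitting set of stage \<open>e\<close> lies in block
        \<open>e\<close> itself.\<close>
      have sub: "V (t e) \<inter> X2p - (\<Union>d\<in>{d\<in>C'. (d, e) \<in> ?r}. V (t d)) \<subseteq> Wf e" if e: "e \<in> pre c" for e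
      proof
        fix z assume z: "z \<in> V (t e) \<inter> X2p - (\<Union>d\<in>{d\<in>C'. (d, e) \<in> ?r}. V (t d))"
        have "z \<notin> Wf d" if d: "d \<in> pre e" for d
        proof
          assume zd: "z \<in> Wf d"
          have "(d, c) \<in> ?r"
            using d preC'(2)[OF e] card_of_linear(2,3)[of A] unfolding pre_def trans_def antisym_def by blast
          then have "d \<in> pre c" using d unfolding pre_def by blast
          then have "Wf d - V (t d) \<subseteq> X1" by (rule blockD(4)[OF bl])
          moreover have "z \<notin> V (t d)" using z d unfolding pre_def by blast
          ultimately show False using zd z X12(3) unfolding X2p_def by blast
        qed
        then show "z \<in> Wf e" using blockD(1)[OF bl[OF e]] z by blast
      qed
      have "\<forall>e\<in>pre c. \<exists>E. E \<in> \<B>' \<and> {b\<in>E. \<forall>x\<in>Wf e. b \<notin> N k x} \<prec> A"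
      proof
        fix e assume e: "e \<in> pre c"
        let ?Z = "V (t e) \<inter> X2p - (\<Union>d\<in>{d\<in>C'. (d, e) \<in> ?r}. V (t d))"
        obtain E where E: "E \<in> \<B>'" "{b\<in>E. \<forall>x\<in>?Z. b \<notin> N k x} \<prec> A" using C'(6)[OF preC'(1)[OF e]] by blast
        have "{b\<in>E. \<forall>x\<in>Wf e. b \<notin> N k x} \<subseteq> {b\<in>E. \<forall>x\<in>?Z. b \<notin> N k x}" using sub[OF e] by blast
        then show "\<exists>E. E \<in> \<B>' \<and> {b\<in>E. \<forall>x\<in>Wf e. b \<notin> N k x} \<prec> A" using E subset_lesspoll by blast
      qed
      then obtain g where "\<forall>e\<in>pre c. g e \<in> \<B>' \<and> {b\<in>g e. \<forall>x\<in>Wf e. b \<notin> N k x} \<prec> A"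
        by (rule bchoice[THEN exE])
      then have g: "\<And>e. e \<in> pre c \<Longrightarrow> g e \<in> \<B>'"
        "\<And>e. e \<in> pre c \<Longrightarrow> {b\<in>g e. \<forall>x\<in>Wf e. b \<notin> N k x} \<prec> A" by simp_all
      \<comment> \<open>There are fewer earlier blocks than the cofinality of \<open>|A|\<close>.
        Hence their members \<open>g e\<close> have a common lower bound \<open>E\<close>, and their
        exceptional sets have a union smaller than \<open>A\<close>.\<close>
      have "too_few C (g ` pre c)"
        by (rule too_few_image[OF regular_cofinal_too_few[OF C A preC[OF c]]])
      moreover have "g ` pre c \<subseteq> \<B>'" using g(1) by blast
      ultimately have "\<exists>E\<in>\<B>'. \<forall>F\<in>g ` pre c. E \<subseteq> F" by (intro C'(7))
      then obtain E where E: "E \<in> \<B>'" "\<And>e. e \<in> pre c \<Longrightarrow> E \<subseteq> g e" by blast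
      have "(\<Union>e\<in>pre c. {b\<in>g e. \<forall>x\<in>Wf e. b \<notin> N k x}) \<prec> A"
        using g(2) by (rule regular_cofinal_UN_lesspoll[OF C A preC[OF c]])
      moreover have "E - H \<subseteq> (\<Union>e\<in>pre c. {b\<in>g e. \<forall>x\<in>Wf e. b \<notin> N k x})"
      proof
        fix b assume b: "b \<in> E - H"
        then obtain e where e: "e \<in> pre c" "\<forall>w\<in>Wf e. b \<notin> N k w" unfolding H_def by blast
        moreover have "b \<in> g e" using E(2)[OF e(1)] b by blast
        ultimately show "b \<in> (\<Union>e\<in>pre c. {b\<in>g e. \<forall>x\<in>Wf e. b \<notin> N k x})" by blast
      qed
      ultimately have EH: "E - H \<prec> A" using subset_lesspoll by blast
      have "positive A \<B> H" unfolding positive_def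
      proof
        fix F assume F: "F \<in> \<B>"
        have EB: "E \<in> \<B>" using E(1) C'(3) by blast
        obtain G where G: "G \<in> \<B>" "G \<subseteq> E \<inter> F" by (rule fin_base_directed[OF m(3) EB F])
        have "A \<lesssim> G" using m(4) G(1) unfolding big_def by blast
        then have "A \<lesssim> G - (E - H)" using EH by (rule lepoll_Diff[OF A])
        then show "A \<lesssim> F \<inter> H" by (rule lepoll_subset) (use G(2) in blast)
      qed
      then show ?thesis using HT by (rule positive_mono)
    qed
  qed
  have "\<exists>f. \<forall>c. P f c (f c)"
  proof (rule dependent_wf_choice[OF wf_card_of[of A]])
    fix f g :: "'a \<Rightarrow> 'a set \<times> 'a rel \<times> ('a \<Rightarrow> 'a)" and c v
    assume eq: "\<And>z. (z, c) \<in> ?r \<Longrightarrow> f z = g z"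
    have e: "f e = g e" if "e \<in> pre c" for e using eq that unfolding pre_def by blast
    have "T (\<lambda>e. fst (f e)) (\<lambda>e. fst (snd (f e))) c = T (\<lambda>e. fst (g e)) (\<lambda>e. fst (snd (g e))) c"
      unfolding T_def using e by (simp cong: ball_cong bex_cong)
    then show "P f c v = P g c v" unfolding P_def block_def using e by (simp split: prod.splits cong: SUP_cong)
  next
    fix c and f :: "'a \<Rightarrow> 'a set \<times> 'a rel \<times> ('a \<Rightarrow> 'a)"
    assume IH: "\<And>y. (y, c) \<in> ?r \<Longrightarrow> P f y (f y)"
    show "\<exists>v. P f c v"
    proof (cases "c \<in> C'")
      case True
      let ?Wf = "\<lambda>e. fst (f e)" and ?Rf = "\<lambda>e. fst (snd (f e))" and ?bf = "\<lambda>e. snd (snd (f e))"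
      have bl: "block ?Wf ?Rf ?bf e (?Wf e) (?Rf e) (?bf e)" if e: "e \<in> pre c" for e
      proof -
        have "e \<in> C'" "P f e (f e)" using IH e unfolding pre_def by blast+
        then show ?thesis unfolding P_def by (auto split: prod.splits)
      qed
      define U where "U = (\<Union>e\<in>pre c. ?Wf e)"
      define Q where "Q = (\<Union>e\<in>pre c. ?bf e ` ?Wf e)"
      have U: "U \<prec> A" unfolding U_def
        using blockD(5)[OF bl] by (rule regular_cofinal_UN_lesspoll[OF C A preC[OF True]])
      have Q: "Q \<prec> A" unfolding Q_def
      proof (rule regular_cofinal_UN_lesspoll[OF C A preC[OF True]])
        show "?bf e ` ?Wf e \<prec> A" if "e \<in> pre c" for e
          using image_lepoll blockD(5)[OF bl[OF that]] by (rule lesspoll_trans1)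
      qed
      have tA: "t c \<in> A" by (rule C'(4)[OF True])
      define D where "D = V (t c) - U"
      have D: "D \<prec> A" unfolding D_def by (rule subset_lesspoll[OF Diff_subset V(3)[OF tA]])
      have DV: "D \<subseteq> V (t c)" unfolding D_def by blast
      have badD: "(\<Union>a\<in>D. {x\<in>X1. \<not> positive A \<B> (N k x \<inter> N k a)}) \<prec> A"
        unfolding bad_def[symmetric] by (rule subset_lesspoll[OF _ V(4)[OF tA]]) (use DV in blast)
      \<comment> \<open>Points of \<open>X\<close> outside \<open>Ap\<close> are barred from the
        piece, since the blocks have to fill exactly \<open>Ap\<close>.\<close>
      have U2: "U \<union> V (t c) \<union> (X - Ap) \<prec> A" using U V(3)[OF tA] XAp by (intro Un_lesspoll[OF A])
      have badT: "{x\<in>X1. \<not> positive A \<B> (N k x \<inter> T ?Wf ?Rf c)} \<prec> A"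
        using posT[OF True bl] by (rule minimal_almost[OF min1 A k])
      obtain W R b l where W: "D \<subseteq> W" "W - D \<subseteq> X1 - (U \<union> V (t c) \<union> (X - Ap))" "W \<prec> A"
        "well_order_on W R" "inj_on b W" "b ` W \<subseteq> \<Union>\<B> - Q" "l \<in> W" "\<And>x. x \<in> W \<Longrightarrow> (x, l) \<in> R"
        "\<And>x. x \<in> W \<Longrightarrow> b x \<in> N k x" "\<And>x. x \<in> W \<Longrightarrow> underS R x = {} \<Longrightarrow> b x \<in> T ?Wf ?Rf c"
        "\<And>x u. x \<in> W \<Longrightarrow> u \<in> underS R x \<Longrightarrow> \<exists>w\<in>underS R x. (u, w) \<in> R \<and> b x \<in> N k w"
        by (rule block_exists[OF A ne rich D badD U2 Q badT]) (rule that)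
      have VAp: "V (t c) \<subseteq> Ap" unfolding V(2) using tA by blast
      have "block ?Wf ?Rf ?bf c W R b"
        unfolding block_def U_def[symmetric] Q_def[symmetric]
      proof (intro conjI ballI impI)
        show "V (t c) \<subseteq> W \<union> U" using W(1) unfolding D_def by blast
        show "W \<inter> U = {}" using W(1,2) unfolding D_def by blast
        show "W \<subseteq> Ap" using W(2) VAp DV X12(1) by blast
        show "W - V (t c) \<subseteq> X1" using W(2) DV by blast
        show "\<exists>l\<in>W. \<forall>x\<in>W. (x, l) \<in> R" using W(7,8) by blast
        show "b x \<in> N k x" if "x \<in> W" for x by (rule W(9)[OF that])
        show "b x \<in> T ?Wf ?Rf c" if "x \<in> W" "underS R x = {}" for x by (rule W(10)[OF that])
        show "\<exists>w\<in>underS R x. (u, w) \<in> R \<and> b x \<in> N k w" if "x \<in> W" "u \<in> underS R x" for x u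
          by (rule W(11)[OF that])
      qed (fact W)+
      then have "P f c (W, R, b)" unfolding P_def by simp
      then show ?thesis by blast
    next
      case False
      then have "P f c ({}, {}, id)" unfolding P_def by simp
      then show ?thesis by blast
    qed
  qed
  then obtain f where f: "\<And>c. P f c (f c)" by blast
  define Wf Rf bf where "Wf = (\<lambda>e. fst (f e))" and "Rf = (\<lambda>e. fst (snd (f e)))" and "bf = (\<lambda>e. snd (snd (f e)))"
  have bl: "block Wf Rf bf c (Wf c) (Rf c) (bf c)" if "c \<in> C'" for c
    using f[of c] that unfolding P_def Wf_def Rf_def bf_def by (auto split: prod.splits)
  note B = blockD[OF bl]
  have CA': "C' \<subseteq> A" using C'(1) CA by blast
  have lin: "e \<in> pre e' \<or> e = e' \<or> e' \<in> pre e" if "e \<in> C'" "e' \<in> C'" for e e'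
    using card_of_cases[of e A e'] that CA' unfolding pre_def by blast
  have disj: "Wf e \<inter> Wf e' = {}" if "e \<in> C'" "e' \<in> C'" "e \<noteq> e'" for e e'
    using lin[OF that(1,2)] that(3) B(2)[OF that(1)] B(2)[OF that(2)] by blast
  have bdisj: "bf e ` Wf e \<inter> bf e' ` Wf e' = {}" if "e \<in> C'" "e' \<in> C'" "e \<noteq> e'" for e e'
    using lin[OF that(1,2)] that(3) B(8)[OF that(1)] B(8)[OF that(2)] by blast
  define S where "S = Restr (card_of A) C'"
  have woS: "well_order_on C' S" unfolding S_def
    by (rule well_order_on_Restr[OF card_of_Well_order]) (simp add: Field_card_of CA')
  have uS: "underS S c = pre c" if "c \<in> C'" for c
    using that unfolding underS_def S_def pre_def by blast
  have preS: "(e, c) \<in> S" "e \<noteq> c" "e \<in> C'" if "e \<in> pre c" "c \<in> C'" for e c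
    using that unfolding S_def pre_def by blast+
  have reflS: "(c, c) \<in> S" if "c \<in> C'" for c
    using card_of_refl[of c A] that CA' unfolding S_def by blast
  let ?R = "wo_sum S Wf Rf"
  have WU: "(\<Union>c\<in>C'. Wf c) = Ap"
  proof (intro equalityI subsetI)
    fix a assume "a \<in> (\<Union>c\<in>C'. Wf c)"
    then show "a \<in> Ap" using B(3) by blast
  next
    fix a assume "a \<in> Ap"
    then obtain u where u: "u \<in> A" "a \<in> V u" using V(2) by blast
    obtain c where c: "c \<in> C'" "(u, c) \<in> card_of A" using regular_cofinal_subset[OF C C'(1,2) u(1)] by blast
    have "a \<in> V (t c)" using V(1)[OF c(2)] V(1)[OF C'(5)[OF c(1)]] u(2) by blast
    then have "a \<in> Wf c \<union> (\<Union>e\<in>pre c. Wf e)" using B(1)[OF c(1)] by blast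
    then show "a \<in> (\<Union>c\<in>C'. Wf c)" using c(1) preS(3)[OF _ c(1)] by blast
  qed
  have wo: "well_order_on Ap ?R"
    using well_order_on_wo_sum[where W = Wf and R = Rf, OF woS B(6) disj] unfolding WU by blast
  have under: "underS ?R x = (\<Union>e\<in>pre c. Wf e) \<union> underS (Rf c) x" if "c \<in> C'" "x \<in> Wf c" for c x
    using underS_wo_sum[where W = Wf and R = Rf, OF woS disj B(6) that] uS[OF that(1)] by simp
  define i where "i = (\<lambda>x. SOME c. c \<in> C' \<and> x \<in> Wf c)"
  have i: "i x \<in> C' \<and> x \<in> Wf (i x)" if "x \<in> Ap" for x
  proof -
    have "\<exists>c. c \<in> C' \<and> x \<in> Wf c" using that unfolding WU[symmetric] by blast
    then show ?thesis unfolding i_def by (rule someI_ex)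
  qed
  define b where "b = (\<lambda>x. bf (i x) x)"
  have "inj_on b Ap"
  proof (rule inj_onI)
    fix x y assume xy: "x \<in> Ap" "y \<in> Ap" "b x = b y"
    have "b x \<in> bf (i x) ` Wf (i x)" "b y \<in> bf (i y) ` Wf (i y)" using i xy unfolding b_def by blast+
    then have "i x = i y" using bdisj[of "i x" "i y"] i[OF xy(1)] i[OF xy(2)] xy(3) by auto
    then show "x = y" using xy(3) B(7)[of "i x"] i[OF xy(1)] i[OF xy(2)] unfolding b_def inj_on_def by simp
  qed
  moreover have "b x \<in> N k x \<and> (\<forall>u\<in>underS ?R x. \<exists>w\<in>underS ?R x. (u, w) \<in> ?R \<and> b x \<in> N k w)"
    if x: "x \<in> Ap" for x
  proof (intro conjI ballI)
    let ?c = "i x"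
    have c: "?c \<in> C'" "x \<in> Wf ?c" using i[OF x] by blast+
    show "b x \<in> N k x" using B(10)[OF c(1)] c(2) unfolding b_def by blast
    fix u assume u: "u \<in> underS ?R x"
    note ux = under[OF c]
    have RW: "underS (Rf ?c) x \<subseteq> Wf ?c" using well_order_onD(1)[OF B(6)[OF c(1)]] unfolding underS_def by blast
    show "\<exists>w\<in>underS ?R x. (u, w) \<in> ?R \<and> b x \<in> N k w"
    proof (cases "underS (Rf ?c) x = {}")
      case True
      then have "b x \<in> T Wf Rf ?c" using B(11)[OF c(1)] c(2) unfolding b_def by blast
      moreover obtain e where e: "e \<in> pre ?c" "u \<in> Wf e" using u ux True by blast
      ultimately obtain e' w where w: "e' \<in> pre ?c" "w \<in> Wf e'" "b x \<in> N k w"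
        "(e, e') \<in> ?r \<or> e = e' \<and> (u, w) \<in> Rf e" unfolding T_def by blast
      have eC: "e \<in> C'" "e' \<in> C'" using e(1) w(1) unfolding pre_def by blast+
      have "(u, w) \<in> ?R"
      proof (cases "e = e'")
        case True
        then show ?thesis using w e eC reflS by (intro wo_sum_intro2[of e]) auto
      next
        case False
        then have "(e, e') \<in> S" using w(4) eC unfolding S_def by blast
        then show ?thesis using False w(2) e(2) by (intro wo_sum_intro1[of e e'])
      qed
      then show ?thesis using w ux by blast
    next
      case False
      show ?thesis
      proof (cases "u \<in> underS (Rf ?c) x")
        case True
        then obtain w where w: "w \<in> underS (Rf ?c) x" "(u, w) \<in> Rf ?c" "b x \<in> N k w"
          using B(12)[OF c(1)] c(2) unfolding b_def by blast
        have "u \<in> Wf ?c" "w \<in> Wf ?c" using True w(1) RW by blast+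
        then have "(u, w) \<in> ?R" using reflS[OF c(1)] w(2) by (intro wo_sum_intro2[of ?c])
        then show ?thesis using w ux by blast
      next
        case notin: False
        then obtain e where e: "e \<in> pre ?c" "u \<in> Wf e" using u ux by blast
        obtain w where w: "w \<in> underS (Rf ?c) x" "b x \<in> N k w"
          using False B(12)[OF c(1)] c(2) unfolding b_def by blast
        have "w \<in> Wf ?c" using w(1) RW by blast
        then have "(u, w) \<in> ?R" using preS(1,2)[OF e(1) c(1)] e(2) by (intro wo_sum_intro1[of e ?c])
        then show ?thesis using w ux by blast
      qed
    qed
  qed
  ultimately have "path_order k Ap b ?R" using wo unfolding path_order_def by blast
  moreover have "b ` Ap \<subseteq> \<Union>\<B>"
  proof
    fix y assume "y \<in> b ` Ap"
    then obtain x where x: "x \<in> Ap" "y = bf (i x) x" unfolding b_def by blast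
    then show "y \<in> \<Union>\<B>" using i[OF x(1)] B(8)[of "i x"] by blast
  qed
  moreover have "underS ?R x \<prec> A" if x: "x \<in> Ap" for x
  proof -
    have c: "i x \<in> C'" "x \<in> Wf (i x)" using i[OF x] by blast+
    have "(\<Union>e\<in>pre (i x). Wf e) \<prec> A"
    proof (rule regular_cofinal_UN_lesspoll[OF C A preC[OF c(1)]])
      show "Wf e \<prec> A" if "e \<in> pre (i x)" for e by (rule B(5)[OF preS(3)[OF that c(1)]])
    qed
    then have "(\<Union>e\<in>pre (i x). Wf e) \<union> Wf (i x) \<prec> A" using B(5)[OF c(1)] by (rule Un_lesspoll[OF A])
    moreover have "underS (Rf (i x)) x \<subseteq> Wf (i x)"
      using well_order_onD(1)[OF B(6)[OF c(1)]] unfolding underS_def by blast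
    then have "underS ?R x \<subseteq> (\<Union>e\<in>pre (i x). Wf e) \<union> Wf (i x)" unfolding under[OF c] by blast
    ultimately show ?thesis using subset_lesspoll by blast
  qed
  ultimately show ?thesis by blast
qed

subsection \<open>Covering by paths of different colours\<close>

text \<open>\<open>H\<close> halves the members of the base and all large traces
  \<open>E \<inter> N k a\<close>. A point outside \<open>A'\<close> has few
  \<open>k\<close>-neighbours in the \<open>H\<close>-half of some member \<open>E\<close>, so its
  whole trace on \<open>E\<close> was already small. In the other half, colour \<open>k\<close> is
  therefore only a small exception for such points and can be absorbed, while the links of the path
  stay in \<open>H\<close>.\<close>

lemma colour_step:
  fixes A :: "'a set"
  assumes A: "infinite A" and path: "\<And>Z. infinite Z \<Longrightarrow> Z \<prec> A \<Longrightarrow> pathable Z"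
    and K: "finite K" and \<B>: "fin_base A \<B>" "big A \<B>" "captured K A \<B>"
  obtains k A' b R \<C> where "k \<in> K" "A' \<subseteq> A" "A' \<approx> A" "path_order k A' b R" "b ` A' \<subseteq> \<Union>\<B>"
    "\<And>x. x \<in> A' \<Longrightarrow> underS R x \<prec> A" "fin_base A \<C>" "big A \<C>" "captured (K - {k}) (A - A') \<C>"
    "\<Union>\<C> \<subseteq> \<Union>\<B> - b ` A'"
proof -
  obtain X K' \<B>1 where X: "K' \<subseteq> K" "refines \<B>1 \<B>" "minimal A X K' \<B>1"
    using minimal_exists[OF K subset_refl eqpoll_refl \<B>] by blast
  note m1 = minimalD[OF X(3)]
  have ne1: "\<B>1 \<noteq> {}" using m1(3) by (rule fin_base_nonempty)
  define \<P> where "\<P> = {P \<in> \<B>1 \<union> (\<lambda>(E, k, a). E \<inter> N k a) ` (\<B>1 \<times> K' \<times> A). A \<lesssim> P}"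
  have fK: "finite K'" using X(1) K finite_subset by blast
  have B1A: "\<B>1 \<lesssim> A" using A m1(3) by (rule fin_base_lepoll)
  have "K' \<times> A \<lesssim> A"
    by (rule infinite_product_lepoll[OF A finite_lepoll_infinite[OF A fK] lepoll_refl])
  then have "\<B>1 \<times> (K' \<times> A) \<lesssim> A" by (rule infinite_product_lepoll[OF A B1A])
  then have "(\<lambda>(E, k, a). E \<inter> N k a) ` (\<B>1 \<times> K' \<times> A) \<lesssim> A"
    using image_lepoll lepoll_trans by blast
  then have "\<B>1 \<union> (\<lambda>(E, k, a). E \<inter> N k a) ` (\<B>1 \<times> K' \<times> A) \<lesssim> A" by (rule Un_lepoll[OF A B1A])
  then have PA: "\<P> \<lesssim> A" by (rule lepoll_trans[OF subset_imp_lepoll, rotated]) (auto simp: \<P>_def)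
  have Pbig: "A \<lesssim> P" if "P \<in> \<P>" for P using that unfolding \<P>_def by blast
  obtain H where H: "\<And>P. P \<in> \<P> \<Longrightarrow> A \<lesssim> P \<inter> H" "\<And>P. P \<in> \<P> \<Longrightarrow> A \<lesssim> P - H"
    by (rule splitting_set[OF A PA Pbig]) (assumption, rule that)
  have B1P: "E \<in> \<P>" if "E \<in> \<B>1" for E using that m1(4) unfolding \<P>_def big_def by blast
  have posH: "positive A \<B>1 H" using H(1) B1P unfolding positive_def by blast
  define \<B>2 where "\<B>2 = (\<lambda>E. E \<inter> H) ` \<B>1"
  have min: "minimal A X K' \<B>2" unfolding \<B>2_def by (rule minimal_Int[OF X(3) posH])
  note m = minimalD[OF min]
  have Xinf: "infinite X" using m(2) A eqpoll_finite_iff by blast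
  obtain X1 X2 where X12: "X1 \<union> X2 = X" "X1 \<inter> X2 = {}" "X1 \<approx> X" "X2 \<approx> X"
    using split_infinite[OF Xinf] by blast
  have X1A: "X1 \<approx> A" and X2A: "X2 \<approx> A" using X12(3,4) m(2) eqpoll_trans by blast+
  have X1X: "X1 \<subseteq> X" and X2X: "X2 \<subseteq> X" using X12(1) by blast+
  have "\<exists>k\<in>K'. rich A X1 k \<B>2"
  proof (cases "\<exists>M0 :: 'a set. infinite M0 \<and> M0 \<prec> A")
    case True
    then show ?thesis using rich_uncountable[OF min A _ _ fK X1X X1A path] by blast
  next
    case False
    have "K' \<noteq> {}"
    proof
      assume "K' = {}"
      obtain x where "x \<in> X" using Xinf by fastforce
      then obtain E where E: "E \<in> \<B>2" "E \<subseteq> NK K' x" using m(5) unfolding captured_def by blast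
      have "A \<lesssim> E" using m(4) E(1) unfolding big_def by blast
      then obtain y where "y \<in> E" using lepoll_infinite_nonempty[OF A] by blast
      then show False using E(2) \<open>K' = {}\<close> unfolding NK_def by blast
    qed
    then obtain k where k: "k \<in> K'" by blast
    have "rich A X1 k \<B>2"
      by (rule rich_countable[OF minimal_subset[OF min X1X X1A] A _ k]) (use False in blast)
    then show ?thesis using k by blast
  qed
  then obtain k where k: "k \<in> K'" "rich A X1 k \<B>2" by blast
  define A' where "A' = {a\<in>A. positive A \<B>2 (N k a)}"
  obtain b R where b: "path_order k A' b R" "b ` A' \<subseteq> \<Union>\<B>2" "\<forall>x\<in>A'. underS R x \<prec> A"
    using path_from_blocks[OF A min k(1) X1X X2X X12(2) X1A X2A k(2)] unfolding A'_def by blast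
  have "positive A \<B>2 UNIV" using m(4) unfolding big_def positive_def by simp
  then have "{x\<in>X. \<not> positive A \<B>2 (N k x \<inter> UNIV)} \<prec> A" by (rule minimal_almost[OF min A k(1)])
  then have "X - A' \<prec> A" by (rule subset_lesspoll[rotated]) (use m(1) in \<open>auto simp: A'_def\<close>)
  then have "X - (X - A') \<approx> A" by (rule eqpoll_Diff[OF A m(2)])
  then have "A \<lesssim> X - (X - A')" using eqpoll_sym eqpoll_imp_lepoll by blast
  then have "A \<lesssim> A'" by (rule lepoll_subset) blast
  moreover have A'A: "A' \<subseteq> A" unfolding A'_def by blast
  ultimately have eqA: "A' \<approx> A" using lepoll_antisym subset_imp_lepoll by blast
  have posH': "positive A \<B>1 (- H)"
    using H(2) B1P unfolding positive_def by (simp add: Diff_eq)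
  have ex: "\<exists>F\<in>(\<lambda>E. E \<inter> - H) ` \<B>1. F - NK (K - {k}) y \<prec> A" if y: "y \<in> A - A'" for y
  proof -
    obtain E where E: "E \<in> \<B>1" "\<not> A \<lesssim> E \<inter> H \<inter> N k y"
      using y unfolding A'_def positive_def \<B>2_def by blast
    have "E \<inter> N k y \<notin> \<P>"
    proof
      assume "E \<inter> N k y \<in> \<P>"
      then have "A \<lesssim> E \<inter> N k y \<inter> H" by (rule H(1))
      moreover have "E \<inter> N k y \<inter> H = E \<inter> H \<inter> N k y" by blast
      ultimately show False using E(2) by simp
    qed
    moreover have mem: "E \<inter> N k y \<in> (\<lambda>(E, k, a). E \<inter> N k a) ` (\<B>1 \<times> K' \<times> A)"
      using E(1) k(1) y by (intro image_eqI[of _ _ "(E, k, y)"]) auto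
    have "E \<inter> N k y \<in> \<P>" if "A \<lesssim> E \<inter> N k y"
      unfolding \<P>_def by (intro CollectI conjI UnI2 mem that)
    ultimately have "\<not> A \<lesssim> E \<inter> N k y" by blast
    then have small: "E \<inter> N k y \<prec> A" unfolding not_lepoll_iff .
    obtain E0 where E0: "E0 \<in> \<B>" "E0 \<subseteq> NK K y" using \<B>(3) y unfolding captured_def by blast
    obtain E1 where E1: "E1 \<in> \<B>1" "E1 \<subseteq> E0" using X(2) E0(1) unfolding refines_def by blast
    obtain F where F: "F \<in> \<B>1" "F \<subseteq> E \<inter> E1" by (rule fin_base_directed[OF m1(3) E(1) E1(1)])
    have "F \<inter> - H - NK (K - {k}) y \<subseteq> E \<inter> N k y"
      using F(2) E1(2) E0(2) unfolding NK_def by blast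
    then have "F \<inter> - H - NK (K - {k}) y \<prec> A" using small by (rule subset_lesspoll)
    then show ?thesis using F(1) by blast
  qed
  obtain \<C> where C: "fin_base A \<C>" "big A \<C>" "refines \<C> ((\<lambda>E. E \<inter> - H) ` \<B>1)"
    "captured (K - {k}) (A - A') \<C>"
  proof (rule captured_absorb[OF A fin_base_Int[OF m1(3), of "- H"], where Y = "A - A'" and K = "K - {k}"])
    show "big A ((\<lambda>E. E \<inter> - H) ` \<B>1)" using posH' by (simp add: big_Int_iff)
    show "A - A' \<subseteq> A" by blast
    show "\<exists>E\<in>(\<lambda>E. E \<inter> - H) ` \<B>1. E - NK (K - {k}) y \<prec> A" if "y \<in> A - A'" for y by (rule ex[OF that])
  qed (rule that)
  have s1: "\<Union>\<B>1 \<subseteq> \<Union>\<B>" using X(2) unfolding refines_def by (rule conjunct2)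
  have s2: "\<Union>\<B>2 \<subseteq> \<Union>\<B>1 \<inter> H" unfolding \<B>2_def by blast
  have "\<Union>\<C> \<subseteq> \<Union>((\<lambda>E. E \<inter> - H) ` \<B>1)" using C(3) unfolding refines_def by (rule conjunct2)
  also have "\<dots> \<subseteq> \<Union>\<B>1 - H" by blast
  finally have s3: "\<Union>\<C> \<subseteq> \<Union>\<B>1 - H" .
  have bH: "b ` A' \<subseteq> H" by (rule order_trans[OF order_trans[OF b(2) s2] Int_lower2])
  have U1: "b ` A' \<subseteq> \<Union>\<B>"
    by (rule order_trans[OF order_trans[OF order_trans[OF b(2) s2] Int_lower1] s1])
  have U2: "\<Union>\<C> \<subseteq> \<Union>\<B> - b ` A'" by (rule order_trans[OF s3 Diff_mono[OF s1 bH]])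
  show thesis
  proof (rule that[of k A' b R \<C>])
    show "k \<in> K" using k(1) X(1) by blast
    show "underS R x \<prec> A" if "x \<in> A'" for x using b(3) that by blast
  qed (fact A'A eqA b(1) U1 U2 C(1,2,4))+
qed

text \<open>Well-founded induction on the size of \<open>Z\<close>: smaller sets enter
  \<open>colour_step\<close> when a rich colour is found.\<close>

lemma infinite_pathable: "infinite Z \<Longrightarrow> pathable Z"
proof -
  have "wf {(Y :: 'a set, Z). Y \<prec> Z}"
    by (rule wf_subset[OF wf_inv_image[OF wf_ordLess, of card_of]])
      (auto simp: inv_image_def lesspoll_iff_card_of)
  then show "infinite Z \<Longrightarrow> pathable Z"
  proof (induction Z rule: wf_induct_rule)
    case (less Z)
    show ?case unfolding pathable_def
    proof (intro allI impI)
      fix K \<B> assume K: "finite K" and B: "fin_base Z \<B>" "big Z \<B>" "captured K Z \<B>"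
      have IH: "pathable Y" if "infinite Y" "Y \<prec> Z" for Y using less.IH[of Y] that by simp
      obtain k Z' b R \<C> where *: "k \<in> K" "Z' \<subseteq> Z" "Z' \<approx> Z" "path_order k Z' b R" "b ` Z' \<subseteq> \<Union>\<B>"
        "\<And>x. x \<in> Z' \<Longrightarrow> underS R x \<prec> Z" "fin_base Z \<C>" "big Z \<C>" "captured (K - {k}) (Z - Z') \<C>"
        "\<Union>\<C> \<subseteq> \<Union>\<B> - b ` Z'"
        by (rule colour_step[OF less.prems IH K B]) (assumption, assumption, rule that)
      have "underS R x \<prec> Z'" if "x \<in> Z'" for x
        using *(6)[OF that] eqpoll_sym[OF *(3)] by (rule lesspoll_eq_trans)
      then show "\<exists>k\<in>K. \<exists>Z' b R. Z' \<subseteq> Z \<and> Z' \<approx> Z \<and> path_order k Z' b R \<and> b ` Z' \<subseteq> \<Union>\<B> \<and>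
          (\<forall>x\<in>Z'. underS R x \<prec> Z')"
        using *(1-5) by (intro bexI[of _ k] exI[of _ Z'] exI[of _ b] exI[of _ R] conjI ballI)
    qed
  qed
qed

text \<open>A single injection \<open>b\<close> for all colours keeps the paths disjoint also in
  their links.\<close>

definition covered :: "nat set \<Rightarrow> 'a set \<Rightarrow> 'a set \<Rightarrow> bool" where
  "covered K A D \<longleftrightarrow> (\<exists>\<chi> b R. \<chi> ` A \<subseteq> K \<and> inj_on b A \<and> b ` A \<subseteq> D \<and>
     (\<forall>k\<in>K. path_order k {a\<in>A. \<chi> a = k} b (R k)))"

lemma path_order_cong:
  assumes "path_order k X b R" "\<And>x. x \<in> X \<Longrightarrow> b' x = b x" shows "path_order k X b' R"
proof -
  have "inj_on b' X" using assms unfolding path_order_def inj_on_def by simp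
  then show ?thesis using assms unfolding path_order_def by simp
qed

text \<open>By directedness all points of \<open>A\<close> share one infinite member
  \<open>E\<close>. Each \<open>e\<close> in \<open>E\<close> induces a pattern of colours on
  \<open>A\<close>, and infinitely many \<open>e\<close> induce the same pattern
  \<open>\<chi>\<close>. Between a class of \<open>\<chi>\<close> and these \<open>e\<close> every
  pair carries the colour of the class, so any order of the class works.\<close>

lemma covered_finite:
  assumes A: "finite A" and K: "finite K" and fb: "fin_base M \<B>"
    and inf: "\<And>E. E \<in> \<B> \<Longrightarrow> infinite E" and cap: "captured K A \<B>"
  shows "covered K A (\<Union>\<B>)"
proof -
  obtain E where E: "E \<in> \<B>" "\<And>a. a \<in> A \<Longrightarrow> E \<subseteq> NK K a"
  proof -
    have "\<exists>E\<in>\<B>. \<forall>a\<in>A. E \<subseteq> NK K a" using A cap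
    proof (induction A)
      case empty
      then show ?case using fin_base_nonempty[OF fb] by blast
    next
      case (insert a A)
      then obtain E F where E: "E \<in> \<B>" "\<forall>a\<in>A. E \<subseteq> NK K a" and F: "F \<in> \<B>" "F \<subseteq> NK K a"
        unfolding captured_def by blast
      obtain G where "G \<in> \<B>" "G \<subseteq> E \<inter> F" by (rule fin_base_directed[OF fb E(1) F(1)])
      then show ?case using E F by (intro bexI[of _ G]) auto
    qed
    then show thesis using that by blast
  qed
  have "\<forall>e\<in>E. \<forall>a\<in>A. \<exists>k. k \<in> K \<and> e \<in> N k a" using E(2) unfolding NK_def by blast
  then obtain g where g: "\<And>e a. e \<in> E \<Longrightarrow> a \<in> A \<Longrightarrow> g e a \<in> K \<and> e \<in> N (g e a) a" by metis
  have "(\<lambda>e. restrict (g e) A) ` E \<subseteq> A \<rightarrow>\<^sub>E K" using g by auto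
  then have "finite ((\<lambda>e. restrict (g e) A) ` E)" using finite_PiE[OF A, of "\<lambda>_. K"] K finite_subset by blast
  then obtain e0 where e0: "e0 \<in> E" "infinite {e\<in>E. restrict (g e) A = restrict (g e0) A}"
    using pigeonhole_infinite[OF inf[OF E(1)]] by blast
  define \<chi> where "\<chi> = g e0"
  define E' where "E' = {e\<in>E. restrict (g e) A = restrict (g e0) A}"
  have E': "e \<in> N (\<chi> a) a" if "e \<in> E'" "a \<in> A" for e a
  proof -
    have "restrict (g e) A a = restrict (g e0) A a" using that(1) unfolding E'_def by simp
    then have "g e a = \<chi> a" using that(2) unfolding \<chi>_def by simp
    then show ?thesis using g[of e a] that unfolding E'_def by auto
  qed
  have "A \<lesssim> E'" using e0(2) A finite_lepoll_infinite unfolding E'_def by blast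
  then obtain b where b: "inj_on b A" "b ` A \<subseteq> E'" unfolding lepoll_def by blast
  have "path_order k {a\<in>A. \<chi> a = k} b (card_of {a\<in>A. \<chi> a = k})" for k
  proof -
    let ?X = "{a\<in>A. \<chi> a = k}"
    have "inj_on b ?X" using b(1) by (rule inj_on_subset) blast
    moreover have mem: "b x \<in> N k w" if "x \<in> ?X" "w \<in> ?X" for x w
      using E'[of "b x" w] b(2) that by auto
    moreover have "\<exists>w\<in>underS (card_of ?X) x. (u, w) \<in> card_of ?X \<and> b x \<in> N k w"
      if "x \<in> ?X" "u \<in> underS (card_of ?X) x" for x u
    proof -
      have "u \<in> ?X" using that(2) in_card_of[of u x ?X] unfolding underS_def by blast
      then show ?thesis using that(2) card_of_refl[of u ?X] mem[OF that(1)] by blast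
    qed
    moreover have "well_order_on ?X (card_of ?X)" using card_of_Well_order[of ?X] by (simp add: Field_card_of)
    ultimately show ?thesis unfolding path_order_def by blast
  qed
  moreover have "\<chi> ` A \<subseteq> K" using g[OF e0(1)] unfolding \<chi>_def by blast
  moreover have "b ` A \<subseteq> \<Union>\<B>" using b(2) E(1) unfolding E'_def by blast
  ultimately show ?thesis unfolding covered_def using b(1)
    by (intro exI[of _ \<chi>] exI[of _ b] exI[of _ "\<lambda>k. card_of {a\<in>A. \<chi> a = k}"]) blast
qed

text \<open>\<open>M\<close> is separate from \<open>A\<close> because the points left over by
  \<open>colour_step\<close> may be fewer than the chains are long. \<open>fin_base_shrink\<close>
  restores the fit, and \<open>covered_finite\<close> takes over when finitely many points are
  left.\<close>

lemma covered_by_paths: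
  fixes M :: "'a set"
  assumes "finite K" "fin_base M \<B>" "big A \<B>" "\<And>E. E \<in> \<B> \<Longrightarrow> infinite E" "captured K A \<B>"
  shows "covered K A (\<Union>\<B>)"
  using assms
proof (induction K arbitrary: A \<B> M rule: finite_psubset_induct)
  case (psubset K)
  show ?case
  proof (cases "finite A")
    case True
    then show ?thesis using covered_finite psubset.hyps psubset.prems(1,3,4) by blast
  next
    case A: False
    have "\<exists>E\<in>\<B>. E \<subseteq> NK K x" if "x \<in> A" for x using psubset.prems(4) that unfolding captured_def by blast
    moreover have "A \<noteq> {}" using A by auto
    ultimately obtain \<B>' where B': "\<B>' \<subseteq> \<B>" "fin_base A \<B>'" "\<And>x. x \<in> A \<Longrightarrow> \<exists>E\<in>\<B>'. E \<subseteq> NK K x"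
      using fin_base_shrink[OF psubset.prems(1), of A "\<lambda>x E. E \<subseteq> NK K x"] by metis
    have big: "big A \<B>'" using psubset.prems(2) B'(1) unfolding big_def by blast
    have cap: "captured K A \<B>'" using B'(3) unfolding captured_def by blast
    obtain k A' b R \<C> where *: "k \<in> K" "A' \<subseteq> A" "A' \<approx> A" "path_order k A' b R" "b ` A' \<subseteq> \<Union>\<B>'"
        "\<And>x. x \<in> A' \<Longrightarrow> underS R x \<prec> A" "fin_base A \<C>" "big A \<C>" "captured (K - {k}) (A - A') \<C>"
        "\<Union>\<C> \<subseteq> \<Union>\<B>' - b ` A'"
      by (rule colour_step[OF A infinite_pathable psubset.hyps B'(2) big cap]) (assumption, rule that)
    have "big (A - A') \<C>" unfolding big_def
    proof
      fix E assume "E \<in> \<C>"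
      then have "A \<lesssim> E" using *(8) unfolding big_def by blast
      then show "A - A' \<lesssim> E" by (rule lepoll_trans[OF subset_imp_lepoll[OF Diff_subset]])
    qed
    moreover have "infinite E" if "E \<in> \<C>" for E
    proof -
      have "A \<lesssim> E" using *(8) that unfolding big_def by blast
      then show ?thesis using card_of_ordLeq_infinite[of A E] A by (simp add: lepoll_iff_card_of)
    qed
    moreover have "K - {k} \<subset> K" using *(1) by blast
    ultimately have "covered (K - {k}) (A - A') (\<Union>\<C>)" using *(9) by (intro psubset.IH[OF _ *(7)])
    then obtain \<chi> b2 R2 where c: "\<chi> ` (A - A') \<subseteq> K - {k}" "inj_on b2 (A - A')" "b2 ` (A - A') \<subseteq> \<Union>\<C>"
      "\<forall>j\<in>K - {k}. path_order j {a\<in>A - A'. \<chi> a = j} b2 (R2 j)" unfolding covered_def by (elim exE conjE) (rule that)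
    define \<chi>' where "\<chi>' = (\<lambda>a. if a \<in> A' then k else \<chi> a)"
    define b' where "b' = (\<lambda>a. if a \<in> A' then b a else b2 a)"
    have "inj_on b' A"
    proof (rule inj_onI)
      fix x y assume xy: "x \<in> A" "y \<in> A" "b' x = b' y"
      have b1: "inj_on b A'" using *(4) unfolding path_order_def by blast
      have d: "b u \<noteq> b2 v" if "u \<in> A'" "v \<in> A - A'" for u v using that *(10) c(3) by blast
      show "x = y"
      proof (cases "x \<in> A'"; cases "y \<in> A'")
        show ?thesis if "x \<in> A'" "y \<in> A'" using that xy(3) b1 unfolding b'_def inj_on_def by simp
        show ?thesis if "x \<in> A'" "y \<notin> A'" using that xy d[of x y] unfolding b'_def by simp
        show ?thesis if "x \<notin> A'" "y \<in> A'" using that xy d[of y x] unfolding b'_def by simp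
        show ?thesis if "x \<notin> A'" "y \<notin> A'" using that xy c(2) unfolding b'_def inj_on_def by simp
      qed
    qed
    moreover have "\<chi>' ` A \<subseteq> K" using c(1) *(1) unfolding \<chi>'_def by auto
    moreover have "b' ` A \<subseteq> \<Union>\<B>"
    proof
      fix y assume "y \<in> b' ` A"
      then obtain x where x: "x \<in> A" "y = b' x" by blast
      have "b' x \<in> \<Union>\<B>'"
      proof (cases "x \<in> A'")
        case True
        then show ?thesis using *(5) unfolding b'_def by auto
      next
        case False
        then have "b2 x \<in> \<Union>\<C>" using c(3) x(1) by blast
        then show ?thesis using False *(10) unfolding b'_def by auto
      qed
      then show "y \<in> \<Union>\<B>" using x(2) B'(1) by blast
    qed
    moreover have "path_order j {a\<in>A. \<chi>' a = j} b' ((R2(k := R)) j)" if j: "j \<in> K" for j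
    proof (cases "j = k")
      case True
      have "\<chi> a \<noteq> k" if "a \<in> A - A'" for a using c(1) that by blast
      then have "{a\<in>A. \<chi>' a = j} = A'" using True *(2) unfolding \<chi>'_def by auto
      moreover have "path_order k A' b' R" using *(4) by (rule path_order_cong) (simp add: b'_def)
      ultimately show ?thesis using True by simp
    next
      case False
      then have "{a\<in>A. \<chi>' a = j} = {a\<in>A - A'. \<chi> a = j}" unfolding \<chi>'_def by auto
      moreover have "path_order j {a\<in>A - A'. \<chi> a = j} b2 (R2 j)" using c(4) j False by blast
      then have "path_order j {a\<in>A - A'. \<chi> a = j} b' (R2 j)" by (rule path_order_cong) (simp add: b'_def)
      ultimately show ?thesis using False by simp
    qed
    ultimately show ?thesis unfolding covered_def
      by (intro exI[of _ \<chi>'] exI[of _ b'] exI[of _ "R2(k := R)"] conjI ballI)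
  qed
qed

end

section \<open>From the centering family to a base, and from path orders to paths\<close>

lemma nbh_iff:
  assumes "is_graph G" shows "w \<in> nbh G v \<longleftrightarrow> {v, w} \<in> edges G"
  using assms unfolding nbh_def is_graph_def by blast

lemma common_nbh_antimono: "F \<subseteq> F' \<Longrightarrow> common_nbh G F' \<subseteq> common_nbh G F"
  unfolding common_nbh_def by blast

text \<open>Larger sets have fewer common neighbours, so the increasing chains become a base of
  decreasing sets. The chains may be longer than \<open>|A|\<close>, hence the bound
  \<open>UNIV\<close>, which \<open>fin_base_shrink\<close> lowers later. For \<open>I = {}\<close>
  the only list is empty and the base is \<open>{common_nbh G A}\<close>.\<close>

lemma centered_fin_base:
  fixes A :: "'a set" and \<Lambda> :: "'i \<Rightarrow> 'o rel" and \<S> :: "'i \<Rightarrow> 'o \<Rightarrow> 'a set"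
  assumes cen: "centered G A I \<Lambda> \<S> \<kappa>" and A: "A \<noteq> {}"
  obtains \<B> where "fin_base (UNIV :: 'a set set) \<B>" "\<And>E. E \<in> \<B> \<Longrightarrow> \<kappa> \<le>o card_of E"
    "\<And>a. a \<in> A \<Longrightarrow> \<exists>E\<in>\<B>. E \<subseteq> nbh G a"
proof -
  have fin: "finite I" and wo: "\<And>i. i \<in> I \<Longrightarrow> Well_order (\<Lambda> i)"
    and mono: "\<And>i \<alpha> \<beta>. i \<in> I \<Longrightarrow> \<beta> \<in> Field (\<Lambda> i) \<Longrightarrow> \<alpha> \<in> underS (\<Lambda> i) \<beta> \<Longrightarrow> \<S> i \<alpha> \<subseteq> \<S> i \<beta>"
    and cover: "\<And>i. i \<in> I \<Longrightarrow> A \<subseteq> (\<Union>\<alpha>\<in>Field (\<Lambda> i). \<S> i \<alpha>)"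
    and large: "\<And>\<alpha>. \<alpha> \<in> (\<Pi>\<^sub>E i\<in>I. Field (\<Lambda> i)) \<Longrightarrow>
      \<kappa> \<le>o card_of (common_nbh G (if I = {} then A else \<Inter>i\<in>I. \<S> i (\<alpha> i)))"
    using cen unfolding centered_def by simp_all
  obtain xs where xs: "set xs = I" "distinct xs" using finite_distinct_list[OF fin] by blast
  define Cs where "Cs = map (\<lambda>i. \<S> i ` Field (\<Lambda> i)) xs"
  define f where "f = (\<lambda>Fs. common_nbh G (if I = {} then A else \<Inter>(set Fs)))"
  show thesis
  proof (rule that[of "f ` listset Cs"])
    show "fin_base (UNIV :: 'a set set) (f ` listset Cs)"
      unfolding fin_base_def
    proof (intro exI[of _ Cs] exI[of _ f] conjI refl ballI impI)
      fix C assume "C \<in> set Cs"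
      then obtain i where i: "i \<in> I" "C = \<S> i ` Field (\<Lambda> i)" unfolding Cs_def using xs(1) by auto
      show "C \<noteq> {}" using cover[OF i(1)] A i(2) by blast
      show "C \<lesssim> (UNIV :: 'a set set)" by (rule subset_imp_lepoll) simp
      show "chain_subset C" unfolding chain_subset_def
      proof (intro ballI)
        fix S T assume "S \<in> C" "T \<in> C"
        then obtain \<alpha> \<beta> where ab: "\<alpha> \<in> Field (\<Lambda> i)" "\<beta> \<in> Field (\<Lambda> i)" "S = \<S> i \<alpha>" "T = \<S> i \<beta>"
          using i(2) by blast
        have "\<alpha> = \<beta> \<or> \<alpha> \<in> underS (\<Lambda> i) \<beta> \<or> \<beta> \<in> underS (\<Lambda> i) \<alpha>"
          using well_order_onD(5)[OF wo[OF i(1)]] ab(1,2) unfolding total_on_def underS_def by blast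
        then show "S \<subseteq> T \<or> T \<subseteq> S" using mono[OF i(1)] ab by blast
      qed
    next
      fix Fs Hs :: "'a set list"
      assume "list_all2 (\<subseteq>) Fs Hs"
      then have "\<Inter>(set Fs) \<subseteq> \<Inter>(set Hs)" by (induction rule: list_all2_induct) auto
      then show "f Hs \<subseteq> f Fs" unfolding f_def by (simp add: common_nbh_antimono)
    qed
  next
    fix E assume "E \<in> f ` listset Cs"
    then obtain Fs where Fs: "Fs \<in> listset Cs" "E = f Fs" by blast
    have len: "length Fs = length xs" and nth: "\<And>j. j < length xs \<Longrightarrow> Fs ! j \<in> \<S> (xs ! j) ` Field (\<Lambda> (xs ! j))"
      using Fs(1) unfolding listset_iff Cs_def by (auto simp: list_all2_conv_all_nth)
    \<comment> \<open>Entries of the list are translated back into indices: \<open>g j\<close> names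
      the entry at position \<open>j\<close>, and \<open>pos\<close> inverts the enumeration
      \<open>xs\<close> of \<open>I\<close>.\<close>
    have "\<forall>j\<in>{..<length xs}. \<exists>\<alpha>. \<alpha> \<in> Field (\<Lambda> (xs ! j)) \<and> Fs ! j = \<S> (xs ! j) \<alpha>" using nth by blast
    then obtain g where "\<forall>j\<in>{..<length xs}. g j \<in> Field (\<Lambda> (xs ! j)) \<and> Fs ! j = \<S> (xs ! j) (g j)"
      by (rule bchoice[THEN exE])
    then have g: "g j \<in> Field (\<Lambda> (xs ! j))" "Fs ! j = \<S> (xs ! j) (g j)" if "j < length xs" for j
      using that by simp_all
    have bij: "bij_betw ((!) xs) {..<length xs} I" using bij_betw_nth[OF xs(2)] xs(1) by blast
    define pos where "pos = inv_into {..<length xs} ((!) xs)"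
    have pos: "pos i < length xs" "xs ! pos i = i" if "i \<in> I" for i
      using bij that inv_into_into[of i "(!) xs" "{..<length xs}"] f_inv_into_f[of i "(!) xs" "{..<length xs}"]
      unfolding pos_def bij_betw_def by auto
    have posn: "pos (xs ! j) = j" if "j < length xs" for j
      unfolding pos_def using bij that by (intro inv_into_f_f) (auto simp: bij_betw_def)
    define \<alpha> where "\<alpha> = restrict (\<lambda>i. g (pos i)) I"
    have "g (pos i) \<in> Field (\<Lambda> i)" if "i \<in> I" for i
      using g(1)[OF pos(1)[OF that]] pos(2)[OF that] by simp
    then have \<alpha>: "\<alpha> \<in> (\<Pi>\<^sub>E i\<in>I. Field (\<Lambda> i))" unfolding \<alpha>_def by simp
    have eq: "(\<Inter>i\<in>I. \<S> i (\<alpha> i)) = \<Inter>(set Fs)"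
    proof -
      have "(\<lambda>i. \<S> i (\<alpha> i)) ` I = (\<lambda>i. \<S> i (g (pos i))) ` I" unfolding \<alpha>_def by (rule image_cong) simp_all
      also have "\<dots> = (\<lambda>i. \<S> i (g (pos i))) ` ((!) xs ` {..<length xs})"
        using bij by (simp add: bij_betw_def)
      also have "\<dots> = (!) Fs ` {..<length xs}"
        unfolding image_image by (rule image_cong) (simp_all add: g(2) posn)
      also have "\<dots> = set Fs" using len by (auto simp: set_conv_nth)
      finally show ?thesis by simp
    qed
    show "\<kappa> \<le>o card_of E" using large[OF \<alpha>] unfolding Fs(2) f_def eq .
  next
    fix a assume a: "a \<in> A"
    have "\<forall>i\<in>I. \<exists>\<alpha>. \<alpha> \<in> Field (\<Lambda> i) \<and> a \<in> \<S> i \<alpha>" using cover a by blast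
    then obtain \<alpha> where \<alpha>: "\<forall>i\<in>I. \<alpha> i \<in> Field (\<Lambda> i) \<and> a \<in> \<S> i (\<alpha> i)" by (rule bchoice[THEN exE])
    let ?Fs = "map (\<lambda>i. \<S> i (\<alpha> i)) xs"
    have "?Fs \<in> listset Cs"
      using \<alpha> xs(1) unfolding listset_iff Cs_def by (auto simp: list_all2_conv_all_nth)
    moreover have "a \<in> (if I = {} then A else \<Inter>(set ?Fs))" using \<alpha> xs(1) a by auto
    then have "f ?Fs \<subseteq> nbh G a" unfolding f_def common_nbh_def by blast
    ultimately show "\<exists>E\<in>f ` listset Cs. E \<subseteq> nbh G a" by blast
  qed
qed

theorem theorem6p2:
  fixes \<kappa> :: "'k rel" and G :: "'a graph" and A B :: "'a set"
    and I :: "'i set" and \<Lambda> :: "'i \<Rightarrow> 'o rel" and \<S> :: "'i \<Rightarrow> 'o \<Rightarrow> 'a set"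
    and c :: "'a set \<Rightarrow> nat" and r :: nat
  assumes "Card_order \<kappa>" and "infinite (Field \<kappa>)"
    and "bipartite G A B"
    and "|A| =o \<kappa>"
    and "centered G A I \<Lambda> \<S> \<kappa>"
    and "c \<in> edges G \<rightarrow> {..<r}"
  shows "\<exists>J P. J \<subseteq> {..<r} \<and>
           (\<forall>i \<in> J. mono_path G c i (P i)) \<and>
           disjoint_family_on (\<lambda>i. verts (P i)) J \<and>
           A \<subseteq> (\<Union>i \<in> J. verts (P i))"
proof -
  have graph: "is_graph G" and AB: "A \<inter> B = {}" and VG: "verts G = A \<union> B"
    and edge: "\<And>e. e \<in> edges G \<Longrightarrow> \<exists>a\<in>A. \<exists>b\<in>B. e = {a, b}"
    using assms(3) unfolding bipartite_def by simp_all
  have Ainf: "infinite A"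
    using card_of_ordIso_finite_Field[OF assms(1) ordIso_symmetric[OF assms(4)]] assms(2) by simp
  then have "A \<noteq> {}" by auto
  define N where "N = (\<lambda>k a. {b. {a, b} \<in> edges G \<and> c {a, b} = k})"
  interpret coloured_nbhds N .
  have NB: "b \<in> B" if "b \<in> N k a" "a \<in> A" for k a b
  proof -
    have "{a, b} \<in> edges G" using that(1) unfolding N_def by simp
    then obtain a' b' where "a' \<in> A" "b' \<in> B" "{a, b} = {a', b'}" using edge by blast
    then show ?thesis using AB that(2) by (auto simp: doubleton_eq_iff)
  qed
  obtain \<B> where \<B>: "fin_base (UNIV :: 'a set set) \<B>" "\<And>E. E \<in> \<B> \<Longrightarrow> \<kappa> \<le>o card_of E"
    "\<And>a. a \<in> A \<Longrightarrow> \<exists>E\<in>\<B>. E \<subseteq> nbh G a"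
    by (rule centered_fin_base[OF assms(5) \<open>A \<noteq> {}\<close>]) (rule that)
  obtain \<C> where \<C>: "\<C> \<subseteq> \<B>" "fin_base A \<C>" "\<And>a. a \<in> A \<Longrightarrow> \<exists>E\<in>\<C>. E \<subseteq> nbh G a"
    by (rule fin_base_shrink[where Q = "\<lambda>a E. E \<subseteq> nbh G a", OF \<B>(1) \<open>A \<noteq> {}\<close> \<B>(3)])
      (assumption, rule that)
  have large: "A \<lesssim> E" if "E \<in> \<C>" for E
    unfolding lepoll_iff_card_of using ordIso_ordLeq_trans[OF assms(4) \<B>(2)] that \<C>(1) by blast
  have "infinite E" if "E \<in> \<C>" for E
    using large[OF that] card_of_ordLeq_infinite[of A E] Ainf by (simp add: lepoll_iff_card_of)
  moreover have "nbh G a \<subseteq> NK {..<r} a" for a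
  proof
    fix x assume "x \<in> nbh G a"
    then have e: "{a, x} \<in> edges G" using nbh_iff[OF graph] by blast
    then have "c {a, x} \<in> {..<r}" using assms(6) by blast
    moreover have "x \<in> N (c {a, x}) a" using e unfolding N_def by simp
    ultimately show "x \<in> NK {..<r} a" unfolding NK_def by blast
  qed
  then have "captured {..<r} A \<C>" using \<C>(3) unfolding captured_def by (meson order_trans)
  ultimately have "covered {..<r} A (\<Union>\<C>)"
    using \<C>(2) large by (intro covered_by_paths) (auto simp: big_def)
  then obtain \<chi> b R where cov: "\<chi> ` A \<subseteq> {..<r}" "inj_on b A"
    "\<forall>k\<in>{..<r}. path_order k {a\<in>A. \<chi> a = k} b (R k)"
    unfolding covered_def by (elim exE conjE) (rule that)
  define X where "X = (\<lambda>k. {a\<in>A. \<chi> a = k})"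
  define V where "V = (\<lambda>k. \<Union>x\<in>X k. insert (b x) {x})"
  \<comment> \<open>All edges of colour \<open>k\<close> inside \<open>V k\<close> are kept; further
    edges cannot spoil cofinality.\<close>
  define P where "P = (\<lambda>k. (V k, {e\<in>edges G. c e = k \<and> e \<subseteq> V k}))"
  have po: "path_order k (X k) b (R k)" if "k < r" for k using cov(3) that unfolding X_def by blast
  have bN: "b x \<in> N k x" if "k < r" "x \<in> X k" for k x using po[OF that(1)] that(2) unfolding path_order_def by blast
  have bB: "b x \<in> B" if "x \<in> A" for x
  proof -
    have "\<chi> x < r" "x \<in> X (\<chi> x)" using that cov(1) unfolding X_def by auto
    then show ?thesis using bN NB that by blast
  qed
  have XA: "X k \<subseteq> A" for k unfolding X_def by blast
  have path: "mono_path G c k (P k)" if k: "k < r" for k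
  proof -
    have PG: "is_graph (P k)" using graph unfolding is_graph_def P_def by auto
    have VkG: "V k \<subseteq> verts G" using XA bB unfolding V_def VG by blast
    let ?W = "\<lambda>x. insert (b x) {x}" and ?O = "\<lambda>x. pair_order (b x) {x}"
    have wR: "well_order_on (X k) (R k)" using po[OF k] unfolding path_order_def by blast
    note R = well_order_onD[OF wR]
    have ne: "b x \<noteq> x'" if "x \<in> X k" "x' \<in> X k" for x x'
      using subsetD[OF XA that(1)] subsetD[OF XA that(2)] bB AB by auto
    have inj: "x = x'" if "x \<in> X k" "x' \<in> X k" "b x = b x'" for x x'
      using cov(2) that XA unfolding inj_on_def by blast
    have woW: "well_order_on (?W x) (?O x)" if "x \<in> X k" for x
      by (rule well_order_on_pair_order) (use ne[OF that that] in auto)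
    have disj: "?W x \<inter> ?W x' = {}" if "x \<in> X k" "x' \<in> X k" "x \<noteq> x'" for x x'
      using that ne[OF that(1,2)] ne[OF that(2,1)] inj[OF that(1,2)] by auto
    \<comment> \<open>In the order of \<open>X k\<close> every \<open>x\<close> is replaced by its
      link \<open>b x\<close> followed by \<open>x\<close>.\<close>
    let ?T = "wo_sum (R k) ?W ?O"
    have wT: "well_order_on (V k) ?T"
      unfolding V_def by (rule well_order_on_wo_sum[where W = ?W and R = ?O, OF wR woW disj])
    have under: "underS ?T v = (\<Union>y\<in>underS (R k) x. ?W y) \<union> underS (?O x) v" if "x \<in> X k" "v \<in> ?W x" for x v
      by (rule underS_wo_sum[where W = ?W and R = ?O, OF wR disj woW that])
    have ub: "underS ?T (b x) = (\<Union>y\<in>underS (R k) x. ?W y)" if "x \<in> X k" for x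
      using under[OF that, of "b x"] by (simp add: underS_pair_order(1))
    have ux: "underS ?T x = (\<Union>y\<in>underS (R k) x. ?W y) \<union> {b x}" if "x \<in> X k" for x
      using under[OF that, of x] underS_pair_order(2)[of x "{x}" "b x"] ne[OF that that] by auto
    have nb: "w \<in> nbh (P k) v" if "{v, w} \<in> edges G" "c {v, w} = k" "v \<in> V k" "w \<in> V k" for v w
      unfolding nbh_iff[OF PG] using that unfolding P_def by simp
    have inV: "x \<in> V k" "b x \<in> V k" if "x \<in> X k" for x using that unfolding V_def by blast+
    \<comment> \<open>A vertex \<open>x\<close> is joined to \<open>b x\<close>, the last element
      before it; the cofinal neighbours of a link are those given by
      \<open>path_order\<close>.\<close>
    have "\<exists>w\<in>nbh (P k) v \<inter> underS ?T v. (u, w) \<in> ?T" if v: "v \<in> V k" and u: "u \<in> underS ?T v" for v u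
    proof -
      obtain x where x: "x \<in> X k" "v = b x \<or> v = x" using v unfolding V_def by blast
      have refl: "(y, y) \<in> R k" if "y \<in> X k" for y by (rule refl_onD[OF R(2) that])
      show ?thesis
      proof (cases "v = x")
        case True
        have "{x, b x} \<in> edges G" "c {x, b x} = k" using bN[OF k x(1)] unfolding N_def by simp_all
        then have "b x \<in> nbh (P k) v" using nb[of x "b x"] inV[OF x(1)] True by blast
        moreover have "b x \<in> underS ?T v" using ux[OF x(1)] True by blast
        moreover have "(u, b x) \<in> ?T"
        proof (cases "u = b x")
          case True
          then show ?thesis using refl[OF x(1)] by (intro wo_sum_intro2[of x]) (auto simp: pair_order_def)
        next
          case False
          then obtain y where "y \<in> underS (R k) x" "u \<in> ?W y" using u ux[OF x(1)] \<open>v = x\<close> by blast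
          then show ?thesis unfolding underS_def by (intro wo_sum_intro1[of y x]) auto
        qed
        ultimately show ?thesis by blast
      next
        case False
        then have vb: "v = b x" using x(2) by blast
        then obtain y where y: "y \<in> underS (R k) x" "u \<in> ?W y" using u ub[OF x(1)] by blast
        then obtain w where w: "w \<in> underS (R k) x" "(y, w) \<in> R k" "b x \<in> N k w"
          using po[OF k] x(1) unfolding path_order_def by blast
        have wX: "w \<in> X k" using w(2) R(1) by blast
        have "{b x, w} \<in> edges G" "c {b x, w} = k" using w(3) unfolding N_def by (simp_all add: insert_commute)
        then have "w \<in> nbh (P k) v" using nb[of "b x" w] inV(2)[OF x(1)] inV(1)[OF wX] vb by blast
        moreover have "w \<in> underS ?T v" using ub[OF x(1)] w(1) vb by blast
        moreover have "(u, w) \<in> ?T"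
        proof (cases "y = w")
          case True
          then show ?thesis using y(2) refl[OF wX] by (intro wo_sum_intro2[of w]) (auto simp: pair_order_def)
        next
          case False
          then show ?thesis using y(2) w(2) by (intro wo_sum_intro1[of y w]) auto
        qed
        ultimately show ?thesis by blast
      qed
    qed
    moreover have "verts (P k) = V k" unfolding P_def by simp
    ultimately have "rado_path (P k)" unfolding rado_path_def using PG wT by (intro conjI exI[of _ ?T]) simp_all
    moreover have "subgraph (P k) (colour_graph G c k)"
      using PG VkG unfolding subgraph_def colour_graph_def P_def by auto
    ultimately show ?thesis unfolding mono_path_def by blast
  qed
  have "disjoint_family_on (\<lambda>k. verts (P k)) {..<r}"
    unfolding disjoint_family_on_def
  proof (intro ballI impI)
    fix k j assume kj: "k \<in> {..<r}" "j \<in> {..<r}" "k \<noteq> j"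
    have *: "x \<noteq> y" if "x \<in> X k" "y \<in> X j" for x y using that kj(3) unfolding X_def by blast
    have "b x \<noteq> b y" if "x \<in> X k" "y \<in> X j" for x y
      using *[OF that] that XA cov(2) unfolding inj_on_def by blast
    moreover have "b x \<noteq> y" if "x \<in> A" "y \<in> A" for x y using bB[OF that(1)] that(2) AB by blast
    ultimately have "V k \<inter> V j = {}" using * XA[of k] XA[of j] unfolding V_def by blast
    then show "verts (P k) \<inter> verts (P j) = {}" unfolding P_def by simp
  qed
  moreover have "A \<subseteq> (\<Union>k\<in>{..<r}. verts (P k))"
  proof
    fix a assume a: "a \<in> A"
    then have "\<chi> a \<in> {..<r}" "a \<in> V (\<chi> a)" using cov(1) unfolding V_def X_def by blast+
    then show "a \<in> (\<Union>k\<in>{..<r}. verts (P k))" unfolding P_def by auto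
  qed
  \<comment> \<open>All colours are taken as indices; a colour without points contributes the empty
    path.\<close>
  ultimately show ?thesis using path by (intro exI[of _ "{..<r}"] exI[of _ P]) auto
qed

end
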